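(* Let $(R,\mathfrak m)$ be a Cohen-Macaulay local ring of at most countable Cohen-Macaulay type with uncountable residue field. If $\underline{x}$ is a general system of parameters of $R$, then for any ideal $I$ of $R$, $$\mathfrak m\bigl((\underline{x}):((\underline{x}):I)\bigr)\subseteq (\underline{x})+I .$$
   Context: All rings are commutative and Noetherian. A maximal Cohen-Macaulay (MCM) $R$-module is a nonzero finitely generated $R$-module $M$ for which there is an $M$-regular sequence of length $\dim R$ in $\mathfrak m$. A Cohen-Macaulay local ring has countable Cohen-Macaulay type if it has only countably many isomorphism classes of indecomposable MCM modules. Let $\{M_i\}_i$ be a complete list, up to isomorphism, of the indecomposable MCM $R$-modules, and let $\Lambda$ be the set of all annihilators of the modules $\operatorname{Ext}^i_R(M_j,M_k)$ for $i\ge 1$ and all $j,k$. An element $x\in R$ is called a general element if $x$ is not in the union of the proper ideals in $\Lambda$ other than possibly $\mathfrak m$. A general system of parameters is a system of parameters $\underline{x}$ such that the ideal $(\underline{x})$ contains a general element. Colon ideals are taken in $R$. *)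

theory Defs
  imports
    "HOL-Algebra.Algebra"
    "HOL-Library.Extended_Nat"
    "HOL-Library.Countable_Set"
begin

section \<open>Ideals and local rings\<close>

definition colon_ideal :: "('a, 'r) ring_scheme \<Rightarrow> 'a set \<Rightarrow> 'a set \<Rightarrow> 'a set" where
  "colon_ideal R A B = {r \<in> carrier R. \<forall>b \<in> B. r \<otimes>\<^bsub>R\<^esub> b \<in> A}"

definition radical :: "('a, 'r) ring_scheme \<Rightarrow> 'a set \<Rightarrow> 'a set" where
  "radical R A = {r \<in> carrier R. \<exists>n::nat. r [^]\<^bsub>R\<^esub> n \<in> A}"

definition krull_dim :: "('a, 'r) ring_scheme \<Rightarrow> enat" where
  "krull_dim R = (SUP n \<in> {n::nat. \<exists>P. (\<forall>i\<le>n. primeideal (P i) R) \<and> (\<forall>i<n. P i \<subset> P (Suc i))}. enat n)"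

definition noetherian_local_ring :: "('a, 'r) ring_scheme \<Rightarrow> 'a set \<Rightarrow> bool" where
  "noetherian_local_ring R \<mm> \<longleftrightarrow>
     cring R \<and> noetherian_ring R \<and> maximalideal \<mm> R \<and> (\<forall>\<nn>. maximalideal \<nn> R \<longrightarrow> \<nn> = \<mm>)"

text \<open>The ideal generated by the sequence is primary to the maximal ideal exactly when its
  radical is the maximal ideal.\<close>

definition system_of_parameters :: "('a, 'r) ring_scheme \<Rightarrow> 'a set \<Rightarrow> 'a list \<Rightarrow> bool" where
  "system_of_parameters R \<mm> xs \<longleftrightarrow>
     set xs \<subseteq> \<mm> \<and> enat (length xs) = krull_dim R \<and> radical R (genideal R (set xs)) = \<mm>"


section \<open>Modules\<close>

text \<open>The record type of modules extends that of rings; the ring multiplication and unit of a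
  module play no role and are left undefined below.\<close>

definition regular_module :: "('a, 'r) ring_scheme \<Rightarrow> ('a, 'a) module" where
  "regular_module R =
     \<lparr>carrier = carrier R, monoid.mult = undefined, one = undefined,
      ring.zero = \<zero>\<^bsub>R\<^esub>, ring.add = (\<oplus>\<^bsub>R\<^esub>), smult = (\<otimes>\<^bsub>R\<^esub>)\<rparr>"

definition free_module :: "('a, 'r) ring_scheme \<Rightarrow> nat \<Rightarrow> ('a, nat \<Rightarrow> 'a) module" where
  "free_module R n =
     \<lparr>carrier = {..<n} \<rightarrow>\<^sub>E carrier R, monoid.mult = undefined, one = undefined,
      ring.zero = (\<lambda>i\<in>{..<n}. \<zero>\<^bsub>R\<^esub>),
      ring.add = (\<lambda>v w. \<lambda>i\<in>{..<n}. v i \<oplus>\<^bsub>R\<^esub> w i),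
      smult = (\<lambda>a v. \<lambda>i\<in>{..<n}. a \<otimes>\<^bsub>R\<^esub> v i)\<rparr>"

definition quotient_module :: "('a, 'b, 'm) module_scheme \<Rightarrow> 'b set \<Rightarrow> ('a, 'b set) module" where
  "quotient_module M L =
     \<lparr>carrier = a_rcosets\<^bsub>M\<^esub> L, monoid.mult = undefined, one = undefined,
      ring.zero = L, ring.add = set_add M,
      smult = (\<lambda>a C. \<Union>x\<in>C. L +>\<^bsub>M\<^esub> (a \<odot>\<^bsub>M\<^esub> x))\<rparr>"

definition module_span :: "('a, 'r) ring_scheme \<Rightarrow> ('a, 'b, 'm) module_scheme \<Rightarrow> 'b set \<Rightarrow> 'b set" where
  "module_span R M S = \<Inter>{N. submodule N R M \<and> S \<subseteq> N}"

definition finitely_generated :: "('a, 'r) ring_scheme \<Rightarrow> ('a, 'b, 'm) module_scheme \<Rightarrow> bool" where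
  "finitely_generated R M \<longleftrightarrow> (\<exists>S. finite S \<and> S \<subseteq> carrier M \<and> module_span R M S = carrier M)"

definition ideal_smult ::
  "('a, 'r) ring_scheme \<Rightarrow> 'a set \<Rightarrow> ('a, 'b, 'm) module_scheme \<Rightarrow> 'b set" where
  "ideal_smult R A M = module_span R M {a \<odot>\<^bsub>M\<^esub> x | a x. a \<in> A \<and> x \<in> carrier M}"

definition annihilator :: "('a, 'r) ring_scheme \<Rightarrow> ('a, 'b, 'm) module_scheme \<Rightarrow> 'a set" where
  "annihilator R M = {a \<in> carrier R. \<forall>x \<in> carrier M. a \<odot>\<^bsub>M\<^esub> x = \<zero>\<^bsub>M\<^esub>}"

definition mod_hom ::
  "('a, 'r) ring_scheme \<Rightarrow> ('a, 'b, 'm) module_scheme \<Rightarrow> ('a, 'c, 'n) module_scheme \<Rightarrow> ('b \<Rightarrow> 'c) set" where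
  "mod_hom R M N =
     {f \<in> hom (add_monoid M) (add_monoid N).
        \<forall>a \<in> carrier R. \<forall>x \<in> carrier M. f (a \<odot>\<^bsub>M\<^esub> x) = a \<odot>\<^bsub>N\<^esub> f x}"

definition module_iso ::
  "('a, 'r) ring_scheme \<Rightarrow> ('a, 'b, 'm) module_scheme \<Rightarrow> ('a, 'c, 'n) module_scheme \<Rightarrow> bool" where
  "module_iso R M N \<longleftrightarrow> (\<exists>f \<in> mod_hom R M N. bij_betw f (carrier M) (carrier N))"

definition indecomposable :: "('a, 'r) ring_scheme \<Rightarrow> ('a, 'b, 'm) module_scheme \<Rightarrow> bool" where
  "indecomposable R M \<longleftrightarrow>
     carrier M \<noteq> {\<zero>\<^bsub>M\<^esub>} \<and>
     (\<forall>A B. submodule A R M \<and> submodule B R M \<and> A <+>\<^bsub>M\<^esub> B = carrier M \<and> A \<inter> B = {\<zero>\<^bsub>M\<^esub>}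
        \<longrightarrow> A = {\<zero>\<^bsub>M\<^esub>} \<or> B = {\<zero>\<^bsub>M\<^esub>})"


section \<open>Ext\<close>

text \<open>Homomorphisms are made extensional, so that equality in the Hom module is equality of maps.\<close>

definition Hom_module ::
  "('a, 'r) ring_scheme \<Rightarrow> ('a, 'b, 'm) module_scheme \<Rightarrow> ('a, 'c, 'n) module_scheme \<Rightarrow> ('a, 'b \<Rightarrow> 'c) module" where
  "Hom_module R M N =
     \<lparr>carrier = mod_hom R M N \<inter> extensional (carrier M), monoid.mult = undefined, one = undefined,
      ring.zero = (\<lambda>x\<in>carrier M. \<zero>\<^bsub>N\<^esub>),
      ring.add = (\<lambda>f g. \<lambda>x\<in>carrier M. f x \<oplus>\<^bsub>N\<^esub> g x),
      smult = (\<lambda>a f. \<lambda>x\<in>carrier M. a \<odot>\<^bsub>N\<^esub> f x)\<rparr>"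

text \<open>A resolution by free modules of finite rank, with ranks \<open>b\<close>, differentials
  \<open>d i : R^(b (i+1)) \<rightarrow> R^(b i)\<close> and augmentation \<open>\<epsilon> : R^(b 0) \<rightarrow> M\<close>. Every finitely
  generated module over a Noetherian ring has one.\<close>

definition free_resolution ::
  "('a, 'r) ring_scheme \<Rightarrow> ('a, 'b, 'm) module_scheme \<Rightarrow> (nat \<Rightarrow> nat)
     \<Rightarrow> (nat \<Rightarrow> (nat \<Rightarrow> 'a) \<Rightarrow> (nat \<Rightarrow> 'a)) \<Rightarrow> ((nat \<Rightarrow> 'a) \<Rightarrow> 'b) \<Rightarrow> bool" where
  "free_resolution R M b d \<epsilon> \<longleftrightarrow>
     \<epsilon> \<in> mod_hom R (free_module R (b 0)) M \<and>
     \<epsilon> ` carrier (free_module R (b 0)) = carrier M \<and>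
     (\<forall>i. d i \<in> mod_hom R (free_module R (b (Suc i))) (free_module R (b i))) \<and>
     d 0 ` carrier (free_module R (b 1)) = a_kernel (free_module R (b 0)) M \<epsilon> \<and>
     (\<forall>i. d (Suc i) ` carrier (free_module R (b (Suc (Suc i)))) =
            a_kernel (free_module R (b (Suc i))) (free_module R (b i)) (d i))"

context
  fixes R :: "('a, 'r) ring_scheme" and b :: "nat \<Rightarrow> nat"
    and d :: "nat \<Rightarrow> (nat \<Rightarrow> 'a) \<Rightarrow> (nat \<Rightarrow> 'a)" and N :: "('a, 'c, 'n) module_scheme"
begin

definition Hom_cochains :: "nat \<Rightarrow> ('a, (nat \<Rightarrow> 'a) \<Rightarrow> 'c) module" where
  "Hom_cochains i = Hom_module R (free_module R (b i)) N"

definition Hom_coboundary :: "nat \<Rightarrow> ((nat \<Rightarrow> 'a) \<Rightarrow> 'c) \<Rightarrow> ((nat \<Rightarrow> 'a) \<Rightarrow> 'c)" where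
  "Hom_coboundary i f = compose (carrier (free_module R (b (Suc i)))) f (d i)"

definition Hom_cocycles :: "nat \<Rightarrow> ((nat \<Rightarrow> 'a) \<Rightarrow> 'c) set" where
  "Hom_cocycles i = a_kernel (Hom_cochains i) (Hom_cochains (Suc i)) (Hom_coboundary i)"

definition Hom_coboundaries :: "nat \<Rightarrow> ((nat \<Rightarrow> 'a) \<Rightarrow> 'c) set" where
  "Hom_coboundaries i =
     (case i of 0 \<Rightarrow> {\<zero>\<^bsub>Hom_cochains 0\<^esub>}
      | Suc j \<Rightarrow> Hom_coboundary j ` carrier (Hom_cochains j))"

definition Hom_cohomology :: "nat \<Rightarrow> ('a, ((nat \<Rightarrow> 'a) \<Rightarrow> 'c) set) module" where
  "Hom_cohomology i =
     quotient_module (Hom_cochains i\<lparr>carrier := Hom_cocycles i\<rparr>) (Hom_coboundaries i)"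

end

text \<open>\<open>Ext R i M N\<close> is the cohomology of \<open>Hom(F, N)\<close> for a chosen resolution \<open>F\<close> of the finitely
  generated module \<open>M\<close>; up to isomorphism it does not depend on the choice.\<close>

definition Ext ::
  "('a, 'r) ring_scheme \<Rightarrow> nat \<Rightarrow> ('a, 'b, 'm) module_scheme \<Rightarrow> ('a, 'c, 'n) module_scheme
     \<Rightarrow> ('a, ((nat \<Rightarrow> 'a) \<Rightarrow> 'c) set) module" where
  "Ext R i M N =
     (let F = (SOME F. \<exists>\<epsilon>. free_resolution R M (fst F) (snd F) \<epsilon>)
      in Hom_cohomology R (fst F) (snd F) N i)"


section \<open>Maximal Cohen--Macaulay modules\<close>

definition nonzerodivisor_on ::
  "('a, 'r) ring_scheme \<Rightarrow> ('a, 'b, 'm) module_scheme \<Rightarrow> 'a \<Rightarrow> bool" where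
  "nonzerodivisor_on R M a \<longleftrightarrow>
     a \<in> carrier R \<and> (\<forall>x \<in> carrier M. a \<odot>\<^bsub>M\<^esub> x = \<zero>\<^bsub>M\<^esub> \<longrightarrow> x = \<zero>\<^bsub>M\<^esub>)"

definition regular_sequence ::
  "('a, 'r) ring_scheme \<Rightarrow> ('a, 'b, 'm) module_scheme \<Rightarrow> 'a list \<Rightarrow> bool" where
  "regular_sequence R M xs \<longleftrightarrow>
     (\<forall>i < length xs.
        nonzerodivisor_on R
          (quotient_module M (ideal_smult R (genideal R (set (take i xs))) M)) (xs ! i)) \<and>
     ideal_smult R (genideal R (set xs)) M \<noteq> carrier M"

definition MCM :: "('a, 'r) ring_scheme \<Rightarrow> 'a set \<Rightarrow> ('a, 'b, 'm) module_scheme \<Rightarrow> bool" where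
  "MCM R \<mm> M \<longleftrightarrow>
     module R M \<and> carrier M \<noteq> {\<zero>\<^bsub>M\<^esub>} \<and> finitely_generated R M \<and>
     (\<exists>xs. set xs \<subseteq> \<mm> \<and> regular_sequence R M xs \<and> enat (length xs) = krull_dim R)"

definition cohen_macaulay_local_ring :: "('a, 'r) ring_scheme \<Rightarrow> 'a set \<Rightarrow> bool" where
  "cohen_macaulay_local_ring R \<mm> \<longleftrightarrow>
     noetherian_local_ring R \<mm> \<and>
     (\<exists>xs. set xs \<subseteq> \<mm> \<and> regular_sequence R (regular_module R) xs \<and> enat (length xs) = krull_dim R)"

text \<open>Isomorphism classes of finitely generated modules are formed inside one fixed carrier type.
  It is large enough: every finitely generated module is a quotient of some \<open>R^n\<close>, whose elements
  are cosets, that is, sets of vectors (see \<open>finitely_generated_representable\<close> below).\<close>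

type_synonym 'a fg_module = "('a, (nat \<Rightarrow> 'a) set) module"

definition indecomposable_MCMs :: "('a, 'r) ring_scheme \<Rightarrow> 'a set \<Rightarrow> 'a fg_module set" where
  "indecomposable_MCMs R \<mm> = {M. MCM R \<mm> M \<and> indecomposable R M}"

definition countable_CM_type :: "('a, 'r) ring_scheme \<Rightarrow> 'a set \<Rightarrow> bool" where
  "countable_CM_type R \<mm> \<longleftrightarrow>
     countable (indecomposable_MCMs R \<mm> //
       {(M, N) \<in> indecomposable_MCMs R \<mm> \<times> indecomposable_MCMs R \<mm>. module_iso R M N})"

definition complete_MCM_list ::
  "('a, 'r) ring_scheme \<Rightarrow> 'a set \<Rightarrow> 'i set \<Rightarrow> ('i \<Rightarrow> 'a fg_module) \<Rightarrow> bool" where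
  "complete_MCM_list R \<mm> J M \<longleftrightarrow>
     (\<forall>j \<in> J. M j \<in> indecomposable_MCMs R \<mm>) \<and>
     (\<forall>N \<in> indecomposable_MCMs R \<mm>. \<exists>!j. j \<in> J \<and> module_iso R N (M j))"

definition Ext_annihilators ::
  "('a, 'r) ring_scheme \<Rightarrow> 'i set \<Rightarrow> ('i \<Rightarrow> 'a fg_module) \<Rightarrow> 'a set set" where
  "Ext_annihilators R J M =
     {annihilator R (Ext R i (M j) (M k)) | i j k. i \<ge> 1 \<and> j \<in> J \<and> k \<in> J}"

definition general_element ::
  "('a, 'r) ring_scheme \<Rightarrow> 'a set \<Rightarrow> 'i set \<Rightarrow> ('i \<Rightarrow> 'a fg_module) \<Rightarrow> 'a \<Rightarrow> bool" where
  "general_element R \<mm> J M x \<longleftrightarrow>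
     x \<in> carrier R \<and> x \<notin> \<Union>{A \<in> Ext_annihilators R J M. A \<noteq> carrier R \<and> A \<noteq> \<mm>}"

definition general_system_of_parameters ::
  "('a, 'r) ring_scheme \<Rightarrow> 'a set \<Rightarrow> 'i set \<Rightarrow> ('i \<Rightarrow> 'a fg_module) \<Rightarrow> 'a list \<Rightarrow> bool" where
  "general_system_of_parameters R \<mm> J M xs \<longleftrightarrow>
     system_of_parameters R \<mm> xs \<and> (\<exists>x \<in> genideal R (set xs). general_element R \<mm> J M x)"

section \<open>The carrier type is large enough\<close>

lemma module_transport:
  fixes M :: "('a, 'b, 'm) module_scheme" and h :: "'b \<Rightarrow> 'c"
  assumes M: "module R M" and h: "inj_on h (carrier M)"
  shows "\<exists>N :: ('a, 'c) module. module R N \<and> module_iso R M N"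
proof -
  interpret module R M by fact
  define g where "g = the_inv_into (carrier M) h"
  have gh[simp]: "g (h x) = x" if "x \<in> carrier M" for x
    unfolding g_def by (rule the_inv_into_f_f[OF h that])
  define N :: "('a, 'c) module" where
    "N = \<lparr>carrier = h ` carrier M, monoid.mult = undefined, one = undefined, ring.zero = h \<zero>\<^bsub>M\<^esub>,
          ring.add = (\<lambda>x y. h (g x \<oplus>\<^bsub>M\<^esub> g y)), smult = (\<lambda>a x. h (a \<odot>\<^bsub>M\<^esub> g x))\<rparr>"
  have ab: "abelian_group N"
  proof (rule abelian_groupI)
    fix x assume "x \<in> carrier N"
    then obtain u where u: "u \<in> carrier M" "x = h u" by (auto simp: N_def)
    then show "\<exists>y\<in>carrier N. y \<oplus>\<^bsub>N\<^esub> x = \<zero>\<^bsub>N\<^esub>"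
      by (intro bexI[of _ "h (\<ominus>\<^bsub>M\<^esub> u)"]) (auto simp: N_def M.l_neg)
  qed (auto simp: N_def M.a_ac)
  have "module R N"
    by (rule moduleI[OF R.is_cring ab])
       (auto simp: N_def smult_l_distr smult_r_distr smult_assoc1)
  moreover have "module_iso R M N"
    unfolding module_iso_def
    by (rule bexI[of _ h]) (use h in \<open>auto simp: bij_betw_def mod_hom_def hom_def N_def\<close>)
  ultimately show ?thesis by blast
qed

lemma finitely_generated_representable:
  fixes R :: "('a, 'r) ring_scheme" and M :: "('a, 'b, 'm) module_scheme"
  assumes M: "module R M" and fg: "finitely_generated R M"
  shows "\<exists>N :: 'a fg_module. module R N \<and> module_iso R M N"
proof -
  interpret module R M by fact
  from fg obtain S where S: "finite S" "S \<subseteq> carrier M" "module_span R M S = carrier M"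
    unfolding finitely_generated_def by blast
  obtain n :: nat and s where s: "S = s ` {..<n}"
    using finite_imp_nat_seg_image_inj_on[OF S(1)] by (auto simp: lessThan_def)
  have sM: "s i \<in> carrier M" if "i < n" for i using S(2) s that by auto
  define \<phi> where "\<phi> v = finsum M (\<lambda>i. v i \<odot>\<^bsub>M\<^esub> s i) {..<n}" for v
  let ?C = "{..<n} \<rightarrow>\<^sub>E carrier R"
  have vR: "v i \<in> carrier R" if "v \<in> ?C" "i < n" for v i using that by (auto simp: PiE_def)
  have clo: "\<phi> v \<in> carrier M" if "v \<in> ?C" for v
    unfolding \<phi>_def by (rule M.finsum_closed) (use that vR sM in auto)
  have "submodule (\<phi> ` ?C) R M"
  proof (rule submoduleI)
    show "\<phi> ` ?C \<subseteq> carrier M" using clo by auto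
    have "\<phi> (\<lambda>i\<in>{..<n}. \<zero>\<^bsub>R\<^esub>) = finsum M (\<lambda>i. \<zero>\<^bsub>M\<^esub>) {..<n}"
      unfolding \<phi>_def by (rule M.finsum_cong') (auto simp: sM)
    then have "\<phi> (\<lambda>i\<in>{..<n}. \<zero>\<^bsub>R\<^esub>) = \<zero>\<^bsub>M\<^esub>" by simp
    moreover have "(\<lambda>i\<in>{..<n}. \<zero>\<^bsub>R\<^esub>) \<in> ?C" by auto
    ultimately show "\<zero>\<^bsub>M\<^esub> \<in> \<phi> ` ?C" by (rule image_eqI[OF sym])
  next
    fix a assume "a \<in> \<phi> ` ?C"
    then obtain v where v: "v \<in> ?C" "a = \<phi> v" by auto
    let ?w = "\<lambda>i\<in>{..<n}. \<ominus>\<^bsub>R\<^esub> v i"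
    have w: "?w \<in> ?C" using v vR by auto
    have "\<phi> ?w \<oplus>\<^bsub>M\<^esub> \<phi> v = finsum M (\<lambda>i. ?w i \<odot>\<^bsub>M\<^esub> s i \<oplus>\<^bsub>M\<^esub> v i \<odot>\<^bsub>M\<^esub> s i) {..<n}"
      unfolding \<phi>_def by (rule M.finsum_addf[symmetric]) (use vR[OF v(1)] sM in auto)
    also have "\<dots> = finsum M (\<lambda>i. \<zero>\<^bsub>M\<^esub>) {..<n}"
      by (rule M.finsum_cong') (use vR[OF v(1)] sM in \<open>auto simp: smult_l_minus M.l_neg\<close>)
    finally have "\<phi> ?w \<oplus>\<^bsub>M\<^esub> \<phi> v = \<zero>\<^bsub>M\<^esub>" by simp
    then have "\<ominus>\<^bsub>M\<^esub> a = \<phi> ?w" using clo[OF v(1)] clo[OF w] v(2) M.minus_equality by simp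
    then show "\<ominus>\<^bsub>M\<^esub> a \<in> \<phi> ` ?C" using w by blast
  next
    fix a b assume "a \<in> \<phi> ` ?C" "b \<in> \<phi> ` ?C"
    then obtain v w where v: "v \<in> ?C" "a = \<phi> v" and w: "w \<in> ?C" "b = \<phi> w" by auto
    let ?u = "\<lambda>i\<in>{..<n}. v i \<oplus>\<^bsub>R\<^esub> w i"
    have u: "?u \<in> ?C" using v w vR by auto
    have "\<phi> ?u = finsum M (\<lambda>i. v i \<odot>\<^bsub>M\<^esub> s i \<oplus>\<^bsub>M\<^esub> w i \<odot>\<^bsub>M\<^esub> s i) {..<n}"
      unfolding \<phi>_def
      by (rule M.finsum_cong') (use vR[OF v(1)] vR[OF w(1)] sM in \<open>auto simp: smult_l_distr\<close>)
    also have "\<dots> = a \<oplus>\<^bsub>M\<^esub> b"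
      unfolding v(2) w(2) \<phi>_def
      by (rule M.finsum_addf) (use vR[OF v(1)] vR[OF w(1)] sM in auto)
    finally show "a \<oplus>\<^bsub>M\<^esub> b \<in> \<phi> ` ?C" by (rule image_eqI[OF sym u])
  next
    fix r x assume r: "r \<in> carrier R" and "x \<in> \<phi> ` ?C"
    then obtain v where v: "v \<in> ?C" "x = \<phi> v" by auto
    let ?u = "\<lambda>i\<in>{..<n}. r \<otimes>\<^bsub>R\<^esub> v i"
    have u: "?u \<in> ?C" using v vR r by auto
    have "\<phi> ?u = finsum M (\<lambda>i. r \<odot>\<^bsub>M\<^esub> (v i \<odot>\<^bsub>M\<^esub> s i)) {..<n}"
      unfolding \<phi>_def
      by (rule M.finsum_cong') (use vR[OF v(1)] r sM in \<open>auto simp: smult_assoc1\<close>)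
    also have "\<dots> = r \<odot>\<^bsub>M\<^esub> x"
      unfolding v(2) \<phi>_def
      by (rule finsum_smult_ldistr[symmetric]) (use vR[OF v(1)] r sM in auto)
    finally show "r \<odot>\<^bsub>M\<^esub> x \<in> \<phi> ` ?C" by (rule image_eqI[OF sym u])
  qed
  moreover have "S \<subseteq> \<phi> ` ?C"
  proof
    fix x assume "x \<in> S"
    then obtain k where k: "k < n" "x = s k" using s by auto
    let ?e = "\<lambda>i\<in>{..<n}. if i = k then \<one>\<^bsub>R\<^esub> else \<zero>\<^bsub>R\<^esub>"
    have "\<phi> ?e = finsum M (\<lambda>i. if k = i then s i else \<zero>\<^bsub>M\<^esub>) {..<n}"
      unfolding \<phi>_def by (rule M.finsum_cong') (use sM in auto)
    also have "\<dots> = s k" by (rule M.finsum_singleton) (use k sM in auto)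
    finally have "x = \<phi> ?e" using k by simp
    moreover have "?e \<in> ?C" by auto
    ultimately show "x \<in> \<phi> ` ?C" by (rule image_eqI)
  qed
  ultimately have "carrier M \<subseteq> \<phi> ` ?C"
    using S(3) by (auto simp: module_span_def)
  then have "inj_on (\<lambda>x. {v \<in> ?C. \<phi> v = x}) (carrier M)"
    by (intro inj_onI) blast
  then show ?thesis by (rule module_transport[OF M])
qed

end

theory Submission
  imports Defs
begin

text \<open>Write \<open>J\<close> for the parameter ideal, let \<open>a \<in> R\<^sup>n\<close> have generators of \<open>I\<close> as entries and put
  \<open>D = R\<^sup>n/(J R\<^sup>n + R a)\<close>. Every \<open>u \<in> J : (J : I)\<close> defines a homomorphism from the image of \<open>a\<close> in
  \<open>(R/J)\<^sup>n\<close> to \<open>R/J\<close> by \<open>r a \<mapsto> r u\<close>, and it extends to \<open>(R/J)\<^sup>n\<close> only if \<open>u \<in> J + I\<close>. So it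
  suffices that \<open>\<mm>\<close> annihilates \<open>Ext\<^sup>1(D, R/J)\<close> over \<open>R/J\<close>. By change of rings this module is
  \<open>Ext\<^sup>1(X, R)\<close> over \<open>R\<close>, where \<open>X\<close> arises from \<open>D\<close> by taking one syzygy over each of the rings
  \<open>R/(x\<^sub>1, \<dots>, x\<^sub>k)\<close>, and \<open>X\<close> is maximal Cohen-Macaulay because each syzygy gains one in depth. A general
  element of \<open>J\<close> annihilates \<open>D\<close>, hence \<open>Ext\<^sup>1(M, R)\<close> for every indecomposable summand \<open>M\<close> of \<open>X\<close>;
  by generality the annihilator of \<open>Ext\<^sup>1(M, R)\<close> is then \<open>R\<close> or \<open>\<mm>\<close>.

  Depth is measured by the vanishing of Koszul homology, which, unlike regular sequences, does not
  depend on the choice of the system of parameters and behaves well for summands and syzygies.\<close>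

text \<open>Generality of an element is a condition on modules over R, while the obstruction to
  extending r a |-> r u lives over R/J. Hence the change of rings has to be an equivalence for each
  scalar separately: x, which kills everything over R/J because it lies in J, is carried up to R,
  exchanged there for an arbitrary t in \<open>\<mm>\<close>, and t is carried back down. To keep
  all modules of this passage in one type, each is a quotient of some R^n and is represented by the
  submodule Y of R^n; homomorphisms to R/A become maps to R that are linear modulo A, and Koszul
  conditions are read modulo Y. Splitting X into indecomposables turns into an induction from larger
  Y to smaller ones, since a proper summand of R^n/Y is R^n/A with A strictly containing Y. The only
  regular sequence known at the outset is some sequence of length dim R in \<open>\<mm>\<close>,
  whereas the argument divides by x_1, ..., x_d. That these are regular has to be derived: powers of
  the known sequence lie in J and so act as zero, up to homotopy, on the Koszul complex of x_1, ...,
  x_d.\<close>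

definition power_module :: "'i set \<Rightarrow> ('a, 'b, 'm) module_scheme \<Rightarrow> ('a, 'i \<Rightarrow> 'b) module" where
  "power_module T M =
     \<lparr>carrier = T \<rightarrow>\<^sub>E carrier M, monoid.mult = undefined, one = undefined,
      ring.zero = (\<lambda>i\<in>T. \<zero>\<^bsub>M\<^esub>),
      ring.add = (\<lambda>v w. \<lambda>i\<in>T. v i \<oplus>\<^bsub>M\<^esub> w i),
      smult = (\<lambda>a v. \<lambda>i\<in>T. a \<odot>\<^bsub>M\<^esub> v i)\<rparr>"

text \<open>Powers over other index sets occur as well: over the boolean lists of a fixed length
  they are the modules of Koszul chains, to which the Noetherian property of finite powers is
  applied.\<close>

lemma free_module_eq: "free_module R n = power_module {..<n} (regular_module R)"
  by (simp add: free_module_def power_module_def regular_module_def)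

lemma regular_module_simps [simp]:
  "carrier (regular_module R) = carrier R" "\<zero>\<^bsub>regular_module R\<^esub> = \<zero>\<^bsub>R\<^esub>"
  "add (regular_module R) = add R" "smult (regular_module R) = monoid.mult R"
  "a_inv (regular_module R) = a_inv R" "a_minus (regular_module R) = a_minus R"
proof -
  show "a_inv (regular_module R) = a_inv R"
    by (simp add: regular_module_def a_inv_def m_inv_def fun_eq_iff)
  then show "a_minus (regular_module R) = a_minus R"
    by (simp add: regular_module_def a_minus_def fun_eq_iff)
qed (simp_all add: regular_module_def)

lemma (in cring) module_regular: "module R (regular_module R)"
proof (rule moduleI)
  show "abelian_group (regular_module R)"
    by (rule abelian_groupI) (auto simp: a_ac intro: add.l_inv_ex)
qed (auto simp: l_distr r_distr m_assoc is_cring)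

lemma power_module_simps [simp]:
  "carrier (power_module T M) = T \<rightarrow>\<^sub>E carrier M" "\<zero>\<^bsub>power_module T M\<^esub> = (\<lambda>i\<in>T. \<zero>\<^bsub>M\<^esub>)"
  "v \<oplus>\<^bsub>power_module T M\<^esub> w = (\<lambda>i\<in>T. v i \<oplus>\<^bsub>M\<^esub> w i)"
  "a \<odot>\<^bsub>power_module T M\<^esub> v = (\<lambda>i\<in>T. a \<odot>\<^bsub>M\<^esub> v i)"
  by (simp_all add: power_module_def)

section \<open>Submodules and subtraction in a module\<close>

context module
begin

lemma submoduleD:
  assumes "submodule Y R M"
  shows "u \<in> Y \<Longrightarrow> u \<in> carrier M" "\<zero>\<^bsub>M\<^esub> \<in> Y"
    "u \<in> Y \<Longrightarrow> v \<in> Y \<Longrightarrow> u \<oplus>\<^bsub>M\<^esub> v \<in> Y" "u \<in> Y \<Longrightarrow> \<ominus>\<^bsub>M\<^esub> u \<in> Y"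
    "u \<in> Y \<Longrightarrow> v \<in> Y \<Longrightarrow> u \<ominus>\<^bsub>M\<^esub> v \<in> Y" "a \<in> carrier R \<Longrightarrow> u \<in> Y \<Longrightarrow> a \<odot>\<^bsub>M\<^esub> u \<in> Y"
proof -
  note E = submoduleE[OF assms]
  show "u \<in> Y \<Longrightarrow> u \<in> carrier M" using E(1) by auto
  show z: "\<zero>\<^bsub>M\<^esub> \<in> Y" proof -
    obtain u where u: "u \<in> Y" using E(2) by auto
    then show ?thesis using E(4)[of \<zero> u] E(1) by auto
  qed
  show "u \<in> Y \<Longrightarrow> v \<in> Y \<Longrightarrow> u \<oplus>\<^bsub>M\<^esub> v \<in> Y" by (rule E(5))
  show "u \<in> Y \<Longrightarrow> \<ominus>\<^bsub>M\<^esub> u \<in> Y" by (rule E(3))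
  show "u \<in> Y \<Longrightarrow> v \<in> Y \<Longrightarrow> u \<ominus>\<^bsub>M\<^esub> v \<in> Y" unfolding M.minus_eq by (intro E)
  show "a \<in> carrier R \<Longrightarrow> u \<in> Y \<Longrightarrow> a \<odot>\<^bsub>M\<^esub> u \<in> Y" by (rule E(4))
qed

lemma submoduleI':
  assumes "H \<subseteq> carrier M" "\<zero>\<^bsub>M\<^esub> \<in> H"
    and "\<And>a b. \<lbrakk>a \<in> H ; b \<in> H\<rbrakk> \<Longrightarrow> a \<oplus>\<^bsub>M\<^esub> b \<in> H"
    and smul: "\<And>a x. \<lbrakk>a \<in> carrier R; x \<in> H\<rbrakk> \<Longrightarrow> a \<odot>\<^bsub>M\<^esub> x \<in> H"
  shows "submodule H R M"
proof (rule submoduleI)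
  fix a assume a: "a \<in> H"
  then have "(\<ominus>\<^bsub>R\<^esub> \<one>\<^bsub>R\<^esub>) \<odot>\<^bsub>M\<^esub> a \<in> H" by (intro smul) auto
  with a show "\<ominus>\<^bsub>M\<^esub> a \<in> H" using assms(1) smult_l_minus[of \<one> a] by auto
qed (use assms in auto)

lemma zero_submodule: "submodule {\<zero>\<^bsub>M\<^esub>} R M"
  by (rule submoduleI') auto

lemma smult_minus_distr:
  "\<lbrakk>a \<in> carrier R; x \<in> carrier M; y \<in> carrier M\<rbrakk> \<Longrightarrow> a \<odot>\<^bsub>M\<^esub> (x \<ominus>\<^bsub>M\<^esub> y) = a \<odot>\<^bsub>M\<^esub> x \<ominus>\<^bsub>M\<^esub> a \<odot>\<^bsub>M\<^esub> y"
  by (simp add: M.minus_eq smult_r_distr smult_r_minus)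

lemma smult_minus_distr2:
  "\<lbrakk>a \<in> carrier R; b \<in> carrier R; x \<in> carrier M\<rbrakk> \<Longrightarrow> (a \<ominus> b) \<odot>\<^bsub>M\<^esub> x = a \<odot>\<^bsub>M\<^esub> x \<ominus>\<^bsub>M\<^esub> b \<odot>\<^bsub>M\<^esub> x"
  by (simp add: M.minus_eq R.minus_eq smult_l_distr smult_l_minus)

lemma submodule_span: "S \<subseteq> carrier M \<Longrightarrow> submodule (module_span R M S) R M"
  unfolding module_span_def
  by (rule submoduleI') (use carrier_is_submodule in \<open>auto simp: submoduleD\<close>)

lemma span_superset: "S \<subseteq> module_span R M S"
  by (auto simp: module_span_def)

lemma span_least: "submodule Y R M \<Longrightarrow> S \<subseteq> Y \<Longrightarrow> module_span R M S \<subseteq> Y"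
  by (auto simp: module_span_def)

lemma span_mono: "S \<subseteq> T \<Longrightarrow> module_span R M S \<subseteq> module_span R M T"
  by (auto simp: module_span_def)

lemma submodule_cancel:
  assumes "submodule Y R M" "u \<in> carrier M" "v \<in> Y" "u \<ominus>\<^bsub>M\<^esub> v \<in> Y"
  shows "u \<in> Y"
proof -
  note Y = submoduleD[OF assms(1)]
  have "(u \<ominus>\<^bsub>M\<^esub> v) \<oplus>\<^bsub>M\<^esub> v \<in> Y" using assms Y by blast
  then show ?thesis using assms Y(1) by (simp add: M.minus_eq M.a_assoc M.l_neg)
qed

lemma add_minus_cancel_mid:
  "\<lbrakk>u \<in> carrier M; v \<in> carrier M; w \<in> carrier M\<rbrakk> \<Longrightarrow> (u \<ominus>\<^bsub>M\<^esub> v) \<oplus>\<^bsub>M\<^esub> (v \<ominus>\<^bsub>M\<^esub> w) = u \<ominus>\<^bsub>M\<^esub> w"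
  by (simp add: M.minus_eq M.a_ac M.r_neg1 M.r_neg2)

lemma minus_minus_swap:
  "\<lbrakk>u \<in> carrier M; v \<in> carrier M\<rbrakk> \<Longrightarrow> \<ominus>\<^bsub>M\<^esub> (u \<ominus>\<^bsub>M\<^esub> v) = v \<ominus>\<^bsub>M\<^esub> u"
  by (simp add: M.minus_eq M.minus_add M.a_ac)

lemma minus_add_distrib4:
  "\<lbrakk>u \<in> carrier M; v \<in> carrier M; u' \<in> carrier M; v' \<in> carrier M\<rbrakk> \<Longrightarrow>
    (u \<oplus>\<^bsub>M\<^esub> v) \<ominus>\<^bsub>M\<^esub> (u' \<oplus>\<^bsub>M\<^esub> v') = (u \<ominus>\<^bsub>M\<^esub> u') \<oplus>\<^bsub>M\<^esub> (v \<ominus>\<^bsub>M\<^esub> v')"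
  by (simp add: M.minus_eq M.minus_add M.a_ac)

end

lemma module_power:
  assumes "module R M" shows "module R (power_module T M)"
proof -
  interpret module R M by fact
  show ?thesis
  proof (rule moduleI)
    show "abelian_group (power_module T M)"
    proof (rule abelian_groupI)
      fix v assume v: "v \<in> carrier (power_module T M)"
      show "\<exists>w\<in>carrier (power_module T M). w \<oplus>\<^bsub>power_module T M\<^esub> v = \<zero>\<^bsub>power_module T M\<^esub>"
        by (rule bexI[of _ "\<lambda>i\<in>T. \<ominus>\<^bsub>M\<^esub> v i"]) (use v in \<open>auto simp: fun_eq_iff PiE_iff M.l_neg\<close>)
    qed (auto simp: fun_eq_iff PiE_iff extensional_def M.a_ac)
  qed (auto simp: fun_eq_iff PiE_iff extensional_def smult_l_distr smult_r_distr smult_assoc1 R.is_cring)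
qed

lemma power_a_inv:
  assumes "module R M" "v \<in> carrier (power_module T M)"
  shows "\<ominus>\<^bsub>power_module T M\<^esub> v = (\<lambda>i\<in>T. \<ominus>\<^bsub>M\<^esub> v i)"
proof -
  interpret module R M by fact
  interpret P: module R "power_module T M" by (rule module_power) fact
  have "(\<lambda>i\<in>T. \<ominus>\<^bsub>M\<^esub> v i) \<oplus>\<^bsub>power_module T M\<^esub> v = \<zero>\<^bsub>power_module T M\<^esub>"
    using assms(2) by (auto simp: fun_eq_iff PiE_iff M.l_neg)
  moreover have "(\<lambda>i\<in>T. \<ominus>\<^bsub>M\<^esub> v i) \<in> carrier (power_module T M)"
    using assms(2) by (auto simp: PiE_iff)
  ultimately show ?thesis using assms(2) P.minus_equality by blast
qed

lemma power_a_minus: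
  assumes "module R M" "v \<in> carrier (power_module T M)" "w \<in> carrier (power_module T M)"
  shows "v \<ominus>\<^bsub>power_module T M\<^esub> w = (\<lambda>i\<in>T. v i \<ominus>\<^bsub>M\<^esub> w i)"
  unfolding a_minus_def power_a_inv[OF assms(1,3)] by (simp add: fun_eq_iff)

lemma (in cring) module_free: "module R (free_module R n)"
  unfolding free_module_eq by (rule module_power[OF module_regular])

lemma free_module_simps [simp]:
  "carrier (free_module R n) = {..<n} \<rightarrow>\<^sub>E carrier R" "\<zero>\<^bsub>free_module R n\<^esub> = (\<lambda>i\<in>{..<n}. \<zero>\<^bsub>R\<^esub>)"
  "v \<oplus>\<^bsub>free_module R n\<^esub> w = (\<lambda>i\<in>{..<n}. v i \<oplus>\<^bsub>R\<^esub> w i)"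
  "a \<odot>\<^bsub>free_module R n\<^esub> v = (\<lambda>i\<in>{..<n}. a \<otimes>\<^bsub>R\<^esub> v i)"
  by (simp_all add: free_module_def)

lemma (in cring) free_a_minus:
  assumes "v \<in> carrier (free_module R n)" "w \<in> carrier (free_module R n)"
  shows "v \<ominus>\<^bsub>free_module R n\<^esub> w = (\<lambda>i\<in>{..<n}. v i \<ominus> w i)"
  using power_a_minus[OF module_regular, of v "{..<n}" w] assms by (simp add: free_module_eq)

section \<open>Homomorphisms, images and preimages\<close>

lemma mod_homI:
  assumes "\<And>x. x \<in> carrier M \<Longrightarrow> f x \<in> carrier N"
    and "\<And>x y. x \<in> carrier M \<Longrightarrow> y \<in> carrier M \<Longrightarrow> f (x \<oplus>\<^bsub>M\<^esub> y) = f x \<oplus>\<^bsub>N\<^esub> f y"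
    and "\<And>a x. a \<in> carrier R \<Longrightarrow> x \<in> carrier M \<Longrightarrow> f (a \<odot>\<^bsub>M\<^esub> x) = a \<odot>\<^bsub>N\<^esub> f x"
  shows "f \<in> mod_hom R M N"
  using assms by (auto simp: mod_hom_def hom_def)

lemma mod_homD:
  assumes "f \<in> mod_hom R M N"
  shows "x \<in> carrier M \<Longrightarrow> f x \<in> carrier N"
    and "x \<in> carrier M \<Longrightarrow> y \<in> carrier M \<Longrightarrow> f (x \<oplus>\<^bsub>M\<^esub> y) = f x \<oplus>\<^bsub>N\<^esub> f y"
    and "a \<in> carrier R \<Longrightarrow> x \<in> carrier M \<Longrightarrow> f (a \<odot>\<^bsub>M\<^esub> x) = a \<odot>\<^bsub>N\<^esub> f x"
  using assms by (auto simp: mod_hom_def hom_def)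

lemma mod_hom_simps:
  assumes "module R M" "module R N" and f: "f \<in> mod_hom R M N"
  shows "f \<zero>\<^bsub>M\<^esub> = \<zero>\<^bsub>N\<^esub>"
    and "x \<in> carrier M \<Longrightarrow> f (\<ominus>\<^bsub>M\<^esub> x) = \<ominus>\<^bsub>N\<^esub> f x"
    and "x \<in> carrier M \<Longrightarrow> y \<in> carrier M \<Longrightarrow> f (x \<ominus>\<^bsub>M\<^esub> y) = f x \<ominus>\<^bsub>N\<^esub> f y"
proof -
  interpret M: module R M by fact
  interpret N: module R N by fact
  note D = mod_homD[OF f]
  show "f \<zero>\<^bsub>M\<^esub> = \<zero>\<^bsub>N\<^esub>"
    using D(1)[of "\<zero>\<^bsub>M\<^esub>"] D(3)[of "\<zero>\<^bsub>R\<^esub>" "\<zero>\<^bsub>M\<^esub>"] by simp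
  show m: "f (\<ominus>\<^bsub>M\<^esub> x) = \<ominus>\<^bsub>N\<^esub> f x" if "x \<in> carrier M" for x
    using that D(1)[OF that] D(3)[of "\<ominus>\<^bsub>R\<^esub> \<one>\<^bsub>R\<^esub>" x] by (simp add: M.smult_l_minus N.smult_l_minus)
  show "x \<in> carrier M \<Longrightarrow> y \<in> carrier M \<Longrightarrow> f (x \<ominus>\<^bsub>M\<^esub> y) = f x \<ominus>\<^bsub>N\<^esub> f y"
    using D m by (simp add: M.minus_eq N.minus_eq)
qed

lemma mod_hom_comp:
  assumes "f \<in> mod_hom R M N" "g \<in> mod_hom R N P"
  shows "(\<lambda>x. g (f x)) \<in> mod_hom R M P"
  by (rule mod_homI) (simp_all add: mod_homD[OF assms(1)] mod_homD[OF assms(2)])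

lemma submodule_vimage:
  assumes "module R M" "module R N" "f \<in> mod_hom R M N" "submodule Y R N"
  shows "submodule {v \<in> carrier M. f v \<in> Y} R M"
proof -
  interpret M: module R M by fact
  interpret N: module R N by fact
  show ?thesis
    by (rule M.submoduleI')
       (auto simp: mod_homD[OF assms(3)] mod_hom_simps[OF assms(1-3)] N.submoduleD[OF assms(4)])
qed

lemma submodule_image:
  assumes "module R M" "module R N" "f \<in> mod_hom R M N" "submodule Y R M"
  shows "submodule (f ` Y) R N"
proof -
  interpret M: module R M by fact
  interpret N: module R N by fact
  note Y = M.submoduleD[OF assms(4)] and f = mod_homD[OF assms(3)]
  show ?thesis
  proof (rule N.submoduleI')
    show "f ` Y \<subseteq> carrier N" using Y f by auto
    show "\<zero>\<^bsub>N\<^esub> \<in> f ` Y" using Y(2) mod_hom_simps(1)[OF assms(1-3)] by force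
    fix a b assume "a \<in> f ` Y" "b \<in> f ` Y"
    then obtain u v where "u \<in> Y" "v \<in> Y" "a = f u" "b = f v" by auto
    then show "a \<oplus>\<^bsub>N\<^esub> b \<in> f ` Y" using Y f(2)[of u v] by (metis imageI)
  next
    fix a b assume "a \<in> carrier R" "b \<in> f ` Y"
    then obtain v where "v \<in> Y" "b = f v" by auto
    then show "a \<odot>\<^bsub>N\<^esub> b \<in> f ` Y" using Y f(3)[of a v] \<open>a \<in> carrier R\<close> by (metis imageI)
  qed
qed

lemma submodule_equalizer:
  assumes "module R M" "module R N" "f \<in> mod_hom R M N" "g \<in> mod_hom R M N"
  shows "submodule {v \<in> carrier M. f v = g v} R M"
proof -
  interpret M: module R M by fact
  show ?thesis
    by (rule M.submoduleI')
       (auto simp: mod_homD[OF assms(3)] mod_homD[OF assms(4)]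
         mod_hom_simps[OF assms(1-3)] mod_hom_simps[OF assms(1,2,4)])
qed

lemma submodule_Int:
  assumes "module R M" "submodule A R M" "submodule B R M" shows "submodule (A \<inter> B) R M"
proof -
  interpret M: module R M by fact
  show ?thesis by (rule M.submoduleI') (auto simp: M.submoduleD[OF assms(2)] M.submoduleD[OF assms(3)])
qed

subsection \<open>Free modules\<close>

definition unit_vector :: "('a, 'r) ring_scheme \<Rightarrow> nat \<Rightarrow> nat \<Rightarrow> nat \<Rightarrow> 'a" where
  "unit_vector R n k = (\<lambda>i\<in>{..<n}. if i = k then \<one>\<^bsub>R\<^esub> else \<zero>\<^bsub>R\<^esub>)"

lemma (in cring) unit_vector_closed [simp]: "unit_vector R n k \<in> carrier (free_module R n)"
  by (auto simp: unit_vector_def)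

text \<open>With \<open>L\<close> a preimage or an equalizer this takes the place of computing with
  sums over a basis. The induction is on \<open>k\<close>, for vectors that vanish from coordinate
  \<open>k\<close> on.\<close>

lemma (in cring) free_module_induct:
  assumes L: "submodule L R (free_module R n)" and e: "\<And>i. i < n \<Longrightarrow> unit_vector R n i \<in> L"
    and v: "v \<in> carrier (free_module R n)"
  shows "v \<in> L"
proof -
  interpret F: module R "free_module R n" by (rule module_free)
  note L = F.submoduleD[OF L]
  have claim: "v \<in> carrier (free_module R n) \<Longrightarrow> (\<forall>i. k \<le> i \<and> i < n \<longrightarrow> v i = \<zero>) \<Longrightarrow> k \<le> n \<Longrightarrow> v \<in> L" for k v
  proof (induction k arbitrary: v)
    case 0
    then have v0: "v = \<zero>\<^bsub>free_module R n\<^esub>" by (auto simp: fun_eq_iff PiE_iff extensional_def)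
    show ?case unfolding v0 by (rule L(2))
  next
    case (Suc k)
    have k: "k < n" using Suc by simp
    define w where "w = v(k := \<zero>)"
    have w: "w \<in> L"
      by (rule Suc.IH) (use Suc.prems k in \<open>auto simp: w_def PiE_iff extensional_def not_less_eq_eq\<close>)
    have vk: "v k \<in> carrier R" using Suc.prems(1) k by auto
    have "v = w \<oplus>\<^bsub>free_module R n\<^esub> v k \<odot>\<^bsub>free_module R n\<^esub> unit_vector R n k"
      using Suc.prems(1) k by (auto simp: fun_eq_iff w_def unit_vector_def PiE_iff extensional_def)
    then show ?case using w e[OF k] vk L by metis
  qed
  show ?thesis by (rule claim[OF v, of n]) auto
qed

lemma (in module) free_hom_exists:
  assumes p: "\<And>i. i < n \<Longrightarrow> p i \<in> carrier M"
  obtains h where "h \<in> mod_hom R (free_module R n) M" "\<And>i. i < n \<Longrightarrow> h (unit_vector R n i) = p i"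
proof
  define h where "h v = finsum M (\<lambda>i. v i \<odot>\<^bsub>M\<^esub> p i) {..<n}" for v
  show "h \<in> mod_hom R (free_module R n) M"
  proof (rule mod_homI)
    fix v assume v: "v \<in> carrier (free_module R n)"
    then have vi: "v i \<in> carrier R" if "i < n" for i using that by auto
    show "h v \<in> carrier M" unfolding h_def by (rule M.finsum_closed) (use vi p in auto)
    fix a assume a: "a \<in> carrier R"
    show "h (a \<odot>\<^bsub>free_module R n\<^esub> v) = a \<odot>\<^bsub>M\<^esub> h v"
      unfolding h_def by (subst finsum_smult_ldistr)
        (use vi p a in \<open>auto intro!: M.finsum_cong' simp: smult_assoc1\<close>)
  next
    fix v w assume v: "v \<in> carrier (free_module R n)" and w: "w \<in> carrier (free_module R n)"
    then have vi: "v i \<in> carrier R" "w i \<in> carrier R" if "i < n" for i using that by auto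
    have "h (v \<oplus>\<^bsub>free_module R n\<^esub> w) = finsum M (\<lambda>i. v i \<odot>\<^bsub>M\<^esub> p i \<oplus>\<^bsub>M\<^esub> w i \<odot>\<^bsub>M\<^esub> p i) {..<n}"
      unfolding h_def by (rule M.finsum_cong') (use vi p in \<open>auto simp: smult_l_distr\<close>)
    also have "\<dots> = h v \<oplus>\<^bsub>M\<^esub> h w"
      unfolding h_def by (rule M.finsum_addf) (use vi p in auto)
    finally show "h (v \<oplus>\<^bsub>free_module R n\<^esub> w) = h v \<oplus>\<^bsub>M\<^esub> h w" .
  qed
  fix k assume k: "k < n"
  have "h (unit_vector R n k) = finsum M (\<lambda>i. if k = i then p i else \<zero>\<^bsub>M\<^esub>) {..<n}"
    unfolding h_def by (rule M.finsum_cong') (use p in \<open>auto simp: unit_vector_def\<close>)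
  also have "\<dots> = p k" by (rule M.finsum_singleton) (use k p in auto)
  finally show "h (unit_vector R n k) = p k" .
qed

lemma (in module) free_hom_eqI:
  assumes "f \<in> mod_hom R (free_module R n) M" "g \<in> mod_hom R (free_module R n) M"
    and "\<And>i. i < n \<Longrightarrow> f (unit_vector R n i) = g (unit_vector R n i)"
    and "v \<in> carrier (free_module R n)"
  shows "f v = g v"
proof -
  have "v \<in> {v \<in> carrier (free_module R n). f v = g v}"
    by (rule free_module_induct[OF submodule_equalizer[OF module_free module_axioms assms(1,2)] _ assms(4)])
       (use assms(3) unit_vector_closed in simp)
  then show ?thesis by simp
qed

text \<open>Projectivity of free modules: a preimage under \<open>f\<close> is chosen for the image
  of each unit vector, and two maps that agree on the unit vectors are equal.\<close>

lemma (in module) free_hom_lift: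
  assumes "module R N" and f: "f \<in> mod_hom R N M" and g: "g \<in> mod_hom R (free_module R n) M"
    and sub: "\<And>v. v \<in> carrier (free_module R n) \<Longrightarrow> g v \<in> f ` carrier N"
  obtains h where "h \<in> mod_hom R (free_module R n) N"
    "\<And>v. v \<in> carrier (free_module R n) \<Longrightarrow> f (h v) = g v"
proof -
  interpret N: module R N by fact
  have "\<forall>i. \<exists>w. i < n \<longrightarrow> w \<in> carrier N \<and> f w = g (unit_vector R n i)"
    using sub[OF unit_vector_closed] by (metis imageE)
  then obtain p where p: "\<And>i. i < n \<Longrightarrow> p i \<in> carrier N" "\<And>i. i < n \<Longrightarrow> f (p i) = g (unit_vector R n i)"
    by metis
  obtain h where h: "h \<in> mod_hom R (free_module R n) N" "\<And>i. i < n \<Longrightarrow> h (unit_vector R n i) = p i"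
    using N.free_hom_exists[where n = n and p = p, OF p(1)] by blast
  have "f (h v) = g v" if "v \<in> carrier (free_module R n)" for v
    by (rule free_hom_eqI[OF mod_hom_comp[OF h(1) f] g _ that]) (simp add: h p)
  with h(1) show ?thesis by (rule that)
qed

lemma (in module) finitely_generated_free_surj:
  assumes "finite S" "S \<subseteq> carrier M"
  obtains n h where "h \<in> mod_hom R (free_module R n) M"
    "h ` carrier (free_module R n) = module_span R M S"
proof -
  obtain n :: nat and s where s: "S = s ` {..<n}"
    using finite_imp_nat_seg_image_inj_on[OF assms(1)] by (auto simp: lessThan_def)
  obtain h where h: "h \<in> mod_hom R (free_module R n) M" "\<And>i. i < n \<Longrightarrow> h (unit_vector R n i) = s i"
    using free_hom_exists[of n s] assms(2) s by auto
  interpret F: module R "free_module R n" by (rule module_free)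
  have "submodule (h ` carrier (free_module R n)) R M"
    by (rule submodule_image[OF F.module_axioms module_axioms h(1) F.carrier_is_submodule])
  moreover have "S \<subseteq> h ` carrier (free_module R n)"
    using h(2) unit_vector_closed s by (metis (no_types, lifting) image_subset_iff lessThan_iff rev_image_eqI)
  ultimately have "module_span R M S \<subseteq> h ` carrier (free_module R n)" by (rule span_least)
  moreover have "h v \<in> module_span R M S" if "v \<in> carrier (free_module R n)" for v
  proof -
    have "v \<in> {v \<in> carrier (free_module R n). h v \<in> module_span R M S}"
      by (rule free_module_induct[OF submodule_vimage[OF F.module_axioms module_axioms h(1) submodule_span[OF assms(2)]] _ that])
         (use h(2) s span_superset[of S] assms(2) in \<open>auto simp: unit_vector_closed[simplified]\<close>)
    then show ?thesis by simp
  qed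
  ultimately show ?thesis using that h(1) by (metis image_subsetI subset_antisym)
qed

subsection \<open>Noetherian modules\<close>

text \<open>The ascending chain condition for the spans of \<open>u 0, \<dots>, u (k - 1)\<close>.\<close>

definition noetherian_module :: "('a, 'r) ring_scheme \<Rightarrow> ('a, 'b, 'm) module_scheme \<Rightarrow> bool" where
  "noetherian_module R M \<longleftrightarrow>
     (\<forall>u :: nat \<Rightarrow> 'b. range u \<subseteq> carrier M \<longrightarrow> (\<exists>k. u k \<in> module_span R M (u ` {..<k})))"

lemma noetherian_moduleD:
  assumes "noetherian_module R M" "\<And>i::nat. u i \<in> carrier M"
  obtains k where "u k \<in> module_span R M (u ` {..<k})"
proof -
  have "range u \<subseteq> carrier M" using assms(2) by blast
  with assms(1) have "\<exists>k. u k \<in> module_span R M (u ` {..<k})" unfolding noetherian_module_def by simp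
  then show ?thesis using that by blast
qed

lemma (in cring) submodule_regular_iff: "submodule I R (regular_module R) \<longleftrightarrow> ideal I R"
proof
  interpret M: module R "regular_module R" by (rule module_regular)
  assume I: "submodule I R (regular_module R)"
  note D = M.submoduleD[OF I, simplified]
  show "ideal I R"
  proof (rule idealI)
    show "subgroup I (add_monoid R)"
      by (rule add.subgroupI) (use D in \<open>auto simp flip: a_inv_def\<close>)
    fix a x assume "a \<in> I" "x \<in> carrier R"
    then show "x \<otimes> a \<in> I" "a \<otimes> x \<in> I" using D(6)[of x a] D(1)[of a] by (auto simp: m_comm)
  qed (rule ring_axioms)
next
  interpret M: module R "regular_module R" by (rule module_regular)
  assume "ideal I R"
  then interpret I: ideal I R .
  show "submodule I R (regular_module R)"
    by (rule M.submoduleI') (auto simp: I.Icarr I.I_l_closed)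
qed

lemma (in cring) span_regular: "module_span R (regular_module R) S = Idl S"
  by (auto simp: module_span_def genideal_def submodule_regular_iff)

text \<open>The ideals generated by the initial segments of \<open>u\<close> form a chain, and in a
  Noetherian ring a nonempty chain of ideals contains its union.\<close>

lemma (in cring) noetherian_regular_module:
  assumes "noetherian_ring R" shows "noetherian_module R (regular_module R)"
  unfolding noetherian_module_def
proof (intro allI impI)
  interpret N: noetherian_ring R by fact
  fix u :: "nat \<Rightarrow> 'a" assume u: "range u \<subseteq> carrier (regular_module R)"
  then have uR: "u ` A \<subseteq> carrier R" for A by auto
  define C where "C = range (\<lambda>k. Idl (u ` {..<k}))"
  have mono: "Idl (u ` {..<k}) \<subseteq> Idl (u ` {..<l})" if "k \<le> l" for k l
    by (rule subset_Idl_subset[OF uR]) (use that in auto)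
  have "subset.chain {I. ideal I R} C"
  proof (rule subset.chainI)
    show "C \<subseteq> {I. ideal I R}" using genideal_ideal[OF uR] by (auto simp: C_def)
    fix A B assume "A \<in> C" "B \<in> C"
    then obtain k l where "A = Idl (u ` {..<k})" "B = Idl (u ` {..<l})" by (auto simp: C_def)
    then show "(\<subset>)\<^sup>=\<^sup>= A B \<or> (\<subset>)\<^sup>=\<^sup>= B A" using mono[of k l] mono[of l k] by fastforce
  qed
  then have "\<Union>C \<in> C" using N.ideal_chain_is_trivial[of C] by (auto simp: C_def)
  then obtain k where k: "\<Union>C = Idl (u ` {..<k})" by (auto simp: C_def)
  have "u k \<in> Idl (u ` {..<Suc k})" using genideal_self[OF uR, of "{..<Suc k}"] by auto
  also have "\<dots> \<subseteq> \<Union>C" by (auto simp: C_def)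
  finally show "\<exists>k. u k \<in> module_span R (regular_module R) (u ` {..<k})"
    unfolding span_regular using k by blast
qed

text \<open>The defining condition is applied to the sequence from \<open>m\<close> on. Hence the
  indices at which a sequence falls into the span of its predecessors are unbounded.\<close>

lemma noetherian_module_tail:
  assumes "module R M" "noetherian_module R M" "\<And>i::nat. u i \<in> carrier M"
  shows "\<exists>k\<ge>m. u k \<in> module_span R M (u ` {..<k})"
proof -
  interpret module R M by fact
  obtain k where k: "u (m + k) \<in> module_span R M ((\<lambda>i. u (m + i)) ` {..<k})"
    using noetherian_moduleD[OF assms(2), of "\<lambda>i. u (m + i)"] assms(3) by blast
  have "(\<lambda>i. u (m + i)) ` {..<k} \<subseteq> u ` {..<m + k}" by auto
  from span_mono[OF this] k show ?thesis by (intro exI[of _ "m + k"]) auto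
qed

text \<open>Induction on the index set: when an index \<open>t\<close> is added to \<open>T\<close>,
  the \<open>t\<close>-coordinate can be cleared modulo earlier terms at infinitely many places of
  the sequence, and the remainders form a sequence in the power over \<open>T\<close>.\<close>

lemma noetherian_power_module:
  fixes T :: "'i set" and M :: "('a, 'b, 'm) module_scheme"
  assumes M: "module R M" and N: "noetherian_module R M" and "finite T"
  shows "noetherian_module R (power_module T M)"
  using \<open>finite T\<close>
proof (induction T)
  case empty
  show ?case unfolding noetherian_module_def
  proof (intro allI impI)
    interpret P: module R "power_module {} M" by (rule module_power) fact
    fix u :: "nat \<Rightarrow> 'i \<Rightarrow> 'b" assume "range u \<subseteq> carrier (power_module {} M)"
    then have "u 0 \<in> carrier (power_module {} M)" by blast
    then have u0: "u 0 = \<zero>\<^bsub>power_module {} M\<^esub>" by (simp add: fun_eq_iff)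
    have "u 0 \<in> module_span R (power_module {} M) (u ` {..<0})"
      unfolding u0 by (rule P.submoduleD(2)[OF P.submodule_span]) auto
    then show "\<exists>k. u k \<in> module_span R (power_module {} M) (u ` {..<k})" by blast
  qed
next
  case (insert t T)
  let ?P = "power_module (insert t T) M" and ?Q = "power_module T M"
  interpret M: module R M by fact
  interpret P: module R ?P by (rule module_power) fact
  interpret Q: module R ?Q by (rule module_power) fact
  show ?case unfolding noetherian_module_def
  proof (intro allI impI)
    fix u :: "nat \<Rightarrow> 'i \<Rightarrow> 'b" assume u: "range u \<subseteq> carrier ?P"
    then have ui: "u i \<in> carrier ?P" for i by blast
    let ?S = "\<lambda>k. module_span R ?P (u ` {..<k})"
    have S: "submodule (?S k) R ?P" for k by (rule P.submodule_span) (use u in blast)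
    have ev: "(\<lambda>v. v t) \<in> mod_hom R ?P M" by (rule mod_homI) auto
    have rs: "(\<lambda>v. restrict v T) \<in> mod_hom R ?P ?Q" by (rule mod_homI) (auto simp: fun_eq_iff)
    \<comment> \<open>Indices at which the \<open>t\<close>-coordinate of \<open>u k\<close> is
      already that of a combination of earlier terms. They are enumerated by \<open>e\<close>, and
      subtracting the combinations \<open>w\<close> leaves remainders \<open>x\<close> with
      \<open>t\<close>-coordinate zero.\<close>
    define K where "K = {k. \<exists>w \<in> ?S k. w t = u k t}"
    have "\<exists>k\<ge>m. k \<in> K" for m
    proof -
      obtain k where k: "k \<ge> m" "u k t \<in> module_span R M ((\<lambda>i. u i t) ` {..<k})"
        using noetherian_module_tail[OF M N, of "\<lambda>i. u i t" m] ui mod_homD(1)[OF ev] by blast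
      have "(\<lambda>i. u i t) ` {..<k} \<subseteq> (\<lambda>v. v t) ` ?S k" using P.span_superset[of "u ` {..<k}"] by auto
      with M.span_least[OF submodule_image[OF P.module_axioms M ev S]] k(2)
      have "u k t \<in> (\<lambda>v. v t) ` ?S k" by blast
      then obtain w where "w \<in> ?S k" "w t = u k t" by force
      then show ?thesis using k(1) unfolding K_def by blast
    qed
    then have inf: "infinite K" unfolding infinite_nat_iff_unbounded_le by auto
    define e where "e = enumerate K"
    have e: "e s \<in> K" "strict_mono e" for s
      using inf by (auto simp: e_def enumerate_in_set strict_mono_enumerate)
    have "\<forall>s. \<exists>w. w \<in> ?S (e s) \<and> w t = u (e s) t" using e(1) unfolding K_def by blast
    then obtain w where w: "\<And>s. w s \<in> ?S (e s)" "\<And>s. w s t = u (e s) t" by metis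
    define x where "x s = u (e s) \<ominus>\<^bsub>?P\<^esub> w s" for s
    have wP: "w s \<in> carrier ?P" for s using w(1) P.submoduleD(1)[OF S] by blast
    have xP: "x s \<in> carrier ?P" for s unfolding x_def using wP ui by blast
    have xt: "x s t = \<zero>\<^bsub>M\<^esub>" for s
      unfolding x_def using mod_hom_simps(3)[OF P.module_axioms M ev ui wP] w(2) mod_homD(1)[OF ev ui]
      by (simp add: M.r_neg M.minus_eq)
    obtain s where s: "restrict (x s) T \<in> module_span R ?Q ((\<lambda>i. restrict (x i) T) ` {..<s})"
      using noetherian_moduleD[OF insert.IH, of "\<lambda>i. restrict (x i) T"] mod_homD(1)[OF rs xP] by blast
    \<comment> \<open>Restriction to \<open>T\<close> is injective on vectors that vanish at
      \<open>t\<close>. A relation between the restricted remainders therefore lifts to the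
      remainders, inside the span of the terms before \<open>u (e s)\<close>.\<close>
    let ?L = "?S (e s) \<inter> {v \<in> carrier ?P. v t \<in> {\<zero>\<^bsub>M\<^esub>}}"
    have L: "submodule ?L R ?P"
      by (rule submodule_Int[OF P.module_axioms S submodule_vimage[OF P.module_axioms M ev M.zero_submodule]])
    have "x i \<in> ?L" if "i < s" for i
    proof -
      have "e i < e s" using e(2) that by (simp add: strict_mono_less)
      then have sub: "?S (e i) \<subseteq> ?S (e s)" "u (e i) \<in> ?S (e s)"
        using P.span_superset[of "u ` {..<e s}"] by (auto intro!: P.span_mono image_mono)
      then show ?thesis using w(1)[of i] xt xP P.submoduleD(5)[OF S] by (auto simp: x_def)
    qed
    then have "(\<lambda>i. restrict (x i) T) ` {..<s} \<subseteq> (\<lambda>v. restrict v T) ` ?L" by blast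
    with Q.span_least[OF submodule_image[OF P.module_axioms Q.module_axioms rs L]] s
    obtain v where v: "v \<in> ?L" "restrict (x s) T = restrict v T" by blast
    have "x s i = v i" for i
    proof (cases "i \<in> insert t T")
      case True
      then show ?thesis using v xt by (auto dest: fun_cong[of _ _ i])
    next
      case False
      then show ?thesis using xP[of s] v(1) by (auto simp: PiE_iff extensional_def)
    qed
    then have "x s = v" by (rule ext)
    with v(1) have "x s \<in> ?S (e s)" by blast
    then have "u (e s) \<in> ?S (e s)"
      using P.submodule_cancel[OF S ui w(1)] by (simp add: x_def)
    then show "\<exists>k. u k \<in> ?S k" by blast
  qed
qed

lemma (in cring) noetherian_free_module:
  "noetherian_ring R \<Longrightarrow> noetherian_module R (free_module R n)"
  unfolding free_module_eq
  by (rule noetherian_power_module[OF module_regular noetherian_regular_module]) auto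

text \<open>Otherwise every finite subset leaves an element of \<open>Y\<close> outside its span,
  and adding such elements one at a time gives a sequence that is never in the span of its
  predecessors.\<close>

lemma noetherian_submodule_fg:
  assumes M: "module R M" and N: "noetherian_module R M" and Y: "submodule Y R M"
  obtains S where "finite S" "S \<subseteq> Y" "module_span R M S = Y"
proof (rule ccontr)
  interpret module R M by fact
  note Y' = submoduleD[OF Y]
  assume "\<not> thesis"
  with that have "\<forall>S. finite S \<and> S \<subseteq> Y \<longrightarrow> module_span R M S \<noteq> Y" by blast
  then have "\<exists>y. y \<in> Y - module_span R M S" if "finite S" "S \<subseteq> Y" for S
    using span_least[OF Y, of S] that by blast
  then have "\<exists>f. \<forall>S. finite S \<and> S \<subseteq> Y \<longrightarrow> f S \<in> Y - module_span R M S"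
    by (intro choice) blast
  then obtain f where f: "\<And>S. finite S \<Longrightarrow> S \<subseteq> Y \<Longrightarrow> f S \<in> Y - module_span R M S" by blast
  define g where "g = rec_nat {} (\<lambda>_ S. insert (f S) S)"
  have g: "finite (g k) \<and> g k \<subseteq> Y \<and> g k = (\<lambda>i. f (g i)) ` {..<k}" for k
    by (induction k) (use f in \<open>auto simp: g_def lessThan_Suc\<close>)
  have "f (g k) \<in> carrier M" for k using f g Y' by blast
  then obtain k where "f (g k) \<in> module_span R M ((\<lambda>i. f (g i)) ` {..<k})"
    using noetherian_moduleD[OF N, of "\<lambda>k. f (g k)"] by blast
  then show False using f[of "g k"] g[of k] by auto
qed

text \<open>The relation counts the larger submodule as the smaller one. Induction along it proves a
  claim for \<open>Y\<close> from all submodules strictly containing \<open>Y\<close>, and its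
  minimal elements are maximal members of a family.\<close>

lemma noetherian_submodule_wf:
  assumes M: "module R M" and N: "noetherian_module R M"
  shows "wf {(A, B). submodule A R M \<and> submodule B R M \<and> B \<subset> A}"
  unfolding wf_iff_no_infinite_down_chain
proof
  interpret module R M by fact
  assume "\<exists>f. \<forall>i. (f (Suc i), f i) \<in> {(A, B). submodule A R M \<and> submodule B R M \<and> B \<subset> A}"
  then obtain f where f: "\<And>i. submodule (f i) R M" "\<And>i::nat. f i \<subset> f (Suc i)" by blast
  have "\<forall>i. \<exists>y. y \<in> f (Suc i) - f i" using f(2) by blast
  then obtain u where u: "\<And>i. u i \<in> f (Suc i) - f i" using choice by metis
  have "u i \<in> carrier M" for i using u submoduleD(1)[OF f(1)] by blast
  then obtain k where k: "u k \<in> module_span R M (u ` {..<k})" using noetherian_moduleD[OF N] by blast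
  have "f i \<subseteq> f j" if "i \<le> j" for i j by (rule lift_Suc_mono_le[OF _ that]) (use f in blast)
  then have "u i \<in> f k" if "i < k" for i using u[of i] that by (metis DiffD1 Suc_leI subsetD)
  then have "u ` {..<k} \<subseteq> f k" by blast
  then show False using span_least[OF f(1)] k u by blast
qed

subsection \<open>The Koszul complex\<close>

text \<open>A boolean list of the length of \<open>xs\<close> encodes an exterior monomial, and its number of \<open>True\<close>
  entries is the homological degree.\<close>

fun koszul_diff :: "('a, 'b, 'm) module_scheme \<Rightarrow> 'a list \<Rightarrow> (bool list \<Rightarrow> 'b) \<Rightarrow> bool list \<Rightarrow> 'b" where
  "koszul_diff M (x # xs) c (False # l) =
     x \<odot>\<^bsub>M\<^esub> c (True # l) \<oplus>\<^bsub>M\<^esub> koszul_diff M xs (\<lambda>l. c (False # l)) l"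
| "koszul_diff M (x # xs) c (True # l) = \<ominus>\<^bsub>M\<^esub> koszul_diff M xs (\<lambda>l. c (True # l)) l"
| "koszul_diff M [] c l = \<zero>\<^bsub>M\<^esub>"
| "koszul_diff M xs c [] = \<zero>\<^bsub>M\<^esub>"

text \<open>Exterior multiplication by the vector with coordinates \<open>rs\<close>, dual to
  \<open>koszul_diff\<close>, which is contraction with the linear form with coordinates
  \<open>xs\<close>. The signs come from moving past the first basis vector.\<close>

fun koszul_homotopy :: "('a, 'b, 'm) module_scheme \<Rightarrow> 'a list \<Rightarrow> (bool list \<Rightarrow> 'b) \<Rightarrow> bool list \<Rightarrow> 'b" where
  "koszul_homotopy M (r # rs) c (False # l) = koszul_homotopy M rs (\<lambda>l. c (False # l)) l"
| "koszul_homotopy M (r # rs) c (True # l) =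
     r \<odot>\<^bsub>M\<^esub> c (False # l) \<ominus>\<^bsub>M\<^esub> koszul_homotopy M rs (\<lambda>l. c (True # l)) l"
| "koszul_homotopy M [] c l = \<zero>\<^bsub>M\<^esub>"
| "koszul_homotopy M rs c [] = \<zero>\<^bsub>M\<^esub>"

fun dot_product :: "('a, 'r) ring_scheme \<Rightarrow> 'a list \<Rightarrow> 'a list \<Rightarrow> 'a" where
  "dot_product R (r # rs) (x # xs) = r \<otimes>\<^bsub>R\<^esub> x \<oplus>\<^bsub>R\<^esub> dot_product R rs xs"
| "dot_product R _ _ = \<zero>\<^bsub>R\<^esub>"

text \<open>Degrees are not separated: a chain may be inhomogeneous. With \<open>k = 0\<close> the
  chains are those without component in degree zero.\<close>

definition koszul_chain :: "('a, 'b, 'm) module_scheme \<Rightarrow> nat \<Rightarrow> nat \<Rightarrow> (bool list \<Rightarrow> 'b) \<Rightarrow> bool" where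
  "koszul_chain M n k c \<longleftrightarrow>
     (\<forall>l. length l = n \<longrightarrow> c l \<in> carrier M \<and> (count_list l True \<le> k \<longrightarrow> c l = \<zero>\<^bsub>M\<^esub>))"

text \<open>Chains of all degrees above \<open>k\<close> are treated at once: the condition says that the Koszul homology of \<open>M/Y\<close>
  vanishes in these degrees.\<close>

definition koszul_acyclic_above :: "('a, 'b, 'm) module_scheme \<Rightarrow> 'a list \<Rightarrow> nat \<Rightarrow> 'b set \<Rightarrow> bool" where
  "koszul_acyclic_above M xs k Y \<longleftrightarrow>
     (\<forall>c. koszul_chain M (length xs) k c \<and> (\<forall>l. length l = length xs \<longrightarrow> koszul_diff M xs c l \<in> Y) \<longrightarrow>
       (\<exists>b. koszul_chain M (length xs) (Suc k) b \<and>
            (\<forall>l. length l = length xs \<longrightarrow> c l \<ominus>\<^bsub>M\<^esub> koszul_diff M xs b l \<in> Y)))"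

lemma count_list_le_length: "count_list l a \<le> length l"
  by (induction l) auto

lemma koszul_diff_cong:
  assumes "\<And>l. length l = length xs \<Longrightarrow> c l = c' l" "length l = length xs"
  shows "koszul_diff M xs c l = koszul_diff M xs c' l"
  using assms
proof (induction xs arbitrary: c c' l)
  case (Cons x xs)
  then obtain b l' where l: "l = b # l'" "length l' = length xs" by (cases l) auto
  have "koszul_diff M xs (\<lambda>l. c (b # l)) l' = koszul_diff M xs (\<lambda>l. c' (b # l)) l'" for b
    by (rule Cons.IH) (use Cons.prems l in auto)
  then show ?case using l Cons.prems by (cases b) auto
qed simp

context module
begin

lemma minus_zero_simps [simp]: "\<ominus>\<^bsub>M\<^esub> \<zero>\<^bsub>M\<^esub> = \<zero>\<^bsub>M\<^esub>" "u \<in> carrier M \<Longrightarrow> u \<ominus>\<^bsub>M\<^esub> \<zero>\<^bsub>M\<^esub> = u"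
  by (simp_all add: M.minus_eq M.add.inv_one[simplified])

lemma add_cancel_far:
  "\<lbrakk>u \<in> carrier M; v \<in> carrier M; w \<in> carrier M\<rbrakk> \<Longrightarrow> u \<oplus>\<^bsub>M\<^esub> (v \<oplus>\<^bsub>M\<^esub> (w \<oplus>\<^bsub>M\<^esub> \<ominus>\<^bsub>M\<^esub> u)) = v \<oplus>\<^bsub>M\<^esub> w"
  by (metis M.a_assoc M.a_comm M.add.inv_closed M.add.m_closed M.r_neg M.r_zero a_inv_def)

lemma minus_add_cancel: "\<lbrakk>u \<in> carrier M; v \<in> carrier M\<rbrakk> \<Longrightarrow> (u \<ominus>\<^bsub>M\<^esub> v) \<oplus>\<^bsub>M\<^esub> v = u"
  by (simp add: M.minus_eq M.a_assoc M.l_neg)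

lemma add_minus_cancel_left:
  "\<lbrakk>u \<in> carrier M; v \<in> carrier M\<rbrakk> \<Longrightarrow> (u \<oplus>\<^bsub>M\<^esub> v) \<ominus>\<^bsub>M\<^esub> u = v"
  using M.r_neg1[of u v] M.a_comm[of "u \<oplus>\<^bsub>M\<^esub> v" "\<ominus>\<^bsub>M\<^esub> u"] by (simp add: M.minus_eq)

lemma koszul_diff_closed [simp]:
  assumes "set xs \<subseteq> carrier R" "\<And>l. length l = length xs \<Longrightarrow> c l \<in> carrier M" "length l = length xs"
  shows "koszul_diff M xs c l \<in> carrier M"
  using assms
proof (induction xs arbitrary: c l)
  case (Cons x xs)
  then obtain b l' where l: "l = b # l'" "length l' = length xs" by (cases l) auto
  have "koszul_diff M xs (\<lambda>l. c (b # l)) l' \<in> carrier M" for b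
    by (rule Cons.IH) (use Cons.prems l in auto)
  then show ?case using l Cons.prems by (cases b) auto
qed simp

lemma koszul_homotopy_closed [simp]:
  assumes "set xs \<subseteq> carrier R" "\<And>l. length l = length xs \<Longrightarrow> c l \<in> carrier M" "length l = length xs"
  shows "koszul_homotopy M xs c l \<in> carrier M"
  using assms
proof (induction xs arbitrary: c l)
  case (Cons x xs)
  then obtain b l' where l: "l = b # l'" "length l' = length xs" by (cases l) auto
  have "koszul_homotopy M xs (\<lambda>l. c (b # l)) l' \<in> carrier M" for b
    by (rule Cons.IH) (use Cons.prems l in auto)
  then show ?case using l Cons.prems by (cases b) auto
qed simp

lemma koszul_diff_in_submodule:
  assumes "submodule Y R M"
  assumes "set xs \<subseteq> carrier R" "\<And>l. length l = length xs \<Longrightarrow> c l \<in> Y" "length l = length xs"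
  shows "koszul_diff M xs c l \<in> Y"
  using assms(2-)
proof (induction xs arbitrary: c l)
  case (Cons x xs)
  note Y = submoduleD[OF assms(1)]
  from Cons obtain b l' where l: "l = b # l'" "length l' = length xs" by (cases l) auto
  have "koszul_diff M xs (\<lambda>l. c (b # l)) l' \<in> Y" for b
    by (rule Cons.IH) (use Cons.prems l in auto)
  then show ?case using l Cons.prems Y by (cases b) auto
qed (simp add: submoduleD[OF assms(1)])

lemma koszul_homotopy_in_submodule:
  assumes "submodule Y R M"
  assumes "set xs \<subseteq> carrier R" "\<And>l. length l = length xs \<Longrightarrow> c l \<in> Y" "length l = length xs"
  shows "koszul_homotopy M xs c l \<in> Y"
  using assms(2-)
proof (induction xs arbitrary: c l)
  case (Cons x xs)
  note Y = submoduleD[OF assms(1)]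
  from Cons obtain b l' where l: "l = b # l'" "length l' = length xs" by (cases l) auto
  have "koszul_homotopy M xs (\<lambda>l. c (b # l)) l' \<in> Y" for b
    by (rule Cons.IH) (use Cons.prems l in auto)
  then show ?case using l Cons.prems Y by (cases b) auto
qed (simp add: submoduleD[OF assms(1)])

lemma koszul_diff_zero:
  assumes "set xs \<subseteq> carrier R"
    "\<And>l'. length l' = length xs \<Longrightarrow> count_list l' True = Suc (count_list l True) \<Longrightarrow> c l' = \<zero>\<^bsub>M\<^esub>"
    "length l = length xs"
  shows "koszul_diff M xs c l = \<zero>\<^bsub>M\<^esub>"
  using assms
proof (induction xs arbitrary: c l)
  case (Cons x xs)
  then obtain b l' where l: "l = b # l'" "length l' = length xs" by (cases l) auto
  have "koszul_diff M xs (\<lambda>l. c (b # l)) l' = \<zero>\<^bsub>M\<^esub>"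
    by (rule Cons.IH) (use Cons.prems l in auto)
  then show ?case using l Cons.prems by (cases b) auto
qed simp

lemma koszul_homotopy_zero:
  assumes "set xs \<subseteq> carrier R"
    "\<And>l'. length l' = length xs \<Longrightarrow> Suc (count_list l' True) = count_list l True \<Longrightarrow> c l' = \<zero>\<^bsub>M\<^esub>"
    "length l = length xs"
  shows "koszul_homotopy M xs c l = \<zero>\<^bsub>M\<^esub>"
  using assms
proof (induction xs arbitrary: c l)
  case (Cons x xs)
  then obtain b l' where l: "l = b # l'" "length l' = length xs" by (cases l) auto
  have "koszul_homotopy M xs (\<lambda>l. c (b # l)) l' = \<zero>\<^bsub>M\<^esub>"
    by (rule Cons.IH) (use Cons.prems l in auto)
  then show ?case using l Cons.prems by (cases b) (auto simp: M.minus_eq)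
qed simp

lemma koszul_diff_add:
  assumes "set xs \<subseteq> carrier R" "\<And>l. length l = length xs \<Longrightarrow> c l \<in> carrier M"
    "\<And>l. length l = length xs \<Longrightarrow> c' l \<in> carrier M" "length l = length xs"
  shows "koszul_diff M xs (\<lambda>l. c l \<oplus>\<^bsub>M\<^esub> c' l) l = koszul_diff M xs c l \<oplus>\<^bsub>M\<^esub> koszul_diff M xs c' l"
  using assms
proof (induction xs arbitrary: c c' l)
  case (Cons x xs)
  then obtain b l' where l: "l = b # l'" "length l' = length xs" by (cases l) auto
  have *: "koszul_diff M xs (\<lambda>l. c (b # l) \<oplus>\<^bsub>M\<^esub> c' (b # l)) l' =
      koszul_diff M xs (\<lambda>l. c (b # l)) l' \<oplus>\<^bsub>M\<^esub> koszul_diff M xs (\<lambda>l. c' (b # l)) l'" for b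
    by (rule Cons.IH) (use Cons.prems l in auto)
  have cl: "koszul_diff M xs (\<lambda>l. c (b # l)) l' \<in> carrier M" "koszul_diff M xs (\<lambda>l. c' (b # l)) l' \<in> carrier M" for b
    by (rule koszul_diff_closed; use Cons.prems l in auto)+
  show ?case using l Cons.prems
    by (cases b) (auto simp: * cl smult_r_distr M.minus_add M.a_ac)
qed simp

lemma koszul_homotopy_add:
  assumes "set xs \<subseteq> carrier R" "\<And>l. length l = length xs \<Longrightarrow> c l \<in> carrier M"
    "\<And>l. length l = length xs \<Longrightarrow> c' l \<in> carrier M" "length l = length xs"
  shows "koszul_homotopy M xs (\<lambda>l. c l \<oplus>\<^bsub>M\<^esub> c' l) l = koszul_homotopy M xs c l \<oplus>\<^bsub>M\<^esub> koszul_homotopy M xs c' l"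
  using assms
proof (induction xs arbitrary: c c' l)
  case (Cons x xs)
  then obtain b l' where l: "l = b # l'" "length l' = length xs" by (cases l) auto
  have *: "koszul_homotopy M xs (\<lambda>l. c (b # l) \<oplus>\<^bsub>M\<^esub> c' (b # l)) l' =
      koszul_homotopy M xs (\<lambda>l. c (b # l)) l' \<oplus>\<^bsub>M\<^esub> koszul_homotopy M xs (\<lambda>l. c' (b # l)) l'" for b
    by (rule Cons.IH) (use Cons.prems l in auto)
  have cl: "koszul_homotopy M xs (\<lambda>l. c (b # l)) l' \<in> carrier M" "koszul_homotopy M xs (\<lambda>l. c' (b # l)) l' \<in> carrier M" for b
    by (rule koszul_homotopy_closed; use Cons.prems l in auto)+
  show ?case using l Cons.prems
    by (cases b) (auto simp: * cl smult_r_distr M.minus_eq M.minus_add M.a_ac)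
qed simp

lemma koszul_diff_hom:
  assumes N: "module R N" and f: "f \<in> mod_hom R M N"
    and "set xs \<subseteq> carrier R" "\<And>l. length l = length xs \<Longrightarrow> c l \<in> carrier M" "length l = length xs"
  shows "f (koszul_diff M xs c l) = koszul_diff N xs (\<lambda>l. f (c l)) l"
  using assms(3-)
proof (induction xs arbitrary: c l)
  case (Cons x xs)
  then obtain b l' where l: "l = b # l'" "length l' = length xs" by (cases l) auto
  have *: "f (koszul_diff M xs (\<lambda>l. c (b # l)) l') = koszul_diff N xs (\<lambda>l. f (c (b # l))) l'" for b
    by (rule Cons.IH) (use Cons.prems l in auto)
  have cl: "koszul_diff M xs (\<lambda>l. c (b # l)) l' \<in> carrier M" for b
    by (rule koszul_diff_closed; use Cons.prems l in auto)+
  show ?case using l Cons.prems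
    by (cases b) (auto simp: *[symmetric] cl mod_homD[OF f] mod_hom_simps[OF module_axioms N f])
qed (simp add: mod_hom_simps[OF module_axioms N f])

lemma koszul_homotopy_hom:
  assumes N: "module R N" and f: "f \<in> mod_hom R M N"
    and "set xs \<subseteq> carrier R" "\<And>l. length l = length xs \<Longrightarrow> c l \<in> carrier M" "length l = length xs"
  shows "f (koszul_homotopy M xs c l) = koszul_homotopy N xs (\<lambda>l. f (c l)) l"
  using assms(3-)
proof (induction xs arbitrary: c l)
  case (Cons x xs)
  then obtain b l' where l: "l = b # l'" "length l' = length xs" by (cases l) auto
  have *: "f (koszul_homotopy M xs (\<lambda>l. c (b # l)) l') = koszul_homotopy N xs (\<lambda>l. f (c (b # l))) l'" for b
    by (rule Cons.IH) (use Cons.prems l in auto)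
  have cl: "koszul_homotopy M xs (\<lambda>l. c (b # l)) l' \<in> carrier M" for b
    by (rule koszul_homotopy_closed; use Cons.prems l in auto)+
  show ?case using l Cons.prems
    by (cases b) (auto simp: *[symmetric] cl mod_homD[OF f] mod_hom_simps[OF module_axioms N f])
qed (simp add: mod_hom_simps[OF module_axioms N f])

lemma smult_mod_hom: "a \<in> carrier R \<Longrightarrow> (\<lambda>v. a \<odot>\<^bsub>M\<^esub> v) \<in> mod_hom R M M"
  by (rule mod_homI) (auto simp: smult_r_distr smult_assoc1[symmetric] R.m_comm)

lemma uminus_mod_hom: "(\<lambda>v. \<ominus>\<^bsub>M\<^esub> v) \<in> mod_hom R M M"
  by (rule mod_homI) (auto simp: M.minus_add M.a_comm smult_r_minus)

lemmas koszul_diff_smult = koszul_diff_hom[OF module_axioms smult_mod_hom, symmetric]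
lemmas koszul_homotopy_smult = koszul_homotopy_hom[OF module_axioms smult_mod_hom, symmetric]
lemmas koszul_diff_uminus = koszul_diff_hom[OF module_axioms uminus_mod_hom, symmetric]
lemmas koszul_homotopy_uminus = koszul_homotopy_hom[OF module_axioms uminus_mod_hom, symmetric]

lemma koszul_diff_minus:
  assumes "set xs \<subseteq> carrier R" "\<And>l. length l = length xs \<Longrightarrow> c l \<in> carrier M"
    "\<And>l. length l = length xs \<Longrightarrow> c' l \<in> carrier M" "length l = length xs"
  shows "koszul_diff M xs (\<lambda>l. c l \<ominus>\<^bsub>M\<^esub> c' l) l = koszul_diff M xs c l \<ominus>\<^bsub>M\<^esub> koszul_diff M xs c' l"
  unfolding M.minus_eq using assms by (simp add: koszul_diff_add koszul_diff_uminus)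

lemma koszul_diff_diff:
  assumes "set xs \<subseteq> carrier R" "\<And>l. length l = length xs \<Longrightarrow> c l \<in> carrier M" "length l = length xs"
  shows "koszul_diff M xs (koszul_diff M xs c) l = \<zero>\<^bsub>M\<^esub>"
  using assms
proof (induction xs arbitrary: c l)
  case (Cons x xs)
  then obtain b l' where l: "l = b # l'" "length l' = length xs" by (cases l) auto
  have *: "koszul_diff M xs (koszul_diff M xs (\<lambda>l. c (b # l))) l' = \<zero>\<^bsub>M\<^esub>" for b
    by (rule Cons.IH) (use Cons.prems l in auto)
  have cl: "length k = length xs \<Longrightarrow> koszul_diff M xs (\<lambda>l. c (b # l)) k \<in> carrier M" for b k
    by (rule koszul_diff_closed; use Cons.prems l in auto)+
  have x: "x \<in> carrier R" "set xs \<subseteq> carrier R" using Cons.prems by auto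
  have ct: "length k = length xs \<Longrightarrow> c (b # k) \<in> carrier M" for k b using Cons.prems by auto
  show ?case
  proof (cases b)
    case True
    then show ?thesis using l x cl *[of True] by (simp add: koszul_diff_uminus)
  next
    case False
    then show ?thesis using l x cl ct *[of False]
      by (simp add: koszul_diff_add koszul_diff_smult smult_r_minus M.l_neg)
  qed
qed simp

text \<open>Contraction with a form and exterior multiplication by a vector anticommute up to the
  pairing of the two: in the expansion along the first entry the mixed terms cancel and the product
  of \<open>r\<close> and \<open>x\<close> remains. Hence every element of the ideal generated by
  \<open>xs\<close> is null-homotopic on the Koszul complex.\<close>

lemma koszul_homotopy:
  assumes "length rs = length xs"
    and "set rs \<subseteq> carrier R" "set xs \<subseteq> carrier R" "\<And>l. length l = length xs \<Longrightarrow> c l \<in> carrier M" "length l = length xs"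
  shows "koszul_diff M xs (koszul_homotopy M rs c) l \<oplus>\<^bsub>M\<^esub> koszul_homotopy M rs (koszul_diff M xs c) l
     = dot_product R rs xs \<odot>\<^bsub>M\<^esub> c l"
  using assms
proof (induction rs xs arbitrary: c l rule: list_induct2)
  case (Cons r rs x xs)
  then obtain b l' where l: "l = b # l'" "length l' = length xs" by (cases l) auto
  let ?d = "dot_product R rs xs"
  have *: "koszul_diff M xs (koszul_homotopy M rs (\<lambda>l. c (b # l))) l' \<oplus>\<^bsub>M\<^esub>
      koszul_homotopy M rs (koszul_diff M xs (\<lambda>l. c (b # l))) l' = ?d \<odot>\<^bsub>M\<^esub> c (b # l')" for b
    by (rule Cons.IH) (use Cons.prems l in auto)
  have x: "x \<in> carrier R" "set xs \<subseteq> carrier R" "r \<in> carrier R" "set rs \<subseteq> carrier R"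
    and len: "length rs = length xs" using Cons by auto
  have ct: "length k = length xs \<Longrightarrow> c (b # k) \<in> carrier M" for k b using Cons.prems by auto
  have cl: "length k = length xs \<Longrightarrow> koszul_diff M xs (\<lambda>l. c (b # l)) k \<in> carrier M"
    "length k = length xs \<Longrightarrow> koszul_homotopy M rs (\<lambda>l. c (b # l)) k \<in> carrier M"  for b k
    by (rule koszul_diff_closed koszul_homotopy_closed; use x len ct in auto)+
  have cl2: "koszul_diff M xs (koszul_homotopy M rs (\<lambda>l. c (b # l))) l' \<in> carrier M"
     "koszul_homotopy M rs (koszul_diff M xs (\<lambda>l. c (b # l))) l' \<in> carrier M" for b
    by (rule koszul_diff_closed koszul_homotopy_closed; use x len cl l in auto)+
  have d: "?d \<in> carrier R" using len x by (induction rs xs rule: list_induct2) auto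
  show ?case
  proof (cases b)
    case True
    have "koszul_diff M (x # xs) (koszul_homotopy M (r # rs) c) l \<oplus>\<^bsub>M\<^esub> koszul_homotopy M (r # rs) (koszul_diff M (x # xs) c) l
      = (r \<otimes> x) \<odot>\<^bsub>M\<^esub> c (True # l') \<oplus>\<^bsub>M\<^esub> (koszul_diff M xs (koszul_homotopy M rs (\<lambda>l. c (True # l))) l' \<oplus>\<^bsub>M\<^esub>
      koszul_homotopy M rs (koszul_diff M xs (\<lambda>l. c (True # l))) l')"
      using l x cl cl2 ct len True
      by (simp add: koszul_diff_add koszul_diff_uminus koszul_diff_smult koszul_homotopy_uminus smult_r_distr smult_assoc1
          M.minus_eq M.minus_add M.a_ac M.r_neg1 M.r_neg2 add_cancel_far)
    then show ?thesis using l x ct d True by (simp add: * smult_l_distr)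
  next
    case False
    have "koszul_diff M (x # xs) (koszul_homotopy M (r # rs) c) l \<oplus>\<^bsub>M\<^esub> koszul_homotopy M (r # rs) (koszul_diff M (x # xs) c) l
      = (r \<otimes> x) \<odot>\<^bsub>M\<^esub> c (False # l') \<oplus>\<^bsub>M\<^esub> (koszul_diff M xs (koszul_homotopy M rs (\<lambda>l. c (False # l))) l' \<oplus>\<^bsub>M\<^esub>
      koszul_homotopy M rs (koszul_diff M xs (\<lambda>l. c (False # l))) l')"
      using l x cl cl2 ct len False
      by (simp add: koszul_homotopy_add koszul_homotopy_smult smult_r_distr smult_r_minus R.m_comm[of r x] smult_assoc1
          M.minus_eq M.minus_add M.a_ac M.r_neg1 M.r_neg2 add_cancel_far)
    then show ?thesis using l x ct d False by (simp add: * smult_l_distr)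
  qed
qed simp

lemma koszul_chainD:
  assumes "koszul_chain M n k c"
  shows "length l = n \<Longrightarrow> c l \<in> carrier M" "length l = n \<Longrightarrow> count_list l True \<le> k \<Longrightarrow> c l = \<zero>\<^bsub>M\<^esub>"
  using assms by (auto simp: koszul_chain_def)

lemma koszul_acyclicD:
  assumes "koszul_acyclic_above M xs k Y" "koszul_chain M (length xs) k c"
    and "\<And>l. length l = length xs \<Longrightarrow> koszul_diff M xs c l \<in> Y"
  obtains b where "koszul_chain M (length xs) (Suc k) b"
    "\<And>l. length l = length xs \<Longrightarrow> c l \<ominus>\<^bsub>M\<^esub> koszul_diff M xs b l \<in> Y"
proof -
  have "\<exists>b. koszul_chain M (length xs) (Suc k) b \<and>
            (\<forall>l. length l = length xs \<longrightarrow> c l \<ominus>\<^bsub>M\<^esub> koszul_diff M xs b l \<in> Y)"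
    using assms unfolding koszul_acyclic_above_def by blast
  then show ?thesis using that by blast
qed

lemma koszul_acyclicI:
  assumes "\<And>c. koszul_chain M (length xs) k c \<Longrightarrow>
    (\<And>l. length l = length xs \<Longrightarrow> koszul_diff M xs c l \<in> Y) \<Longrightarrow>
    \<exists>b. koszul_chain M (length xs) (Suc k) b \<and>
            (\<forall>l. length l = length xs \<longrightarrow> c l \<ominus>\<^bsub>M\<^esub> koszul_diff M xs b l \<in> Y)"
  shows "koszul_acyclic_above M xs k Y"
  using assms unfolding koszul_acyclic_above_def by simp

lemma koszul_chain_diff:
  assumes "set xs \<subseteq> carrier R" "koszul_chain M (length xs) (Suc k) c"
  shows "koszul_chain M (length xs) k (koszul_diff M xs c)"
  unfolding koszul_chain_def
  using koszul_chainD[OF assms(2)] koszul_diff_closed[OF assms(1)]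
  by (auto intro!: koszul_diff_zero[OF assms(1)])

lemma koszul_chain_homotopy:
  assumes "set rs \<subseteq> carrier R" "koszul_chain M (length rs) k c"
  shows "koszul_chain M (length rs) (Suc k) (koszul_homotopy M rs c)"
  unfolding koszul_chain_def
  using koszul_chainD[OF assms(2)] koszul_homotopy_closed[OF assms(1)]
  by (auto intro!: koszul_homotopy_zero[OF assms(1)])

text \<open>A list has at most its length many entries \<open>True\<close>, so the only chain in
  question is zero. Both descending inductions on the degree start here.\<close>

lemma koszul_acyclic_above_length:
  assumes "set xs \<subseteq> carrier R" "submodule Y R M"
  shows "koszul_acyclic_above M xs (length xs) Y"
proof (rule koszul_acyclicI)
  fix c assume c: "koszul_chain M (length xs) (length xs) c"
  have 0: "c l = \<zero>\<^bsub>M\<^esub>" if "length l = length xs" for l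
    using koszul_chainD(2)[OF c that] count_list_le_length[of l True] that by simp
  have "koszul_diff M xs (\<lambda>_. \<zero>\<^bsub>M\<^esub>) l = \<zero>\<^bsub>M\<^esub>" if "length l = length xs" for l
    by (rule koszul_diff_zero[OF assms(1) _ that]) simp
  then show "\<exists>b. koszul_chain M (length xs) (Suc (length xs)) b \<and>
            (\<forall>l. length l = length xs \<longrightarrow> c l \<ominus>\<^bsub>M\<^esub> koszul_diff M xs b l \<in> Y)"
    using 0 submoduleD(2)[OF assms(2)]
    by (intro exI[of _ "\<lambda>_. \<zero>\<^bsub>M\<^esub>"]) (auto simp: koszul_chain_def M.minus_eq)
qed

text \<open>The long exact sequence of multiplication by \<open>y\<close> on \<open>M/Y\<close>, together with the fact that a power of
  \<open>y\<close> is null-homotopic on the Koszul complex.\<close>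

lemma koszul_acyclic_step:
  assumes xs: "set xs \<subseteq> carrier R" and rs: "set rs \<subseteq> carrier R" "length rs = length xs"
    and Y: "submodule Y R M" and y: "y \<in> carrier R"
    and pow: "y [^] (N::nat) = dot_product R rs xs"
    and nzd: "\<And>v. v \<in> carrier M \<Longrightarrow> y \<odot>\<^bsub>M\<^esub> v \<in> Y \<Longrightarrow> v \<in> Y"
    and Y1: "Y1 = {v \<in> carrier M. \<exists>w \<in> carrier M. v \<ominus>\<^bsub>M\<^esub> y \<odot>\<^bsub>M\<^esub> w \<in> Y}"
    and ac: "koszul_acyclic_above M xs (Suc k) Y1"
  shows "koszul_acyclic_above M xs k Y"
proof (rule koszul_acyclicI)
  note D = submoduleD[OF Y]
  fix c assume c: "koszul_chain M (length xs) k c"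
    and dc: "\<And>l. length l = length xs \<Longrightarrow> koszul_diff M xs c l \<in> Y"
  note c' = koszul_chainD[OF c]
  \<comment> \<open>\<open>?P j\<close> says that y^j times the cycle \<open>c\<close> is a boundary
    modulo \<open>Y\<close>. The homotopy gives it for the exponent \<open>N\<close>, and one factor
    \<open>y\<close> at a time is then cancelled until the exponent is 0.\<close>
  let ?P = "\<lambda>j. \<exists>b. koszul_chain M (length xs) (Suc k) b \<and>
            (\<forall>l. length l = length xs \<longrightarrow> (y [^] (j::nat)) \<odot>\<^bsub>M\<^esub> c l \<ominus>\<^bsub>M\<^esub> koszul_diff M xs b l \<in> Y)"
  have step: "?P j" if "?P (Suc j)" for j
  proof -
    from that obtain b where b: "koszul_chain M (length xs) (Suc k) b"
      and cb: "\<And>l. length l = length xs \<Longrightarrow> (y [^] Suc j) \<odot>\<^bsub>M\<^esub> c l \<ominus>\<^bsub>M\<^esub> koszul_diff M xs b l \<in> Y" by blast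
    note b' = koszul_chainD[OF b]
    have db: "koszul_diff M xs b l \<in> carrier M" if "length l = length xs" for l
      using koszul_diff_closed[OF xs b'(1) that] .
    \<comment> \<open>Modulo \<open>Y\<close> the boundary of \<open>b\<close> is a multiple of
      \<open>y\<close>, so \<open>b\<close> is a cycle over M/Y1, where the hypothesis on degrees
      above \<open>Suc k\<close> applies.\<close>
    have "koszul_diff M xs b l \<in> Y1" if l: "length l = length xs" for l
    proof -
      have "\<ominus>\<^bsub>M\<^esub> ((y [^] Suc j) \<odot>\<^bsub>M\<^esub> c l \<ominus>\<^bsub>M\<^esub> koszul_diff M xs b l) \<in> Y" using D cb[OF l] by blast
      then have "koszul_diff M xs b l \<ominus>\<^bsub>M\<^esub> y \<odot>\<^bsub>M\<^esub> ((y [^] j) \<odot>\<^bsub>M\<^esub> c l) \<in> Y"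
        using db[OF l] c'(1)[OF l] y
        by (simp add: minus_minus_swap smult_assoc1[symmetric] R.m_comm)
      then show ?thesis unfolding Y1 using db[OF l] c'(1)[OF l] y by blast
    qed
    from koszul_acyclicD[OF ac b this] obtain e where e: "koszul_chain M (length xs) (Suc (Suc k)) e"
      and be: "\<And>l. length l = length xs \<Longrightarrow> b l \<ominus>\<^bsub>M\<^esub> koszul_diff M xs e l \<in> Y1" by blast
    note de = koszul_chainD[OF koszul_chain_diff[OF xs e]]
    \<comment> \<open>In the degrees where \<open>b\<close> and the boundary of \<open>e\<close>
      vanish the witness has to be zero, so that the chosen \<open>f\<close> is again a chain in
      degrees above \<open>Suc k\<close>.\<close>
    have "\<exists>w. length l = length xs \<longrightarrow> w \<in> carrier M \<and> (b l \<ominus>\<^bsub>M\<^esub> koszul_diff M xs e l) \<ominus>\<^bsub>M\<^esub> y \<odot>\<^bsub>M\<^esub> w \<in> Y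
        \<and> (count_list l True \<le> Suc k \<longrightarrow> w = \<zero>\<^bsub>M\<^esub>)" for l
    proof (cases "length l = length xs \<and> count_list l True \<le> Suc k")
      case True
      then show ?thesis using b' de D(2) y by (intro exI[of _ "\<zero>\<^bsub>M\<^esub>"]) (simp add: M.minus_eq)
    next
      case False
      then show ?thesis using be[of l] unfolding Y1 by auto
    qed
    then obtain f where f: "\<And>l. length l = length xs \<Longrightarrow> f l \<in> carrier M"
      "\<And>l. length l = length xs \<Longrightarrow> (b l \<ominus>\<^bsub>M\<^esub> koszul_diff M xs e l) \<ominus>\<^bsub>M\<^esub> y \<odot>\<^bsub>M\<^esub> f l \<in> Y"
      "\<And>l. length l = length xs \<Longrightarrow> count_list l True \<le> Suc k \<Longrightarrow> f l = \<zero>\<^bsub>M\<^esub>" by metis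
    have fc: "koszul_chain M (length xs) (Suc k) f" using f by (simp add: koszul_chain_def)
    have "(y [^] j) \<odot>\<^bsub>M\<^esub> c l \<ominus>\<^bsub>M\<^esub> koszul_diff M xs f l \<in> Y" if l: "length l = length xs" for l
    proof -
      have df: "koszul_diff M xs f l \<in> carrier M" using koszul_diff_closed[OF xs f(1) l] .
      have "koszul_diff M xs (\<lambda>l. (b l \<ominus>\<^bsub>M\<^esub> koszul_diff M xs e l) \<ominus>\<^bsub>M\<^esub> y \<odot>\<^bsub>M\<^esub> f l) l \<in> Y"
        by (rule koszul_diff_in_submodule[OF Y xs f(2) l])
      also have "koszul_diff M xs (\<lambda>l. (b l \<ominus>\<^bsub>M\<^esub> koszul_diff M xs e l) \<ominus>\<^bsub>M\<^esub> y \<odot>\<^bsub>M\<^esub> f l) l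
        = (koszul_diff M xs b l \<ominus>\<^bsub>M\<^esub> koszul_diff M xs (koszul_diff M xs e) l) \<ominus>\<^bsub>M\<^esub> y \<odot>\<^bsub>M\<^esub> koszul_diff M xs f l"
        using xs b'(1) de(1) f(1) l y by (simp add: koszul_diff_minus koszul_diff_smult)
      also have "koszul_diff M xs (koszul_diff M xs e) l = \<zero>\<^bsub>M\<^esub>"
        by (rule koszul_diff_diff[OF xs koszul_chainD(1)[OF e] l])
      finally have 1: "koszul_diff M xs b l \<ominus>\<^bsub>M\<^esub> y \<odot>\<^bsub>M\<^esub> koszul_diff M xs f l \<in> Y"
        using db[OF l] by (simp add: M.minus_eq)
      have "((y [^] Suc j) \<odot>\<^bsub>M\<^esub> c l \<ominus>\<^bsub>M\<^esub> koszul_diff M xs b l) \<oplus>\<^bsub>M\<^esub>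
            (koszul_diff M xs b l \<ominus>\<^bsub>M\<^esub> y \<odot>\<^bsub>M\<^esub> koszul_diff M xs f l) \<in> Y"
        by (rule D(3)[OF cb[OF l] 1])
      then have "y \<odot>\<^bsub>M\<^esub> ((y [^] j) \<odot>\<^bsub>M\<^esub> c l \<ominus>\<^bsub>M\<^esub> koszul_diff M xs f l) \<in> Y"
        using c'(1)[OF l] db[OF l] df y
        by (simp add: add_minus_cancel_mid smult_minus_distr smult_assoc1[symmetric] R.m_comm)
      then show ?thesis by (rule nzd[rotated]) (simp add: df c'(1)[OF l] y)
    qed
    with fc show ?thesis by blast
  qed
  have "?P N"
  proof (intro exI conjI allI impI)
    show "koszul_chain M (length xs) (Suc k) (koszul_homotopy M rs c)"
      using koszul_chain_homotopy[OF rs(1), unfolded rs(2), OF c] .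
    fix l :: "bool list" assume l: "length l = length xs"
    have h: "koszul_homotopy M rs (koszul_diff M xs c) l \<in> Y"
      by (rule koszul_homotopy_in_submodule[OF Y rs(1)]) (use dc rs l in auto)
    have cl: "koszul_diff M xs (koszul_homotopy M rs c) l \<in> carrier M"
      by (rule koszul_diff_closed[OF xs _ l], rule koszul_homotopy_closed[OF rs(1)]) (simp_all only: c'(1) rs(2))
    have "(y [^] N) \<odot>\<^bsub>M\<^esub> c l = koszul_diff M xs (koszul_homotopy M rs c) l \<oplus>\<^bsub>M\<^esub> koszul_homotopy M rs (koszul_diff M xs c) l"
      unfolding pow by (rule koszul_homotopy[OF rs(2,1) xs c'(1) l, symmetric])
    then show "(y [^] N) \<odot>\<^bsub>M\<^esub> c l \<ominus>\<^bsub>M\<^esub> koszul_diff M xs (koszul_homotopy M rs c) l \<in> Y"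
      using add_minus_cancel_left[OF cl D(1)[OF h]] h by (simp only:)
  qed
  then have "?P 0"
  proof (induction N)
    case (Suc j)
    show ?case by (rule Suc.IH, rule step, rule Suc.prems)
  qed assumption
  then show "\<exists>b. koszul_chain M (length xs) (Suc k) b \<and>
            (\<forall>l. length l = length xs \<longrightarrow> c l \<ominus>\<^bsub>M\<^esub> koszul_diff M xs b l \<in> Y)"
    using c'(1) by auto
qed

text \<open>The quotient of M in the conclusion is isomorphic to p(M)/Y0, the kernel of F/Y0 ->
  F/p(M). In the long exact sequence of Koszul homology its vanishing range begins one degree lower
  than that of F/p(M): a syzygy gains one in depth.\<close>

lemma koszul_acyclic_syzygy:
  assumes F: "module R F" and p: "p \<in> mod_hom R M F"
    and xs: "set xs \<subseteq> carrier R" and Y0: "submodule Y0 R F" "Y0 \<subseteq> p ` carrier M"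
    and ac1: "koszul_acyclic_above F xs (Suc k) (p ` carrier M)" and ac2: "koszul_acyclic_above F xs k Y0"
  shows "koszul_acyclic_above M xs k {w \<in> carrier M. p w \<in> Y0}"
proof (rule koszul_acyclicI)
  interpret F: module R F by fact
  note D = F.submoduleD[OF submodule_image[OF module_axioms F p carrier_is_submodule]]
  note hom = mod_hom_simps[OF module_axioms F p] mod_homD[OF p]
  fix c assume c: "koszul_chain M (length xs) k c"
    and dc: "\<And>l. length l = length xs \<Longrightarrow> koszul_diff M xs c l \<in> {w \<in> carrier M. p w \<in> Y0}"
  note c' = koszul_chainD[OF c]
  have pc: "koszul_chain F (length xs) k (\<lambda>l. p (c l))"
    using c' hom by (simp add: koszul_chain_def)
  have "koszul_diff F xs (\<lambda>l. p (c l)) l \<in> Y0" if "length l = length xs" for l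
    using dc[OF that] koszul_diff_hom[OF F p xs c'(1) that] by simp
  from F.koszul_acyclicD[OF ac2 pc this] obtain b where b: "koszul_chain F (length xs) (Suc k) b"
    and cb: "\<And>l. length l = length xs \<Longrightarrow> p (c l) \<ominus>\<^bsub>F\<^esub> koszul_diff F xs b l \<in> Y0" by blast
  note b' = F.koszul_chainD[OF b]
  have db: "koszul_diff F xs b l \<in> carrier F" if "length l = length xs" for l
    using F.koszul_diff_closed[OF xs b'(1) that] .
  \<comment> \<open>Modulo \<open>Y0\<close> this boundary is the image of \<open>c\<close>, so
    \<open>b\<close> is a cycle modulo the image of \<open>p\<close>.\<close>
  have "koszul_diff F xs b l \<in> p ` carrier M" if l: "length l = length xs" for l
  proof -
    have "p (c l) \<ominus>\<^bsub>F\<^esub> (p (c l) \<ominus>\<^bsub>F\<^esub> koszul_diff F xs b l) \<in> p ` carrier M"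
      by (rule D(5)) (use cb[OF l] Y0(2) c'(1)[OF l] in auto)
    then show ?thesis using hom c'(1)[OF l] db[OF l] by (simp add: F.minus_eq F.minus_add F.r_neg2)
  qed
  from F.koszul_acyclicD[OF ac1 b this] obtain e where e: "koszul_chain F (length xs) (Suc (Suc k)) e"
    and be: "\<And>l. length l = length xs \<Longrightarrow> b l \<ominus>\<^bsub>F\<^esub> koszul_diff F xs e l \<in> p ` carrier M" by blast
  note de = F.koszul_chainD[OF F.koszul_chain_diff[OF xs e]]
  have "\<exists>w. length l = length xs \<longrightarrow> w \<in> carrier M \<and> p w = b l \<ominus>\<^bsub>F\<^esub> koszul_diff F xs e l
      \<and> (count_list l True \<le> Suc k \<longrightarrow> w = \<zero>\<^bsub>M\<^esub>)" for l
  proof (cases "length l = length xs \<and> count_list l True \<le> Suc k")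
    case True
    then show ?thesis using b' de hom by (intro exI[of _ "\<zero>\<^bsub>M\<^esub>"]) (simp add: F.minus_eq)
  next
    case False
    then show ?thesis using be[of l] by (metis imageE)
  qed
  then obtain w where w: "\<And>l. length l = length xs \<Longrightarrow> w l \<in> carrier M"
    "\<And>l. length l = length xs \<Longrightarrow> p (w l) = b l \<ominus>\<^bsub>F\<^esub> koszul_diff F xs e l"
    "\<And>l. length l = length xs \<Longrightarrow> count_list l True \<le> Suc k \<Longrightarrow> w l = \<zero>\<^bsub>M\<^esub>" by metis
  have wc: "koszul_chain M (length xs) (Suc k) w" using w by (simp add: koszul_chain_def)
  have "c l \<ominus>\<^bsub>M\<^esub> koszul_diff M xs w l \<in> {w \<in> carrier M. p w \<in> Y0}" if l: "length l = length xs" for l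
  proof -
    have dw: "koszul_diff M xs w l \<in> carrier M" using koszul_diff_closed[OF xs w(1) l] .
    have "p (koszul_diff M xs w l) = koszul_diff F xs (\<lambda>l. p (w l)) l"
      by (rule koszul_diff_hom[OF F p xs w(1) l])
    also have "\<dots> = koszul_diff F xs (\<lambda>l. b l \<ominus>\<^bsub>F\<^esub> koszul_diff F xs e l) l"
      by (rule koszul_diff_cong[OF w(2) l])
    also have "\<dots> = koszul_diff F xs b l \<ominus>\<^bsub>F\<^esub> koszul_diff F xs (koszul_diff F xs e) l"
      by (rule F.koszul_diff_minus[OF xs b'(1) de(1) l])
    also have "koszul_diff F xs (koszul_diff F xs e) l = \<zero>\<^bsub>F\<^esub>"
      by (rule F.koszul_diff_diff[OF xs F.koszul_chainD(1)[OF e] l])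
    finally have "p (c l \<ominus>\<^bsub>M\<^esub> koszul_diff M xs w l) = p (c l) \<ominus>\<^bsub>F\<^esub> koszul_diff F xs b l"
      using hom dw c'(1)[OF l] db[OF l] by (simp add: F.minus_eq)
    then show ?thesis using cb[OF l] dw c'(1)[OF l] by simp
  qed
  with wc show "\<exists>b. koszul_chain M (length xs) (Suc k) b \<and>
            (\<forall>l. length l = length xs \<longrightarrow> c l \<ominus>\<^bsub>M\<^esub> koszul_diff M xs b l \<in> {w \<in> carrier M. p w \<in> Y0})" by blast
qed

text \<open>M/Y1 is a retract of M/Y: by \<open>qY\<close> the map \<open>q\<close> induces M/Y1 ->
  M/Y, and by \<open>qc\<close> its composite with the projection back to M/Y1 is the identity.
  Vanishing homology passes to retracts.\<close>

lemma koszul_acyclic_summand: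
  assumes xs: "set xs \<subseteq> carrier R" and Y: "submodule Y1 R M" "Y \<subseteq> Y1"
    and q: "q \<in> mod_hom R M M" and qY: "\<And>v. v \<in> Y1 \<Longrightarrow> q v \<in> Y"
    and qc: "\<And>v. v \<in> carrier M \<Longrightarrow> v \<ominus>\<^bsub>M\<^esub> q v \<in> Y1"
    and ac: "koszul_acyclic_above M xs k Y"
  shows "koszul_acyclic_above M xs k Y1"
proof (rule koszul_acyclicI)
  note D = submoduleD[OF Y(1)]
  note hom = mod_hom_simps[OF module_axioms module_axioms q] mod_homD[OF q]
  fix c assume c: "koszul_chain M (length xs) k c"
    and dc: "\<And>l. length l = length xs \<Longrightarrow> koszul_diff M xs c l \<in> Y1"
  note c' = koszul_chainD[OF c]
  have pc: "koszul_chain M (length xs) k (\<lambda>l. q (c l))"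
    using c' hom by (simp add: koszul_chain_def)
  have "koszul_diff M xs (\<lambda>l. q (c l)) l \<in> Y" if "length l = length xs" for l
    using qY[OF dc[OF that]] koszul_diff_hom[OF module_axioms q xs c'(1) that] by simp
  from koszul_acyclicD[OF ac pc this] obtain b where b: "koszul_chain M (length xs) (Suc k) b"
    and cb: "\<And>l. length l = length xs \<Longrightarrow> q (c l) \<ominus>\<^bsub>M\<^esub> koszul_diff M xs b l \<in> Y" by blast
  have "c l \<ominus>\<^bsub>M\<^esub> koszul_diff M xs b l \<in> Y1" if l: "length l = length xs" for l
  proof -
    have "(c l \<ominus>\<^bsub>M\<^esub> q (c l)) \<oplus>\<^bsub>M\<^esub> (q (c l) \<ominus>\<^bsub>M\<^esub> koszul_diff M xs b l) \<in> Y1"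
      by (rule D(3)) (use qc[OF c'(1)[OF l]] cb[OF l] Y(2) in auto)
    then show ?thesis
      using c'(1)[OF l] hom(4) koszul_diff_closed[OF xs koszul_chainD(1)[OF b] l]
      by (simp add: add_minus_cancel_mid)
  qed
  with b show "\<exists>b. koszul_chain M (length xs) (Suc k) b \<and>
            (\<forall>l. length l = length xs \<longrightarrow> c l \<ominus>\<^bsub>M\<^esub> koszul_diff M xs b l \<in> Y1)" by blast
qed

end

subsection \<open>Koszul homology and regular sequences\<close>

text \<open>The submodule Y + x_1 M + ... + x_n M. The recursion splits off the first entry, as
  \<open>koszul_diff\<close> does.\<close>

fun koszul_span :: "('a, 'b, 'm) module_scheme \<Rightarrow> 'a list \<Rightarrow> 'b set \<Rightarrow> 'b set" where
  "koszul_span M [] Y = Y"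
| "koszul_span M (x # xs) Y =
     {v \<in> carrier M. \<exists>w \<in> carrier M. v \<ominus>\<^bsub>M\<^esub> x \<odot>\<^bsub>M\<^esub> w \<in> koszul_span M xs Y}"

lemma count_list_True_0_iff: "count_list l True = 0 \<longleftrightarrow> l = replicate (length l) False"
  by (induction l) auto

context module
begin

lemma submodule_translate:
  assumes Y: "submodule Y R M" and x: "x \<in> carrier R"
  shows "submodule {v \<in> carrier M. \<exists>w \<in> carrier M. v \<ominus>\<^bsub>M\<^esub> x \<odot>\<^bsub>M\<^esub> w \<in> Y} R M" (is "submodule ?L R M")
proof (rule submoduleI')
  note D = submoduleD[OF Y]
  show "?L \<subseteq> carrier M" by blast
  show "\<zero>\<^bsub>M\<^esub> \<in> ?L" using x D(2) by (auto intro!: bexI[of _ "\<zero>\<^bsub>M\<^esub>"])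
  fix a b assume "a \<in> ?L" "b \<in> ?L"
  then obtain u v where uv: "a \<in> carrier M" "b \<in> carrier M" "u \<in> carrier M" "v \<in> carrier M"
    "a \<ominus>\<^bsub>M\<^esub> x \<odot>\<^bsub>M\<^esub> u \<in> Y" "b \<ominus>\<^bsub>M\<^esub> x \<odot>\<^bsub>M\<^esub> v \<in> Y" by blast
  have "(a \<ominus>\<^bsub>M\<^esub> x \<odot>\<^bsub>M\<^esub> u) \<oplus>\<^bsub>M\<^esub> (b \<ominus>\<^bsub>M\<^esub> x \<odot>\<^bsub>M\<^esub> v) \<in> Y" using uv D(3) by blast
  then have "(a \<oplus>\<^bsub>M\<^esub> b) \<ominus>\<^bsub>M\<^esub> x \<odot>\<^bsub>M\<^esub> (u \<oplus>\<^bsub>M\<^esub> v) \<in> Y"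
    using uv x by (simp add: smult_r_distr minus_add_distrib4)
  moreover have "u \<oplus>\<^bsub>M\<^esub> v \<in> carrier M" "a \<oplus>\<^bsub>M\<^esub> b \<in> carrier M" using uv by simp_all
  ultimately show "a \<oplus>\<^bsub>M\<^esub> b \<in> ?L" by blast
next
  note D = submoduleD[OF Y]
  fix r a assume r: "r \<in> carrier R" and "a \<in> ?L"
  then obtain u where u: "a \<in> carrier M" "u \<in> carrier M" "a \<ominus>\<^bsub>M\<^esub> x \<odot>\<^bsub>M\<^esub> u \<in> Y" by blast
  have "r \<odot>\<^bsub>M\<^esub> (a \<ominus>\<^bsub>M\<^esub> x \<odot>\<^bsub>M\<^esub> u) \<in> Y" using u D(6) r by blast
  then have "r \<odot>\<^bsub>M\<^esub> a \<ominus>\<^bsub>M\<^esub> x \<odot>\<^bsub>M\<^esub> (r \<odot>\<^bsub>M\<^esub> u) \<in> Y"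
    using u x r by (simp add: smult_minus_distr smult_assoc1[symmetric] R.m_comm)
  moreover have "r \<odot>\<^bsub>M\<^esub> u \<in> carrier M" "r \<odot>\<^bsub>M\<^esub> a \<in> carrier M" using u r by simp_all
  ultimately show "r \<odot>\<^bsub>M\<^esub> a \<in> ?L" by blast
qed

lemma submodule_koszul_span:
  "submodule Y R M \<Longrightarrow> set xs \<subseteq> carrier R \<Longrightarrow> submodule (koszul_span M xs Y) R M"
  by (induction xs) (auto simp: submodule_translate)

lemma koszul_span_superset:
  assumes Y: "submodule Y R M" and "set xs \<subseteq> carrier R"
  shows "Y \<subseteq> koszul_span M xs Y"
  using assms(2)
proof (induction xs)
  case (Cons x xs)
  show ?case
  proof
    fix v assume v: "v \<in> Y"
    then have "v \<ominus>\<^bsub>M\<^esub> x \<odot>\<^bsub>M\<^esub> \<zero>\<^bsub>M\<^esub> \<in> koszul_span M xs Y"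
      using Cons submoduleD(1)[OF Y v] by auto
    then show "v \<in> koszul_span M (x # xs) Y" using submoduleD(1)[OF Y v] by auto
  qed
qed simp

lemma smult_in_koszul_span:
  assumes Y: "submodule Y R M" and "set xs \<subseteq> carrier R" "x \<in> set xs" "v \<in> carrier M"
  shows "x \<odot>\<^bsub>M\<^esub> v \<in> koszul_span M xs Y"
  using assms(2,3)
proof (induction xs)
  case (Cons z xs)
  then have z: "z \<in> carrier R" "x \<in> carrier R" "set xs \<subseteq> carrier R" by auto
  note K = submodule_koszul_span[OF Y z(3)]
  show ?case
  proof (cases "x = z")
    case True
    have "x \<odot>\<^bsub>M\<^esub> v \<ominus>\<^bsub>M\<^esub> z \<odot>\<^bsub>M\<^esub> v = \<zero>\<^bsub>M\<^esub>" using True z assms(4) by (simp add: M.minus_eq M.r_neg)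
    then show ?thesis using True z assms(4) submoduleD(2)[OF K] by (auto intro!: bexI[of _ v])
  next
    case False
    then have "x \<odot>\<^bsub>M\<^esub> v \<in> koszul_span M xs Y" using Cons by auto
    then have "x \<odot>\<^bsub>M\<^esub> v \<ominus>\<^bsub>M\<^esub> z \<odot>\<^bsub>M\<^esub> \<zero>\<^bsub>M\<^esub> \<in> koszul_span M xs Y"
      using z assms(4) by simp
    then show ?thesis using z assms(4) by (auto intro!: bexI[of _ "\<zero>\<^bsub>M\<^esub>"])
  qed
qed simp

lemma koszul_span_least:
  assumes L: "submodule L R M" and "Y \<subseteq> L" "set xs \<subseteq> carrier R"
    and "\<And>x v. x \<in> set xs \<Longrightarrow> v \<in> carrier M \<Longrightarrow> x \<odot>\<^bsub>M\<^esub> v \<in> L"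
  shows "koszul_span M xs Y \<subseteq> L"
  using assms(3,4)
proof (induction xs)
  case (Cons x xs)
  then have IH: "koszul_span M xs Y \<subseteq> L" by auto
  show ?case
  proof
    fix v assume "v \<in> koszul_span M (x # xs) Y"
    then obtain w where w: "v \<in> carrier M" "w \<in> carrier M" "v \<ominus>\<^bsub>M\<^esub> x \<odot>\<^bsub>M\<^esub> w \<in> koszul_span M xs Y" by auto
    show "v \<in> L" by (rule submodule_cancel[OF L w(1), of "x \<odot>\<^bsub>M\<^esub> w"]) (use w IH Cons.prems in auto)
  qed
qed (use assms(2) in simp)

lemma koszul_diff_in_span:
  assumes Y: "submodule Y R M" and "set xs \<subseteq> carrier R"
    and "\<And>l. length l = length xs \<Longrightarrow> c l \<in> carrier M" "length l = length xs"
    and "c (replicate (length xs) True) \<in> carrier M"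
  shows "koszul_diff M xs c (replicate (length xs) False) \<in> koszul_span M xs Y"
  using assms(2,3)
proof (induction xs arbitrary: c)
  case Nil
  show ?case using submoduleD(2)[OF Y] by simp
next
  case (Cons x xs)
  then have x: "x \<in> carrier R" "set xs \<subseteq> carrier R" by auto
  let ?l = "replicate (length xs) False"
  have K: "koszul_diff M xs (\<lambda>l. c (False # l)) ?l \<in> koszul_span M xs Y"
    by (rule Cons.IH[OF x(2)]) (use Cons.prems in auto)
  note Kc = submoduleD(1)[OF submodule_koszul_span[OF Y x(2)] K]
  have c: "c (True # ?l) \<in> carrier M" using Cons.prems by auto
  show ?case using K Kc c x by (auto intro!: bexI[OF _ c] simp: add_minus_cancel_left)
qed

text \<open>Each term x_i w_i is placed on the list whose only \<open>True\<close> is at position i.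
  The resulting chain is homogeneous of degree one, which makes its differential vanish outside
  degree zero.\<close>

lemma koszul_span_preimage:
  assumes Y: "submodule Y R M" and "set xs \<subseteq> carrier R" "v \<in> koszul_span M xs Y"
  shows "\<exists>c. (\<forall>l. c l \<in> carrier M \<and> (count_list l True \<noteq> 1 \<longrightarrow> c l = \<zero>\<^bsub>M\<^esub>)) \<and>
    v \<ominus>\<^bsub>M\<^esub> koszul_diff M xs c (replicate (length xs) False) \<in> Y"
  using assms(2,3)
proof (induction xs arbitrary: v)
  case Nil
  then show ?case using submoduleD(1)[OF Y] by (intro exI[of _ "\<lambda>_. \<zero>\<^bsub>M\<^esub>"]) auto
next
  case (Cons x xs)
  let ?l = "replicate (length xs) False"
  from Cons.prems obtain w where w: "v \<in> carrier M" "w \<in> carrier M" "v \<ominus>\<^bsub>M\<^esub> x \<odot>\<^bsub>M\<^esub> w \<in> koszul_span M xs Y"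
    by auto
  have x: "x \<in> carrier R" "set xs \<subseteq> carrier R" using Cons.prems by auto
  obtain c where c: "\<And>l. c l \<in> carrier M" "\<And>l. count_list l True \<noteq> 1 \<Longrightarrow> c l = \<zero>\<^bsub>M\<^esub>"
    "(v \<ominus>\<^bsub>M\<^esub> x \<odot>\<^bsub>M\<^esub> w) \<ominus>\<^bsub>M\<^esub> koszul_diff M xs c ?l \<in> Y"
    using Cons.IH[OF x(2) w(3)] by blast
  define c' where "c' l = (case l of [] \<Rightarrow> \<zero>\<^bsub>M\<^esub> | b # l \<Rightarrow>
    if b then (if count_list l True = 0 then w else \<zero>\<^bsub>M\<^esub>) else c l)" for l
  have "koszul_diff M (x # xs) c' (replicate (length (x # xs)) False) = x \<odot>\<^bsub>M\<^esub> w \<oplus>\<^bsub>M\<^esub> koszul_diff M xs c ?l"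
    by (simp add: c'_def count_list_True_0_iff)
  moreover have "koszul_diff M xs c ?l \<in> carrier M" using koszul_diff_closed[OF x(2), of c ?l] c(1) by simp
  ultimately have "v \<ominus>\<^bsub>M\<^esub> koszul_diff M (x # xs) c' (replicate (length (x # xs)) False) \<in> Y"
    using c(3) w x by (simp add: M.minus_eq M.minus_add M.a_assoc)
  then show ?case using c w by (intro exI[of _ c']) (auto simp: c'_def split: list.splits)
qed

text \<open>A relation between x u and the multiples of \<open>xs\<close>, modulo \<open>Y\<close>,
  is the same as a Koszul cycle of degree one with entry \<open>u\<close> at the first basis vector.
  If the cycle is a boundary, its entry there is a combination of multiples of the remaining
  elements.\<close>

lemma koszul_acyclic_regular:
  assumes Y: "submodule Y R M" and xs: "set (x # xs) \<subseteq> carrier R"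
    and ac: "koszul_acyclic_above M (x # xs) 0 Y"
    and u: "u \<in> carrier M" "x \<odot>\<^bsub>M\<^esub> u \<in> koszul_span M xs Y"
  shows "u \<in> koszul_span M xs Y"
proof -
  let ?F = "replicate (length xs) False"
  have x: "x \<in> carrier R" "set xs \<subseteq> carrier R" using xs by auto
  obtain c0 where c0: "\<And>l. c0 l \<in> carrier M" "\<And>l. count_list l True \<noteq> 1 \<Longrightarrow> c0 l = \<zero>\<^bsub>M\<^esub>"
    "x \<odot>\<^bsub>M\<^esub> u \<ominus>\<^bsub>M\<^esub> koszul_diff M xs c0 ?F \<in> Y"
    using koszul_span_preimage[OF Y x(2) u(2)] by blast
  define c where "c l = (case l of [] \<Rightarrow> \<zero>\<^bsub>M\<^esub> | b # l \<Rightarrow>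
    if b then (if count_list l True = 0 then u else \<zero>\<^bsub>M\<^esub>) else \<ominus>\<^bsub>M\<^esub> c0 l)" for l
  have cc: "c l \<in> carrier M" "count_list l True \<noteq> 1 \<Longrightarrow> c l = \<zero>\<^bsub>M\<^esub>" for l
    using c0(1,2) u by (auto simp: c_def split: list.splits)
  have chain: "koszul_chain M (length (x # xs)) 0 c" using cc by (simp add: koszul_chain_def)
  have "koszul_diff M (x # xs) c l \<in> Y" if l: "length l = length (x # xs)" for l
  proof (cases "count_list l True = 0")
    case True
    then have "l = replicate (length (x # xs)) False" using l count_list_True_0_iff by metis
    then have "koszul_diff M (x # xs) c l = x \<odot>\<^bsub>M\<^esub> u \<ominus>\<^bsub>M\<^esub> koszul_diff M xs c0 ?F"
      using x c0(1) by (simp add: c_def count_list_True_0_iff M.minus_eq koszul_diff_uminus)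
    then show ?thesis using c0(3) by simp
  next
    case False
    then have "koszul_diff M (x # xs) c l = \<zero>\<^bsub>M\<^esub>" by (intro koszul_diff_zero[OF xs _ l] cc(2)) simp
    then show ?thesis using submoduleD(2)[OF Y] by simp
  qed
  from koszul_acyclicD[OF ac chain this] obtain b where b: "koszul_chain M (length (x # xs)) (Suc 0) b"
    and cb: "\<And>l. length l = length (x # xs) \<Longrightarrow> c l \<ominus>\<^bsub>M\<^esub> koszul_diff M (x # xs) b l \<in> Y" by blast
  have bc: "b (True # l) \<in> carrier M" if "length l = length xs" for l
    using koszul_chainD(1)[OF b] that by simp
  have K: "koszul_diff M xs (\<lambda>l. b (True # l)) ?F \<in> koszul_span M xs Y"
    by (rule koszul_diff_in_span[OF Y x(2) bc]) (use bc in auto)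
  note S = submoduleD[OF submodule_koszul_span[OF Y x(2)]]
  \<comment> \<open>At the first basis vector the differential is minus the differential for
    \<open>xs\<close>, so modulo \<open>Y\<close> the element \<open>u\<close> is a boundary of
    degree zero for \<open>xs\<close>.\<close>
  have "c (True # ?F) \<ominus>\<^bsub>M\<^esub> koszul_diff M (x # xs) b (True # ?F) \<in> Y" by (rule cb) simp
  then have "u \<ominus>\<^bsub>M\<^esub> \<ominus>\<^bsub>M\<^esub> koszul_diff M xs (\<lambda>l. b (True # l)) ?F \<in> Y"
    by (simp add: c_def count_list_True_0_iff)
  then have "u \<ominus>\<^bsub>M\<^esub> \<ominus>\<^bsub>M\<^esub> koszul_diff M xs (\<lambda>l. b (True # l)) ?F \<in> koszul_span M xs Y"
    using koszul_span_superset[OF Y x(2)] by blast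
  then show ?thesis
    by (rule submodule_cancel[OF submodule_koszul_span[OF Y x(2)] u(1), rotated]) (rule S(4)[OF K])
qed

text \<open>By \<open>C(2)\<close> there is a sequence starting at \<open>c\<close> with u_k = x
  u_{k+1} modulo \<open>L\<close>. For some k the term u_k is a combination of its predecessors, all
  of which lie in L + x R u_k. So (1 - x r) u_k lies in \<open>L\<close> for some r, and the unit
  can be removed.\<close>

lemma noetherian_nakayama:
  assumes N: "noetherian_module R M" and L: "submodule L R M" and x: "x \<in> carrier R"
    and unit: "\<And>r. r \<in> carrier R \<Longrightarrow> \<one> \<ominus> x \<otimes> r \<in> Units R"
    and C: "\<And>c. c \<in> C \<Longrightarrow> c \<in> carrier M" "\<And>c. c \<in> C \<Longrightarrow> \<exists>c'\<in>C. c \<ominus>\<^bsub>M\<^esub> x \<odot>\<^bsub>M\<^esub> c' \<in> L"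
    and c: "c \<in> C"
  shows "c \<in> L"
proof -
  note D = submoduleD[OF L]
  obtain f where f: "\<And>c. c \<in> C \<Longrightarrow> f c \<in> C" "\<And>c. c \<in> C \<Longrightarrow> c \<ominus>\<^bsub>M\<^esub> x \<odot>\<^bsub>M\<^esub> f c \<in> L"
    using C(2) by metis
  define u where "u k = (f ^^ k) c" for k
  have uC: "u k \<in> C" for k by (induction k) (use c f in \<open>auto simp: u_def\<close>)
  note uM = C(1)[OF uC]
  have us: "u k \<ominus>\<^bsub>M\<^esub> x \<odot>\<^bsub>M\<^esub> u (Suc k) \<in> L" for k using f(2)[OF uC] by (simp add: u_def)
  obtain k where k: "u k \<in> module_span R M (u ` {..<k})" by (rule noetherian_moduleD[OF N uM])
  \<comment> \<open>This is L + x R u_k. Going backwards from u_{k-1}, every earlier term is seen to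
    lie in it.\<close>
  define S where "S = {v \<in> carrier M. \<exists>r \<in> carrier R. v \<ominus>\<^bsub>M\<^esub> (x \<otimes> r) \<odot>\<^bsub>M\<^esub> u k \<in> L}"
  have SI: "v \<in> S" if "v \<in> carrier M" "r \<in> carrier R" "v \<ominus>\<^bsub>M\<^esub> (x \<otimes> r) \<odot>\<^bsub>M\<^esub> u k \<in> L" for v r
    unfolding S_def by (rule CollectI, rule conjI, rule that(1), rule bexI, rule that(3), rule that(2))
  have SE: "\<exists>r\<in>carrier R. v \<ominus>\<^bsub>M\<^esub> (x \<otimes> r) \<odot>\<^bsub>M\<^esub> u k \<in> L" "v \<in> carrier M" if "v \<in> S" for v
    using that unfolding S_def by simp_all
  have Ssub: "submodule S R M"
  proof (rule submoduleI')
    show "S \<subseteq> carrier M" using SE by blast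
    show "\<zero>\<^bsub>M\<^esub> \<in> S" by (rule SI[of _ \<zero>]) (use x uM D(2) in auto)
    fix a b assume ab: "a \<in> S" "b \<in> S"
    then obtain r s where rs: "r \<in> carrier R" "a \<ominus>\<^bsub>M\<^esub> (x \<otimes> r) \<odot>\<^bsub>M\<^esub> u k \<in> L" "s \<in> carrier R" "b \<ominus>\<^bsub>M\<^esub> (x \<otimes> s) \<odot>\<^bsub>M\<^esub> u k \<in> L"
      using SE by metis
    show "a \<oplus>\<^bsub>M\<^esub> b \<in> S"
    proof (rule SI[of _ "r \<oplus> s"])
      have "(a \<ominus>\<^bsub>M\<^esub> (x \<otimes> r) \<odot>\<^bsub>M\<^esub> u k) \<oplus>\<^bsub>M\<^esub> (b \<ominus>\<^bsub>M\<^esub> (x \<otimes> s) \<odot>\<^bsub>M\<^esub> u k) \<in> L" by (rule D(3)[OF rs(2,4)])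
      then show "a \<oplus>\<^bsub>M\<^esub> b \<ominus>\<^bsub>M\<^esub> (x \<otimes> (r \<oplus> s)) \<odot>\<^bsub>M\<^esub> u k \<in> L"
        using SE(2)[OF ab(1)] SE(2)[OF ab(2)] rs(1,3) x uM
        by (simp add: R.r_distr smult_l_distr minus_add_distrib4)
    qed (use SE(2)[OF ab(1)] SE(2)[OF ab(2)] rs in auto)
  next
    fix t a assume t: "t \<in> carrier R" and a: "a \<in> S"
    then obtain r where r: "r \<in> carrier R" "a \<ominus>\<^bsub>M\<^esub> (x \<otimes> r) \<odot>\<^bsub>M\<^esub> u k \<in> L" using SE by metis
    show "t \<odot>\<^bsub>M\<^esub> a \<in> S"
    proof (rule SI[of _ "t \<otimes> r"])
      have "t \<odot>\<^bsub>M\<^esub> (a \<ominus>\<^bsub>M\<^esub> (x \<otimes> r) \<odot>\<^bsub>M\<^esub> u k) \<in> L" by (rule D(6)[OF t r(2)])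
      moreover have "x \<otimes> (t \<otimes> r) = t \<otimes> (x \<otimes> r)" using x t r by (simp add: R.m_lcomm)
      ultimately show "t \<odot>\<^bsub>M\<^esub> a \<ominus>\<^bsub>M\<^esub> (x \<otimes> (t \<otimes> r)) \<odot>\<^bsub>M\<^esub> u k \<in> L"
        using SE(2)[OF a] r x uM t by (simp add: smult_minus_distr smult_assoc1)
    qed (use SE(2)[OF a] r t in auto)
  qed
  have uS: "j < k \<Longrightarrow> u (k - Suc j) \<in> S" for j
  proof (induction j)
    case 0
    then show ?case using us[of "k - 1"] x by (intro SI[of _ \<one>] uM) auto
  next
    case (Suc j)
    then obtain r where r: "r \<in> carrier R" "u (k - Suc j) \<ominus>\<^bsub>M\<^esub> (x \<otimes> r) \<odot>\<^bsub>M\<^esub> u k \<in> L"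
      using SE(1)[of "u (k - Suc j)"] by auto
    let ?a = "u (k - Suc (Suc j))"
    have s: "?a \<ominus>\<^bsub>M\<^esub> x \<odot>\<^bsub>M\<^esub> u (k - Suc j) \<in> L" using us[of "k - Suc (Suc j)"] Suc.prems by (simp add: Suc_diff_Suc)
    show ?case
    proof (rule SI[of _ "x \<otimes> r"])
      have "(?a \<ominus>\<^bsub>M\<^esub> x \<odot>\<^bsub>M\<^esub> u (k - Suc j)) \<oplus>\<^bsub>M\<^esub> x \<odot>\<^bsub>M\<^esub> (u (k - Suc j) \<ominus>\<^bsub>M\<^esub> (x \<otimes> r) \<odot>\<^bsub>M\<^esub> u k) \<in> L"
        by (rule D(3)[OF s D(6)[OF x r(2)]])
      then show "?a \<ominus>\<^bsub>M\<^esub> (x \<otimes> (x \<otimes> r)) \<odot>\<^bsub>M\<^esub> u k \<in> L"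
        using uM x r(1) by (simp add: smult_minus_distr smult_assoc1 add_minus_cancel_mid)
    qed (use uM r x in auto)
  qed
  have "u i \<in> S" if "i < k" for i
    using uS[of "k - Suc i"] that by (simp add: Suc_diff_Suc)
  then have "u ` {..<k} \<subseteq> S" by blast
  then have "u k \<in> S" using k span_least[OF Ssub] by blast
  then obtain r where r: "r \<in> carrier R" "u k \<ominus>\<^bsub>M\<^esub> (x \<otimes> r) \<odot>\<^bsub>M\<^esub> u k \<in> L" using SE by blast
  have "(\<one> \<ominus> x \<otimes> r) \<odot>\<^bsub>M\<^esub> u k \<in> L" using r x uM by (simp add: smult_minus_distr2)
  moreover have U: "\<one> \<ominus> x \<otimes> r \<in> Units R" by (rule unit[OF r(1)])
  ultimately have "inv (\<one> \<ominus> x \<otimes> r) \<odot>\<^bsub>M\<^esub> ((\<one> \<ominus> x \<otimes> r) \<odot>\<^bsub>M\<^esub> u k) \<in> L" by - (rule D(6), auto)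
  also have "inv (\<one> \<ominus> x \<otimes> r) \<odot>\<^bsub>M\<^esub> ((\<one> \<ominus> x \<otimes> r) \<odot>\<^bsub>M\<^esub> u k) = (inv (\<one> \<ominus> x \<otimes> r) \<otimes> (\<one> \<ominus> x \<otimes> r)) \<odot>\<^bsub>M\<^esub> u k"
    by (rule smult_assoc1[symmetric, OF R.Units_inv_closed[OF U] R.Units_closed[OF U] uM])
  also have "\<dots> = u k" unfolding R.Units_l_inv[OF U] by (rule smult_one[OF uM])
  finally have "u k \<in> L" .
  \<comment> \<open>Membership in \<open>L\<close> goes down the sequence from u_k to u_0, which is
    \<open>c\<close>.\<close>
  moreover have "u j \<in> L" if "u (Suc j) \<in> L" for j
    by (rule submodule_cancel[OF L uM D(6)[OF x that] us])
  ultimately have "u 0 \<in> L" by (induction k) auto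
  then show ?thesis by (simp add: u_def)
qed

text \<open>The cycles of the Koszul complex on \<open>xs\<close> satisfy \<open>Z = B + x Z\<close>, where \<open>B\<close> are the boundaries.\<close>

lemma koszul_acyclic_tail:
  assumes N: "noetherian_module R M" and Y: "submodule Y R M" and xs: "set (x # xs) \<subseteq> carrier R"
    and unit: "\<And>r. r \<in> carrier R \<Longrightarrow> \<one> \<ominus> x \<otimes> r \<in> Units R"
    and ac: "koszul_acyclic_above M (x # xs) 0 Y"
  shows "koszul_acyclic_above M xs 0 Y"
proof (rule koszul_acyclicI)
  note D = submoduleD[OF Y]
  have x: "x \<in> carrier R" "set xs \<subseteq> carrier R" using xs by auto
  let ?n = "length xs"
  let ?T = "{l :: bool list. length l = ?n}"
  let ?P = "power_module ?T M"
  interpret P: module R ?P by (rule module_power) (rule module_axioms)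
  have "finite {l :: bool list. set l \<subseteq> UNIV \<and> length l = ?n}" by (rule finite_lists_length_eq) simp
  then have NP: "noetherian_module R ?P" by (intro noetherian_power_module[OF module_axioms N]) simp
  \<comment> \<open>\<open>L\<close> consists of the boundaries of chains of degree above one and
    \<open>C\<close> of the cycles of positive degree, both modulo \<open>Y\<close>. They sit in a
    finite power of \<open>M\<close>, where the Nakayama argument applies.\<close>
  define L where "L = {v \<in> carrier ?P. \<exists>b. koszul_chain M ?n (Suc 0) b \<and> (\<forall>l. length l = ?n \<longrightarrow> v l \<ominus>\<^bsub>M\<^esub> koszul_diff M xs b l \<in> Y)}"
  have LI: "v \<in> L" if "v \<in> carrier ?P" "koszul_chain M ?n (Suc 0) b" "\<And>l. length l = ?n \<Longrightarrow> v l \<ominus>\<^bsub>M\<^esub> koszul_diff M xs b l \<in> Y" for v b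
    using that unfolding L_def by blast
  have LE: "\<exists>b. koszul_chain M ?n (Suc 0) b \<and> (\<forall>l. length l = ?n \<longrightarrow> v l \<ominus>\<^bsub>M\<^esub> koszul_diff M xs b l \<in> Y)" "v \<in> carrier ?P" if "v \<in> L" for v
    using that unfolding L_def by blast+
  define C where "C = {v \<in> carrier ?P. koszul_chain M ?n 0 v \<and> (\<forall>l. length l = ?n \<longrightarrow> koszul_diff M xs v l \<in> Y)}"
  have CI: "restrict v ?T \<in> C" if "koszul_chain M ?n 0 v" "\<And>l. length l = ?n \<Longrightarrow> koszul_diff M xs v l \<in> Y" for v
  proof -
    have "koszul_diff M xs (restrict v ?T) l = koszul_diff M xs v l" if "length l = ?n" for l
      by (rule koszul_diff_cong) (use that in auto)
    then show ?thesis using that by (auto simp: C_def koszul_chain_def)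
  qed
  have L: "submodule L R ?P"
  proof (rule P.submoduleI')
    show "L \<subseteq> carrier ?P" unfolding L_def by blast
    have "koszul_diff M xs (\<lambda>_. \<zero>\<^bsub>M\<^esub>) l = \<zero>\<^bsub>M\<^esub>" if "length l = ?n" for l
      by (rule koszul_diff_zero) (use x that in auto)
    then show "\<zero>\<^bsub>?P\<^esub> \<in> L" by (intro LI[of _ "\<lambda>_. \<zero>\<^bsub>M\<^esub>"]) (auto simp: koszul_chain_def D(2))
    fix v w assume v: "v \<in> L" and w: "w \<in> L"
    obtain b b' where b: "koszul_chain M ?n (Suc 0) b" "\<And>l. length l = ?n \<Longrightarrow> v l \<ominus>\<^bsub>M\<^esub> koszul_diff M xs b l \<in> Y"
      and b': "koszul_chain M ?n (Suc 0) b'" "\<And>l. length l = ?n \<Longrightarrow> w l \<ominus>\<^bsub>M\<^esub> koszul_diff M xs b' l \<in> Y"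
      using LE(1)[OF v] LE(1)[OF w] by blast
    note B = koszul_chainD[OF b(1)] and B' = koszul_chainD[OF b'(1)]
    have vw: "v l \<in> carrier M" "w l \<in> carrier M" if "length l = ?n" for l
      using LE(2)[OF v] LE(2)[OF w] that by auto
    show "v \<oplus>\<^bsub>?P\<^esub> w \<in> L"
    proof (rule LI[of _ "\<lambda>l. b l \<oplus>\<^bsub>M\<^esub> b' l"])
      show "v \<oplus>\<^bsub>?P\<^esub> w \<in> carrier ?P" by (rule P.M.a_closed[OF LE(2)[OF v] LE(2)[OF w]])
      show "koszul_chain M ?n (Suc 0) (\<lambda>l. b l \<oplus>\<^bsub>M\<^esub> b' l)" using B B' by (simp add: koszul_chain_def)
      fix l :: "bool list" assume l: "length l = ?n"
      have "(v l \<ominus>\<^bsub>M\<^esub> koszul_diff M xs b l) \<oplus>\<^bsub>M\<^esub> (w l \<ominus>\<^bsub>M\<^esub> koszul_diff M xs b' l) \<in> Y"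
        by (rule D(3)[OF b(2)[OF l] b'(2)[OF l]])
      moreover have "koszul_diff M xs b l \<in> carrier M" "koszul_diff M xs b' l \<in> carrier M"
        by (rule koszul_diff_closed[OF x(2) _ l], fact B B')+
      ultimately show "(v \<oplus>\<^bsub>?P\<^esub> w) l \<ominus>\<^bsub>M\<^esub> koszul_diff M xs (\<lambda>l. b l \<oplus>\<^bsub>M\<^esub> b' l) l \<in> Y"
        using l vw[OF l] koszul_diff_add[OF x(2) B(1) B'(1) l] by (simp add: minus_add_distrib4)
    qed
  next
    fix r v assume r: "r \<in> carrier R" and v: "v \<in> L"
    obtain b where b: "koszul_chain M ?n (Suc 0) b" "\<And>l. length l = ?n \<Longrightarrow> v l \<ominus>\<^bsub>M\<^esub> koszul_diff M xs b l \<in> Y"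
      using LE(1)[OF v] by blast
    note B = koszul_chainD[OF b(1)]
    have vw: "v l \<in> carrier M" if "length l = ?n" for l using LE(2)[OF v] that by auto
    show "r \<odot>\<^bsub>?P\<^esub> v \<in> L"
    proof (rule LI[of _ "\<lambda>l. r \<odot>\<^bsub>M\<^esub> b l"])
      show "r \<odot>\<^bsub>?P\<^esub> v \<in> carrier ?P" by (rule P.smult_closed[OF r LE(2)[OF v]])
      show "koszul_chain M ?n (Suc 0) (\<lambda>l. r \<odot>\<^bsub>M\<^esub> b l)" using B r by (simp add: koszul_chain_def)
      fix l :: "bool list" assume l: "length l = ?n"
      have "r \<odot>\<^bsub>M\<^esub> (v l \<ominus>\<^bsub>M\<^esub> koszul_diff M xs b l) \<in> Y" by (rule D(6)[OF r b(2)[OF l]])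
      moreover have "koszul_diff M xs b l \<in> carrier M" using koszul_diff_closed[OF x(2) B(1) l] .
      ultimately show "(r \<odot>\<^bsub>?P\<^esub> v) l \<ominus>\<^bsub>M\<^esub> koszul_diff M xs (\<lambda>l. r \<odot>\<^bsub>M\<^esub> b l) l \<in> Y"
        using l r vw[OF l] koszul_diff_smult[OF r x(2) B(1) l] by (simp add: smult_minus_distr)
    qed
  qed
  have step: "\<exists>c'\<in>C. c \<ominus>\<^bsub>?P\<^esub> x \<odot>\<^bsub>?P\<^esub> c' \<in> L" if "c \<in> C" for c
  proof -
    from that have cP: "c \<in> carrier ?P" and c: "koszul_chain M ?n 0 c" "\<And>l. length l = ?n \<Longrightarrow> koszul_diff M xs c l \<in> Y"
      unfolding C_def by blast+
    note c' = koszul_chainD[OF c(1)]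
    \<comment> \<open>The cycle \<open>c\<close> for \<open>xs\<close>, regarded as a cycle for
      \<open>x # xs\<close> without component along the new basis vector.\<close>
    define ch where "ch l = (case l of [] \<Rightarrow> \<zero>\<^bsub>M\<^esub> | b # l \<Rightarrow> if b then \<zero>\<^bsub>M\<^esub> else c l)" for l
    have chain: "koszul_chain M (length (x # xs)) 0 ch" using c' by (auto simp: koszul_chain_def ch_def split: list.splits)
    have "koszul_diff M (x # xs) ch l \<in> Y" if l: "length l = length (x # xs)" for l
    proof -
      obtain b l' where l': "l = b # l'" "length l' = ?n" using l by (cases l) auto
      have 0: "koszul_diff M xs (\<lambda>_. \<zero>\<^bsub>M\<^esub>) l' = \<zero>\<^bsub>M\<^esub>" by (rule koszul_diff_zero) (use x l' in auto)
      have "koszul_diff M xs c l' \<in> carrier M" by (rule koszul_diff_closed[OF x(2) c'(1) l'(2)])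
      then show ?thesis using l' 0 c(2)[OF l'(2)] x D(2) by (cases b) (simp_all add: ch_def)
    qed
    from koszul_acyclicD[OF ac chain this] obtain b where b: "koszul_chain M (length (x # xs)) (Suc 0) b"
      and cb: "\<And>l. length l = length (x # xs) \<Longrightarrow> ch l \<ominus>\<^bsub>M\<^esub> koszul_diff M (x # xs) b l \<in> Y" by blast
    note B = koszul_chainD[OF b]
    \<comment> \<open>The components of \<open>b\<close> along the first basis vector and away from
      it. Comparing entries shows that \<open>c1\<close> is a cycle modulo \<open>Y\<close>, and
      that modulo \<open>Y\<close> the chain \<open>c\<close> is x c1 plus the boundary of
      \<open>b1\<close>.\<close>
    define c1 where "c1 l = b (True # l)" for l
    define b1 where "b1 l = b (False # l)" for l
    have c1: "koszul_chain M ?n 0 c1" and b1: "koszul_chain M ?n (Suc 0) b1"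
      unfolding koszul_chain_def c1_def b1_def using B by simp_all
    note B1 = koszul_chainD[OF b1] and C1 = koszul_chainD[OF c1]
    have dc1: "koszul_diff M xs c1 l \<in> carrier M" if "length l = ?n" for l by (rule koszul_diff_closed[OF x(2) C1(1) that])
    have db1: "koszul_diff M xs b1 l \<in> carrier M" if "length l = ?n" for l by (rule koszul_diff_closed[OF x(2) B1(1) that])
    have "koszul_diff M xs c1 l \<in> Y" if l: "length l = ?n" for l
    proof -
      have "ch (True # l) \<ominus>\<^bsub>M\<^esub> koszul_diff M (x # xs) b (True # l) \<in> Y" by (rule cb) (simp add: l)
      then show ?thesis using dc1[OF l] by (simp add: ch_def c1_def[symmetric] M.minus_eq)
    qed
    then have c1C: "restrict c1 ?T \<in> C" by (rule CI[OF c1])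
    have "c \<ominus>\<^bsub>?P\<^esub> x \<odot>\<^bsub>?P\<^esub> restrict c1 ?T \<in> L"
    proof (rule LI[OF _ b1])
      have rc: "restrict c1 ?T \<in> carrier ?P" using c1C unfolding C_def by blast
      then have xc: "x \<odot>\<^bsub>?P\<^esub> restrict c1 ?T \<in> carrier ?P" by (rule P.smult_closed[OF x(1)])
      show "c \<ominus>\<^bsub>?P\<^esub> x \<odot>\<^bsub>?P\<^esub> restrict c1 ?T \<in> carrier ?P" by (rule P.M.minus_closed[OF cP xc])
      fix l :: "bool list" assume l: "length l = ?n"
      have "ch (False # l) \<ominus>\<^bsub>M\<^esub> koszul_diff M (x # xs) b (False # l) \<in> Y" by (rule cb) (simp add: l)
      then have "c l \<ominus>\<^bsub>M\<^esub> (x \<odot>\<^bsub>M\<^esub> c1 l \<oplus>\<^bsub>M\<^esub> koszul_diff M xs b1 l) \<in> Y"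
        by (simp add: ch_def c1_def b1_def[abs_def])
      moreover have "c l \<ominus>\<^bsub>M\<^esub> (x \<odot>\<^bsub>M\<^esub> c1 l \<oplus>\<^bsub>M\<^esub> koszul_diff M xs b1 l) = (c l \<ominus>\<^bsub>M\<^esub> x \<odot>\<^bsub>M\<^esub> c1 l) \<ominus>\<^bsub>M\<^esub> koszul_diff M xs b1 l"
        using c'(1)[OF l] C1(1)[OF l] db1[OF l] x by (simp add: M.minus_eq M.minus_add M.a_assoc)
      ultimately show "(c \<ominus>\<^bsub>?P\<^esub> x \<odot>\<^bsub>?P\<^esub> restrict c1 ?T) l \<ominus>\<^bsub>M\<^esub> koszul_diff M xs b1 l \<in> Y"
        unfolding power_a_minus[OF module_axioms cP xc] using l by simp
    qed
    with c1C show ?thesis by blast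
  qed
  fix c assume c: "koszul_chain M ?n 0 c" and dc: "\<And>l. length l = ?n \<Longrightarrow> koszul_diff M xs c l \<in> Y"
  have "restrict c ?T \<in> L"
    by (rule P.noetherian_nakayama[OF NP L x(1) unit _ step CI[OF c dc]]) (auto simp: C_def)
  then show "\<exists>b. koszul_chain M ?n (Suc 0) b \<and> (\<forall>l. length l = ?n \<longrightarrow> c l \<ominus>\<^bsub>M\<^esub> koszul_diff M xs b l \<in> Y)"
    using LE(1)[of "restrict c ?T"] by simp
qed

end

subsection \<open>Ext over quotient rings\<close>

declare free_module_simps [simp del]

lemma (in abelian_group) minus_eq_imp:
  "\<lbrakk>u \<in> carrier G; v \<in> carrier G\<rbrakk> \<Longrightarrow> (u \<oplus> v) \<ominus> u = v"
  using r_neg1[of u v] a_comm[of "u \<oplus> v" "\<ominus> u"] by (simp add: minus_eq)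

locale cring_ideal = cring R + ideal A R for A and R (structure)
begin

lemma quotient_cring: "cring (R Quot A)"
  by (rule quotient_is_cring[OF is_cring])

sublocale Q: cring "R Quot A"
  by (rule quotient_cring)

sublocale proj: ring_hom_ring R "R Quot A" "(+>) A"
  by (rule rcos_ring_hom_ring)

lemma proj_eq_iff: "a \<in> carrier R \<Longrightarrow> b \<in> carrier R \<Longrightarrow> A +> a = A +> b \<longleftrightarrow> a \<ominus> b \<in> A"
  by (rule quotient_eq_iff_same_a_r_cos[OF is_ideal, symmetric])

lemma proj_zero_iff: "a \<in> carrier R \<Longrightarrow> A +> a = \<zero>\<^bsub>R Quot A\<^esub> \<longleftrightarrow> a \<in> A"
  using proj_eq_iff[of a \<zero>] proj.hom_zero by (simp add: minus_eq)

lemma proj_minus: "a \<in> carrier R \<Longrightarrow> b \<in> carrier R \<Longrightarrow> A +> (a \<ominus> b) = (A +> a) \<ominus>\<^bsub>R Quot A\<^esub> (A +> b)"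
  by (simp add: minus_eq Q.minus_eq)

lemma proj_cancel:
  assumes nzd: "\<And>r. r \<in> carrier R \<Longrightarrow> x \<otimes> r \<in> A \<Longrightarrow> r \<in> A" and "x \<in> carrier R" "a \<in> carrier R" "b \<in> carrier R"
    and eq: "(A +> x) \<otimes>\<^bsub>R Quot A\<^esub> (A +> a) = (A +> x) \<otimes>\<^bsub>R Quot A\<^esub> (A +> b)"
  shows "A +> a = A +> b"
proof -
  have "A +> (x \<otimes> a) = A +> (x \<otimes> b)" using eq assms by simp
  then have "x \<otimes> a \<ominus> x \<otimes> b \<in> A" using proj_eq_iff[of "x \<otimes> a" "x \<otimes> b"] assms(2-4) by blast
  also have "x \<otimes> a \<ominus> x \<otimes> b = x \<otimes> (a \<ominus> b)" using assms(2-4) by (simp add: minus_eq r_distr r_minus)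
  finally show ?thesis using proj_eq_iff[OF assms(3,4)] nzd[OF minus_closed[OF assms(3,4)]] by blast
qed

end

text \<open>A homomorphism Y -> R/A, given by representatives in R. Only the cosets of the values
  are linear, which keeps all maps R-valued while the ideal \<open>A\<close> changes.\<close>

definition linear_mod ::
  "('a, 'r) ring_scheme \<Rightarrow> 'a set \<Rightarrow> ('a, 'b, 'm) module_scheme \<Rightarrow> 'b set \<Rightarrow> ('b \<Rightarrow> 'a) \<Rightarrow> bool" where
  "linear_mod R A M Y g \<longleftrightarrow>
     (\<forall>v\<in>Y. g v \<in> carrier R) \<and>
     (\<forall>u\<in>Y. \<forall>v\<in>Y. A +>\<^bsub>R\<^esub> g (u \<oplus>\<^bsub>M\<^esub> v) = A +>\<^bsub>R\<^esub> (g u \<oplus>\<^bsub>R\<^esub> g v)) \<and>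
     (\<forall>r\<in>carrier R. \<forall>v\<in>Y. A +>\<^bsub>R\<^esub> g (r \<odot>\<^bsub>M\<^esub> v) = A +>\<^bsub>R\<^esub> (r \<otimes>\<^bsub>R\<^esub> g v))"

lemma linear_modD:
  assumes "linear_mod R A M Y g"
  shows "v \<in> Y \<Longrightarrow> g v \<in> carrier R"
    "u \<in> Y \<Longrightarrow> v \<in> Y \<Longrightarrow> A +>\<^bsub>R\<^esub> g (u \<oplus>\<^bsub>M\<^esub> v) = A +>\<^bsub>R\<^esub> (g u \<oplus>\<^bsub>R\<^esub> g v)"
    "r \<in> carrier R \<Longrightarrow> v \<in> Y \<Longrightarrow> A +>\<^bsub>R\<^esub> g (r \<odot>\<^bsub>M\<^esub> v) = A +>\<^bsub>R\<^esub> (r \<otimes>\<^bsub>R\<^esub> g v)"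
  using assms by (auto simp: linear_mod_def)

lemma linear_modI:
  assumes "\<And>v. v \<in> Y \<Longrightarrow> g v \<in> carrier R"
    "\<And>u v. u \<in> Y \<Longrightarrow> v \<in> Y \<Longrightarrow> A +>\<^bsub>R\<^esub> g (u \<oplus>\<^bsub>M\<^esub> v) = A +>\<^bsub>R\<^esub> (g u \<oplus>\<^bsub>R\<^esub> g v)"
    "\<And>r v. r \<in> carrier R \<Longrightarrow> v \<in> Y \<Longrightarrow> A +>\<^bsub>R\<^esub> g (r \<odot>\<^bsub>M\<^esub> v) = A +>\<^bsub>R\<^esub> (r \<otimes>\<^bsub>R\<^esub> g v)"
  shows "linear_mod R A M Y g"
  using assms by (auto simp: linear_mod_def)

text \<open>For \<open>A\<^sup>n \<subseteq> Y \<subseteq> R\<^sup>n\<close> this says that \<open>t\<close> annihilates \<open>Ext\<^sup>1\<close> of \<open>R\<^sup>n/Y\<close> and \<open>R/A\<close> over the ring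
  \<open>R/A\<close>: a map \<open>g\<close> as below is a homomorphism \<open>Y/A\<^sup>n \<rightarrow> R/A\<close>, and \<open>t g\<close> extends to \<open>(R/A)\<^sup>n\<close>.\<close>

definition kills_ext :: "('a, 'r) ring_scheme \<Rightarrow> 'a set \<Rightarrow> nat \<Rightarrow> (nat \<Rightarrow> 'a) set \<Rightarrow> 'a \<Rightarrow> bool" where
  "kills_ext R A n Y t \<longleftrightarrow>
     (\<forall>g. linear_mod R A (free_module R n) Y g \<and> (\<forall>v \<in> {..<n} \<rightarrow>\<^sub>E A. g v \<in> A) \<longrightarrow>
       (\<exists>h \<in> mod_hom R (free_module R n) (regular_module R).
          \<forall>v\<in>Y. A +>\<^bsub>R\<^esub> (t \<otimes>\<^bsub>R\<^esub> g v) = A +>\<^bsub>R\<^esub> h v))"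

lemma kills_extD:
  assumes "kills_ext R A n Y t" "linear_mod R A (free_module R n) Y g" "\<And>v. v \<in> {..<n} \<rightarrow>\<^sub>E A \<Longrightarrow> g v \<in> A"
  obtains h where "h \<in> mod_hom R (free_module R n) (regular_module R)"
    "\<And>v. v \<in> Y \<Longrightarrow> A +>\<^bsub>R\<^esub> (t \<otimes>\<^bsub>R\<^esub> g v) = A +>\<^bsub>R\<^esub> h v"
proof -
  have "\<exists>h \<in> mod_hom R (free_module R n) (regular_module R).
          \<forall>v\<in>Y. A +>\<^bsub>R\<^esub> (t \<otimes>\<^bsub>R\<^esub> g v) = A +>\<^bsub>R\<^esub> h v"
    using assms unfolding kills_ext_def by simp
  then show ?thesis using that by blast
qed

lemma (in cring) module_hom_regularD:
  assumes "h \<in> mod_hom R (free_module R n) (regular_module R)"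
  shows "v \<in> carrier (free_module R n) \<Longrightarrow> h v \<in> carrier R"
    "u \<in> carrier (free_module R n) \<Longrightarrow> v \<in> carrier (free_module R n) \<Longrightarrow> h (u \<oplus>\<^bsub>free_module R n\<^esub> v) = h u \<oplus> h v"
    "r \<in> carrier R \<Longrightarrow> v \<in> carrier (free_module R n) \<Longrightarrow> h (r \<odot>\<^bsub>free_module R n\<^esub> v) = r \<otimes> h v"
    "u \<in> carrier (free_module R n) \<Longrightarrow> v \<in> carrier (free_module R n) \<Longrightarrow> h (u \<ominus>\<^bsub>free_module R n\<^esub> v) = h u \<ominus> h v"
  using mod_homD[OF assms] mod_hom_simps(3)[OF module_free module_regular assms] by simp_all

lemma (in cring) submodule_power_ideal:
  assumes "ideal A R" shows "submodule ({..<n} \<rightarrow>\<^sub>E A) R (free_module R n)"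
proof -
  interpret A: ideal A R by fact
  interpret F: module R "free_module R n" by (rule module_free)
  show ?thesis
  proof (rule F.submoduleI')
    show "{..<n} \<rightarrow>\<^sub>E A \<subseteq> carrier (free_module R n)" by (simp add: free_module_simps PiE_mono A.a_subset)
  qed (auto simp: PiE_iff A.I_l_closed free_module_simps)
qed

text \<open>The vector is a combination of unit vectors with coefficients in \<open>A\<close>. As
  the unit vectors themselves are in general outside A^n, the coordinates are cleared one at a time
  inside A^n.\<close>

lemma (in cring) hom_power_ideal:
  assumes A: "ideal A R" and h: "h \<in> mod_hom R (free_module R n) (free_module R m)" and v: "v \<in> {..<n} \<rightarrow>\<^sub>E A"
  shows "h v \<in> {..<m} \<rightarrow>\<^sub>E A"
proof -
  interpret A: ideal A R by fact
  interpret F: module R "free_module R n" by (rule module_free)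
  interpret G: module R "free_module R m" by (rule module_free)
  have hc: "h w \<in> carrier (free_module R m)" if "w \<in> carrier (free_module R n)" for w
    by (rule mod_homD(1)[OF h that])
  have claim: "w \<in> {..<n} \<rightarrow>\<^sub>E A \<Longrightarrow> (\<forall>i. k \<le> i \<and> i < n \<longrightarrow> w i = \<zero>) \<Longrightarrow> k \<le> n \<Longrightarrow> h w \<in> {..<m} \<rightarrow>\<^sub>E A" for k w
  proof (induction k arbitrary: w)
    case 0
    then have w0: "w = \<zero>\<^bsub>free_module R n\<^esub>" by (auto simp: fun_eq_iff PiE_iff extensional_def free_module_simps)
    have "h w = \<zero>\<^bsub>free_module R m\<^esub>" unfolding w0 by (rule mod_hom_simps(1)[OF module_free module_free h])
    then show ?case by (auto simp: PiE_iff free_module_simps extensional_def)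
  next
    case (Suc k)
    have k: "k < n" using Suc by simp
    define u where "u = w(k := \<zero>)"
    have u: "u \<in> {..<n} \<rightarrow>\<^sub>E A"
      using Suc.prems k by (auto simp: u_def PiE_iff extensional_def)
    have hu: "h u \<in> {..<m} \<rightarrow>\<^sub>E A"
      by (rule Suc.IH[OF u]) (use Suc.prems k in \<open>auto simp: u_def not_less_eq_eq\<close>)
    have uc: "u \<in> carrier (free_module R n)" using u A.Icarr by (auto simp: PiE_iff free_module_simps)
    have wk: "w k \<in> A" using Suc.prems(1) k by auto
    have "w = u \<oplus>\<^bsub>free_module R n\<^esub> w k \<odot>\<^bsub>free_module R n\<^esub> unit_vector R n k"
      using Suc.prems(1) k A.Icarr by (auto simp: fun_eq_iff u_def unit_vector_def PiE_iff extensional_def free_module_simps)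
    then have "h w = h u \<oplus>\<^bsub>free_module R m\<^esub> w k \<odot>\<^bsub>free_module R m\<^esub> h (unit_vector R n k)"
      using mod_homD(2)[OF h uc, of "w k \<odot>\<^bsub>free_module R n\<^esub> unit_vector R n k"]
        mod_homD(3)[OF h A.Icarr[OF wk] unit_vector_closed]
        F.smult_closed[OF A.Icarr[OF wk] unit_vector_closed] by metis
    moreover have "w k \<odot>\<^bsub>free_module R m\<^esub> h (unit_vector R n k) \<in> {..<m} \<rightarrow>\<^sub>E A"
      using wk hc[OF unit_vector_closed] by (auto simp: PiE_iff A.I_r_closed free_module_simps)
    ultimately show ?case using hu by (auto simp: PiE_iff free_module_simps extensional_def)
  qed
  show ?thesis by (rule claim[OF v, of n]) auto
qed

lemma (in cring) hom_power_ideal_regular: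
  assumes A: "ideal A R" and h: "h \<in> mod_hom R (free_module R n) (regular_module R)" and v: "v \<in> {..<n} \<rightarrow>\<^sub>E A"
  shows "h v \<in> A"
proof -
  have "(\<lambda>w. \<lambda>i\<in>{..<Suc 0}. h w) \<in> mod_hom R (free_module R n) (free_module R (Suc 0))"
    by (rule mod_homI) (auto simp: module_hom_regularD[OF h] free_module_simps(1)[of R "Suc 0"]
      free_module_simps(3,4)[of R "Suc 0"] fun_eq_iff)
  from hom_power_ideal[OF A this v] show ?thesis by auto
qed

text \<open>A homomorphism R^n -> R/A lifts along R -> R/A because R^n is free: \<open>h\<close>
  takes the given representatives at the unit vectors, and the vectors at which \<open>g\<close> and
  \<open>h\<close> agree modulo \<open>A\<close> form a submodule.\<close>

lemma (in cring) linear_mod_lift: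
  assumes A: "ideal A R" and g: "linear_mod R A (free_module R n) (carrier (free_module R n)) g"
  obtains h where "h \<in> mod_hom R (free_module R n) (regular_module R)"
    "\<And>v. v \<in> carrier (free_module R n) \<Longrightarrow> A +> g v = A +> h v"
proof -
  interpret cring_ideal A R by (intro cring_ideal.intro A is_cring)
  interpret F: module R "free_module R n" by (rule module_free)
  interpret M: module R "regular_module R" by (rule module_regular)
  note g = linear_modD[OF g]
  have gc: "g (unit_vector R n i) \<in> carrier (regular_module R)" for i by (simp add: g(1))
  obtain h where h: "h \<in> mod_hom R (free_module R n) (regular_module R)"
    "\<And>i. i < n \<Longrightarrow> h (unit_vector R n i) = g (unit_vector R n i)"
    using M.free_hom_exists[of n "\<lambda>i. g (unit_vector R n i)", OF gc] by blast
  note H = module_hom_regularD[OF h(1)]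
  let ?L = "{v \<in> carrier (free_module R n). A +> g v = A +> h v}"
  have "submodule ?L R (free_module R n)"
  proof (rule F.submoduleI')
    have z: "\<zero> \<odot>\<^bsub>free_module R n\<^esub> \<zero>\<^bsub>free_module R n\<^esub> = \<zero>\<^bsub>free_module R n\<^esub>" by (rule F.smult_l_null) (rule F.M.zero_closed)
    have "A +> g \<zero>\<^bsub>free_module R n\<^esub> = A +> \<zero>"
      using g(3)[of \<zero>, OF _ F.M.zero_closed] g(1)[OF F.M.zero_closed] unfolding z by simp
    moreover have "h \<zero>\<^bsub>free_module R n\<^esub> = \<zero>" using mod_hom_simps(1)[OF module_free module_regular h(1)] by simp
    ultimately show "\<zero>\<^bsub>free_module R n\<^esub> \<in> ?L" using F.M.zero_closed by simp
    fix u v assume "u \<in> ?L" "v \<in> ?L"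
    then have uv: "u \<in> carrier (free_module R n)" "v \<in> carrier (free_module R n)" "A +> g u = A +> h u" "A +> g v = A +> h v" by blast+
    have "A +> g (u \<oplus>\<^bsub>free_module R n\<^esub> v) = A +> h (u \<oplus>\<^bsub>free_module R n\<^esub> v)"
      unfolding g(2)[OF uv(1,2)] H(2)[OF uv(1,2)] using g(1)[OF uv(1)] g(1)[OF uv(2)] H(1)[OF uv(1)] H(1)[OF uv(2)] uv(3,4)
      by simp
    with F.M.a_closed[OF uv(1,2)] show "u \<oplus>\<^bsub>free_module R n\<^esub> v \<in> ?L" by blast
  next
    fix r v assume r: "r \<in> carrier R" and "v \<in> ?L"
    then have v: "v \<in> carrier (free_module R n)" "A +> g v = A +> h v" by blast+
    have "A +> g (r \<odot>\<^bsub>free_module R n\<^esub> v) = A +> h (r \<odot>\<^bsub>free_module R n\<^esub> v)"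
      unfolding g(3)[OF r v(1)] H(3)[OF r v(1)] using g(1)[OF v(1)] H(1)[OF v(1)] v(2) r by simp
    with F.smult_closed[OF r v(1)] show "r \<odot>\<^bsub>free_module R n\<^esub> v \<in> ?L" by blast
  qed blast
  then have "v \<in> ?L" if "v \<in> carrier (free_module R n)" for v
    by (rule free_module_induct[OF _ _ that]) (use h(2) unit_vector_closed in simp)
  with h(1) show ?thesis by (intro that) blast+
qed

lemma (in cring) ideal_adjoin:
  assumes A: "ideal A R" and x: "x \<in> carrier R"
  shows "ideal {a \<in> carrier R. \<exists>r \<in> carrier R. a \<ominus> x \<otimes> r \<in> A} R"
proof -
  interpret M: module R "regular_module R" by (rule module_regular)
  show ?thesis
    using M.submodule_translate[of A x] A x by (simp add: submodule_regular_iff[symmetric])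
qed

text \<open>The change of rings from \<open>R/A'\<close> to \<open>R/A\<close>, where \<open>A' = A + xR\<close>, shifts \<open>Ext\<close> by one degree:
  \<open>Ext\<^sup>1\<close> of \<open>R\<^sup>n/Y'\<close> over \<open>R/A'\<close> is \<open>Ext\<^sup>2\<close> over \<open>R/A\<close>, that is, \<open>Ext\<^sup>1\<close> of the syzygy \<open>R\<^sup>m/Y\<close>.\<close>

lemma (in cring) kills_ext_syzygy:
  assumes A: "ideal A R" and x: "x \<in> carrier R"
    and nzd: "\<And>r. r \<in> carrier R \<Longrightarrow> x \<otimes> r \<in> A \<Longrightarrow> r \<in> A"
    and A': "A' = {a \<in> carrier R. \<exists>r \<in> carrier R. a \<ominus> x \<otimes> r \<in> A}"
    and p: "p \<in> mod_hom R (free_module R m) (free_module R n)"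
    and Y': "Y' = p ` carrier (free_module R m)" "{..<n} \<rightarrow>\<^sub>E A' \<subseteq> Y'"
    and Y: "Y = {w \<in> carrier (free_module R m). p w \<in> {..<n} \<rightarrow>\<^sub>E A}"
    and t: "t \<in> carrier R"
  shows "kills_ext R A' n Y' t \<longleftrightarrow> kills_ext R A m Y t"
proof -
  let ?G = "free_module R m" and ?F = "free_module R n"
  have A'i: "ideal A' R" unfolding A' by (rule ideal_adjoin[OF A x])
  interpret A: cring_ideal A R by (intro cring_ideal.intro A is_cring)
  interpret B: cring_ideal A' R by (intro cring_ideal.intro A'i is_cring)
  interpret G: module R ?G by (rule module_free)
  interpret F: module R ?F by (rule module_free)
  have A'_mem: "a \<in> A' \<longleftrightarrow> (\<exists>r\<in>carrier R. a \<ominus> x \<otimes> r \<in> A)" if "a \<in> carrier R" for a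
    using that unfolding A' by blast
  have B_iff: "A' +> a = A' +> b \<longleftrightarrow> (\<exists>r\<in>carrier R. A +> a = A +> (b \<oplus> x \<otimes> r))"
    if ab: "a \<in> carrier R" "b \<in> carrier R" for a b
  proof -
    have "a \<ominus> b \<ominus> x \<otimes> r = a \<ominus> (b \<oplus> x \<otimes> r)" if "r \<in> carrier R" for r
      using ab that x by (simp add: minus_eq minus_add a_assoc)
    then have "A +> a = A +> (b \<oplus> x \<otimes> r) \<longleftrightarrow> a \<ominus> b \<ominus> x \<otimes> r \<in> A" if "r \<in> carrier R" for r
      using A.proj_eq_iff[of a "b \<oplus> x \<otimes> r"] ab x that by (metis a_closed m_closed)
    then show ?thesis unfolding B.proj_eq_iff[OF ab] A'_mem[OF minus_closed[OF ab]] by blast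
  qed
  have B_mem: "a \<in> A' \<longleftrightarrow> (\<exists>r\<in>carrier R. A +> a = A +> (x \<otimes> r))" if a: "a \<in> carrier R" for a
    unfolding A'_mem[OF a] using A.proj_eq_iff[OF a m_closed[OF x]] by blast
  have AB: "A' +> a = A' +> b" if "A +> a = A +> b" "a \<in> carrier R" "b \<in> carrier R" for a b
    unfolding B_iff[OF that(2,3)] by (rule bexI[of _ \<zero>]) (use that x in simp_all)
  have AsubB: "a \<in> A'" if "a \<in> A" for a
    unfolding A'_mem[OF A.Icarr[OF that]] by (rule bexI[of _ \<zero>]) (use that x A.Icarr in \<open>simp_all add: minus_eq\<close>)
  have Bx: "A' +> (x \<otimes> r) = \<zero>\<^bsub>R Quot A'\<^esub>" if "r \<in> carrier R" for r
    using B.proj_zero_iff[of "x \<otimes> r"] B_mem[of "x \<otimes> r"] that x by blast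
  have cancel: "A +> a = A +> b" if "A +> (x \<otimes> a) = A +> (x \<otimes> b)" "a \<in> carrier R" "b \<in> carrier R" for a b
    by (rule A.proj_cancel[OF nzd x that(2,3)]) (use that x in simp_all)
  have AF: "submodule ({..<n} \<rightarrow>\<^sub>E A) R ?F" and AG: "submodule ({..<m} \<rightarrow>\<^sub>E A) R ?G"
    and BF: "submodule ({..<n} \<rightarrow>\<^sub>E A') R ?F"
    by (rule submodule_power_ideal; fact)+
  note AF = F.submoduleD[OF AF] and AG = G.submoduleD[OF AG] and BF = F.submoduleD[OF BF]
  have pd: "p w \<in> carrier ?F" if "w \<in> carrier ?G" for w by (rule mod_homD(1)[OF p that])
  note ph = mod_homD[OF p] mod_hom_simps[OF module_free module_free p]
  have Ysub: "submodule Y R ?G" unfolding Y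
    by (rule submodule_vimage[OF module_free module_free p submodule_power_ideal[OF A]])
  note YD = G.submoduleD[OF Ysub]
  have Y'sub: "submodule Y' R ?F" unfolding Y'
    by (rule submodule_image[OF module_free module_free p G.carrier_is_submodule])
  note Y'D = F.submoduleD[OF Y'sub]
  have AGY: "w \<in> Y" if "w \<in> {..<m} \<rightarrow>\<^sub>E A" for w
    using hom_power_ideal[OF A p that] AG(1)[OF that] by (simp add: Y)
  have AFB: "v \<in> {..<n} \<rightarrow>\<^sub>E A'" if "v \<in> {..<n} \<rightarrow>\<^sub>E A" for v
    using that AsubB by (auto simp: PiE_iff)
  have pY': "p w \<in> Y'" if "w \<in> carrier ?G" for w using that by (simp add: Y')
  have kerY: "w \<ominus>\<^bsub>?G\<^esub> w' \<in> Y" if "w \<in> carrier ?G" "w' \<in> carrier ?G" "p w = p w'" for w w'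
  proof -
    have "p (w \<ominus>\<^bsub>?G\<^esub> w') = \<zero>\<^bsub>?F\<^esub>" using that ph pd by (simp add: F.minus_eq F.r_neg)
    then show ?thesis unfolding Y using that AF(2) by simp
  qed
  have "\<forall>v. \<exists>w. v \<in> Y' \<longrightarrow> w \<in> carrier ?G \<and> p w = v" unfolding Y' by blast
  \<comment> \<open>An arbitrary section of \<open>p\<close> over \<open>Y'\<close>. Maps out of
    \<open>Y'\<close> are defined through it; they become linear modulo the ideal in question
    because two preimages differ by an element of \<open>Y\<close>, on which the composed maps
    vanish modulo that ideal.\<close>
  then obtain s where s: "\<And>v. v \<in> Y' \<Longrightarrow> s v \<in> carrier ?G" "\<And>v. v \<in> Y' \<Longrightarrow> p (s v) = v" by metis
  have xF: "x \<odot>\<^bsub>?F\<^esub> v \<in> {..<n} \<rightarrow>\<^sub>E A'" if "v \<in> carrier ?F" for v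
  proof -
    have "x \<otimes> r \<in> A'" if "r \<in> carrier R" for r using B_mem[of "x \<otimes> r"] that x by blast
    then show ?thesis using that by (auto simp: free_module_simps PiE_iff)
  qed
  have xY': "x \<odot>\<^bsub>?F\<^esub> v \<in> Y'" if "v \<in> carrier ?F" for v using xF[OF that] Y'(2) by blast
  show ?thesis
  proof
    assume kill: "kills_ext R A m Y t"
    show "kills_ext R A' n Y' t" unfolding kills_ext_def
    proof (intro allI impI, elim conjE)
      fix g assume g: "linear_mod R A' ?F Y' g" and gA: "\<forall>v \<in> {..<n} \<rightarrow>\<^sub>E A'. g v \<in> A'"
      note gD = linear_modD[OF g]
      \<comment> \<open>The connecting homomorphism made explicit: \<open>g\<close> after
        \<open>p\<close> lifts to a linear form \<open>gh\<close> on R^m. On \<open>Y\<close> its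
        values lie in A' = A + xR, and dividing them by \<open>x\<close> modulo \<open>A\<close>
        gives \<open>g'\<close>.\<close>
      have "linear_mod R A' ?G (carrier ?G) (\<lambda>w. g (p w))"
        by (rule linear_modI) (simp_all only: ph gD pY')
      then obtain gh where gh: "gh \<in> mod_hom R ?G (regular_module R)"
        and ghg: "\<And>w. w \<in> carrier ?G \<Longrightarrow> A' +> g (p w) = A' +> gh w"
        using linear_mod_lift[OF A'i] by blast
      note ghD = module_hom_regularD[OF gh]
      have "\<exists>r. w \<in> Y \<longrightarrow> r \<in> carrier R \<and> A +> gh w = A +> (x \<otimes> r)" for w
      proof (cases "w \<in> Y")
        case True
        then have w: "w \<in> carrier ?G" "p w \<in> {..<n} \<rightarrow>\<^sub>E A" by (simp_all add: Y)
        have "g (p w) \<in> A'" using gA AFB[OF w(2)] by blast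
        then have "gh w \<in> A'" using ghg[OF w(1)] B.proj_zero_iff[OF ghD(1)[OF w(1)]] B.proj_zero_iff[OF gD(1)[OF pY'[OF w(1)]]] by simp
        then show ?thesis using B_mem[OF ghD(1)[OF w(1)]] by blast
      qed simp
      then obtain g' where g': "\<And>w. w \<in> Y \<Longrightarrow> g' w \<in> carrier R" "\<And>w. w \<in> Y \<Longrightarrow> A +> gh w = A +> (x \<otimes> g' w)"
        by metis
      have g'lin: "linear_mod R A ?G Y g'"
      proof (rule linear_modI)
        fix u v assume u: "u \<in> Y" and v: "v \<in> Y"
        note c = g'(1)[OF u] g'(1)[OF v] g'(1)[OF YD(3)[OF u v]] ghD(1)[OF YD(1)[OF u]] ghD(1)[OF YD(1)[OF v]]
        have "A +> (x \<otimes> g' (u \<oplus>\<^bsub>?G\<^esub> v)) = A +> (gh u \<oplus> gh v)"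
          using g'(2)[OF YD(3)[OF u v]] ghD(2)[OF YD(1)[OF u] YD(1)[OF v]] by simp
        also have "\<dots> = A +> (x \<otimes> (g' u \<oplus> g' v))"
          using c x g'(2)[OF u] g'(2)[OF v] by (simp add: A.Q.r_distr)
        finally show "A +> g' (u \<oplus>\<^bsub>?G\<^esub> v) = A +> (g' u \<oplus> g' v)" by (rule cancel) (use c in simp_all)
      next
        fix r v assume r: "r \<in> carrier R" and v: "v \<in> Y"
        note c = g'(1)[OF v] g'(1)[OF YD(6)[OF r v]] ghD(1)[OF YD(1)[OF v]]
        have "A +> (x \<otimes> g' (r \<odot>\<^bsub>?G\<^esub> v)) = A +> (r \<otimes> gh v)"
          using g'(2)[OF YD(6)[OF r v]] ghD(3)[OF r YD(1)[OF v]] by simp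
        also have "\<dots> = A +> (x \<otimes> (r \<otimes> g' v))"
          using c x r g'(2)[OF v] by (simp add: A.Q.m_lcomm)
        finally show "A +> g' (r \<odot>\<^bsub>?G\<^esub> v) = A +> (r \<otimes> g' v)" by (rule cancel) (use c r in simp_all)
      qed (rule g'(1))
      have g'A: "g' w \<in> A" if "w \<in> {..<m} \<rightarrow>\<^sub>E A" for w
      proof -
        have wY: "w \<in> Y" by (rule AGY[OF that])
        have "gh w \<in> A" by (rule hom_power_ideal_regular[OF A gh that])
        then have "x \<otimes> g' w \<in> A"
          using g'(2)[OF wY] g'(1)[OF wY] x A.proj_zero_iff[of "gh w"] A.proj_zero_iff[of "x \<otimes> g' w"] ghD(1)[OF YD(1)[OF wY]]
          by (metis m_closed)
        then show ?thesis by (rule nzd[OF g'(1)[OF wY]])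
      qed
      obtain h where h: "h \<in> mod_hom R ?G (regular_module R)" "\<And>w. w \<in> Y \<Longrightarrow> A +> (t \<otimes> g' w) = A +> h w"
        using kills_extD[OF kill g'lin g'A] by blast
      note hD = module_hom_regularD[OF h(1)]
      \<comment> \<open>Modulo \<open>A\<close> this vanishes on \<open>Y\<close> and so descends
        along \<open>p\<close> to \<open>g2\<close> on \<open>Y'\<close>, which lifts t g from R/A'
        to R/A.\<close>
      define k where "k w = t \<otimes> gh w \<ominus> x \<otimes> h w" for w
      have kc: "k w \<in> carrier R" if "w \<in> carrier ?G" for w
        unfolding k_def using ghD(1)[OF that] hD(1)[OF that] t x by simp
      have kadd: "k (u \<oplus>\<^bsub>?G\<^esub> v) = k u \<oplus> k v" if "u \<in> carrier ?G" "v \<in> carrier ?G" for u v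
        unfolding k_def ghD(2)[OF that] hD(2)[OF that]
        using ghD(1)[OF that(1)] ghD(1)[OF that(2)] hD(1)[OF that(1)] hD(1)[OF that(2)] t x
        by (simp add: minus_eq r_distr minus_add a_ac)
      have ksm: "k (r \<odot>\<^bsub>?G\<^esub> v) = r \<otimes> k v" if "r \<in> carrier R" "v \<in> carrier ?G" for r v
        unfolding k_def ghD(3)[OF that] hD(3)[OF that]
        using ghD(1)[OF that(2)] hD(1)[OF that(2)] t x that(1)
        by (simp add: minus_eq r_distr r_minus m_lcomm)
      have kY: "A +> k w = \<zero>\<^bsub>R Quot A\<^esub>" if w: "w \<in> Y" for w
      proof -
        note c = ghD(1)[OF YD(1)[OF w]] hD(1)[OF YD(1)[OF w]] g'(1)[OF w]
        have "A +> k w = (A +> t) \<otimes>\<^bsub>R Quot A\<^esub> (A +> gh w) \<ominus>\<^bsub>R Quot A\<^esub> (A +> x) \<otimes>\<^bsub>R Quot A\<^esub> (A +> h w)"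
          unfolding k_def using c t x by (simp add: A.proj_minus)
        also have "\<dots> = (A +> t) \<otimes>\<^bsub>R Quot A\<^esub> (A +> (x \<otimes> g' w)) \<ominus>\<^bsub>R Quot A\<^esub> (A +> x) \<otimes>\<^bsub>R Quot A\<^esub> (A +> (t \<otimes> g' w))"
          using g'(2)[OF w] h(2)[OF w] by simp
        also have "\<dots> = \<zero>\<^bsub>R Quot A\<^esub>"
          using c t x by (simp add: A.Q.m_lcomm A.Q.minus_eq A.Q.r_neg)
        finally show ?thesis .
      qed
      define g2 where "g2 v = k (s v)" for v
      have g2p: "A +> g2 (p w) = A +> k w" if w: "w \<in> carrier ?G" for w
      proof -
        let ?d = "w \<ominus>\<^bsub>?G\<^esub> s (p w)"
        note sp = s(1)[OF pY'[OF w]]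
        have d: "?d \<in> Y" by (rule kerY[OF w sp s(2)[OF pY'[OF w], symmetric]])
        have "w = ?d \<oplus>\<^bsub>?G\<^esub> s (p w)" using w sp by (simp add: G.minus_eq G.a_assoc G.l_neg)
        then have "k w = k ?d \<oplus> k (s (p w))" using kadd[OF YD(1)[OF d] sp] by simp
        then have "A +> k w = (A +> k ?d) \<oplus>\<^bsub>R Quot A\<^esub> (A +> k (s (p w)))"
          using kc[OF YD(1)[OF d]] kc[OF sp] by simp
        then show ?thesis using kY[OF d] kc[OF sp] by (simp add: g2_def)
      qed
      have g2c: "g2 v \<in> carrier R" if "v \<in> Y'" for v unfolding g2_def by (rule kc[OF s(1)[OF that]])
      have g2lin: "linear_mod R A ?F Y' g2"
      proof (rule linear_modI)
        fix u v assume u: "u \<in> Y'" and v: "v \<in> Y'"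
        have "A +> g2 (p (s u \<oplus>\<^bsub>?G\<^esub> s v)) = A +> k (s u \<oplus>\<^bsub>?G\<^esub> s v)"
          by (rule g2p) (use s(1)[OF u] s(1)[OF v] in simp)
        also have "p (s u \<oplus>\<^bsub>?G\<^esub> s v) = u \<oplus>\<^bsub>?F\<^esub> v" using ph(2)[OF s(1)[OF u] s(1)[OF v]] s(2)[OF u] s(2)[OF v] by simp
        also have "k (s u \<oplus>\<^bsub>?G\<^esub> s v) = g2 u \<oplus> g2 v" using kadd[OF s(1)[OF u] s(1)[OF v]] by (simp add: g2_def)
        finally show "A +> g2 (u \<oplus>\<^bsub>?F\<^esub> v) = A +> (g2 u \<oplus> g2 v)" .
      next
        fix r v assume r: "r \<in> carrier R" and v: "v \<in> Y'"
        have "A +> g2 (p (r \<odot>\<^bsub>?G\<^esub> s v)) = A +> k (r \<odot>\<^bsub>?G\<^esub> s v)"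
          by (rule g2p) (use s(1)[OF v] r in simp)
        also have "p (r \<odot>\<^bsub>?G\<^esub> s v) = r \<odot>\<^bsub>?F\<^esub> v" using ph(3)[OF r s(1)[OF v]] s(2)[OF v] by simp
        also have "k (r \<odot>\<^bsub>?G\<^esub> s v) = r \<otimes> g2 v" using ksm[OF r s(1)[OF v]] by (simp add: g2_def)
        finally show "A +> g2 (r \<odot>\<^bsub>?F\<^esub> v) = A +> (r \<otimes> g2 v)" .
      qed (rule g2c)
      note g2D = linear_modD[OF g2lin]
      have g2g: "A' +> g2 v = A' +> (t \<otimes> g v)" if v: "v \<in> Y'" for v
      proof -
        note c = ghD(1)[OF s(1)[OF v]] hD(1)[OF s(1)[OF v]] gD(1)[OF v]
        have e: "A' +> gh (s v) = A' +> g v" using ghg[OF s(1)[OF v]] s(2)[OF v] by simp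
        have "A' +> g2 v = (A' +> (t \<otimes> gh (s v))) \<ominus>\<^bsub>R Quot A'\<^esub> (A' +> (x \<otimes> h (s v)))"
          unfolding g2_def k_def by (rule B.proj_minus) (use c t x in simp_all)
        also have "\<dots> = A' +> (t \<otimes> gh (s v))" unfolding Bx[OF c(2)] using c t by (simp add: B.Q.minus_eq)
        also have "\<dots> = A' +> (t \<otimes> g v)" using c t e by simp
        finally show ?thesis .
      qed
      \<comment> \<open>The multiple x v lies in A'^n, where \<open>g\<close> vanishes modulo A'; so
        the value of \<open>g2\<close> at x v is divisible by \<open>x\<close> modulo
        \<open>A\<close>. The quotient \<open>H0\<close> is linear on all of R^n, and it extends
        \<open>g2\<close> because \<open>x\<close> can be cancelled.\<close>
      have "\<exists>r. v \<in> carrier ?F \<longrightarrow> r \<in> carrier R \<and> A +> g2 (x \<odot>\<^bsub>?F\<^esub> v) = A +> (x \<otimes> r)" for v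
      proof (cases "v \<in> carrier ?F")
        case True
        have "g (x \<odot>\<^bsub>?F\<^esub> v) \<in> A'" using gA xF[OF True] by blast
        then have "t \<otimes> g (x \<odot>\<^bsub>?F\<^esub> v) \<in> A'" using t by (rule B.I_l_closed)
        then have "g2 (x \<odot>\<^bsub>?F\<^esub> v) \<in> A'"
          using g2g[OF xY'[OF True]] B.proj_zero_iff[OF g2c[OF xY'[OF True]]]
            B.proj_zero_iff[of "t \<otimes> g (x \<odot>\<^bsub>?F\<^esub> v)"] B.Icarr by metis
        then show ?thesis using B_mem[OF g2c[OF xY'[OF True]]] by blast
      qed simp
      then obtain H0 where H0: "\<And>v. v \<in> carrier ?F \<Longrightarrow> H0 v \<in> carrier R"
        "\<And>v. v \<in> carrier ?F \<Longrightarrow> A +> g2 (x \<odot>\<^bsub>?F\<^esub> v) = A +> (x \<otimes> H0 v)" by metis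
      have "linear_mod R A ?F (carrier ?F) H0"
      proof (rule linear_modI)
        fix u v assume u: "u \<in> carrier ?F" and v: "v \<in> carrier ?F"
        note c = H0(1)[OF u] H0(1)[OF v] H0(1)[OF F.M.a_closed[OF u v]] g2c[OF xY'[OF u]] g2c[OF xY'[OF v]]
        have "A +> (x \<otimes> H0 (u \<oplus>\<^bsub>?F\<^esub> v)) = A +> g2 (x \<odot>\<^bsub>?F\<^esub> (u \<oplus>\<^bsub>?F\<^esub> v))"
          using H0(2)[OF F.M.a_closed[OF u v]] by simp
        also have "\<dots> = A +> (g2 (x \<odot>\<^bsub>?F\<^esub> u) \<oplus> g2 (x \<odot>\<^bsub>?F\<^esub> v))"
          unfolding F.smult_r_distr[OF x u v] by (rule g2D(2)[OF xY'[OF u] xY'[OF v]])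
        also have "\<dots> = A +> (x \<otimes> (H0 u \<oplus> H0 v))"
          using c x H0(2)[OF u] H0(2)[OF v] by (simp add: A.Q.r_distr)
        finally show "A +> H0 (u \<oplus>\<^bsub>?F\<^esub> v) = A +> (H0 u \<oplus> H0 v)" by (rule cancel) (use c in simp_all)
      next
        fix r v assume r: "r \<in> carrier R" and v: "v \<in> carrier ?F"
        note c = H0(1)[OF v] H0(1)[OF F.smult_closed[OF r v]] g2c[OF xY'[OF v]]
        have "A +> (x \<otimes> H0 (r \<odot>\<^bsub>?F\<^esub> v)) = A +> g2 (x \<odot>\<^bsub>?F\<^esub> (r \<odot>\<^bsub>?F\<^esub> v))"
          using H0(2)[OF F.smult_closed[OF r v]] by simp
        also have "x \<odot>\<^bsub>?F\<^esub> (r \<odot>\<^bsub>?F\<^esub> v) = r \<odot>\<^bsub>?F\<^esub> (x \<odot>\<^bsub>?F\<^esub> v)"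
          using r x v by (simp add: F.smult_assoc1[symmetric] m_comm)
        also have "A +> g2 (r \<odot>\<^bsub>?F\<^esub> (x \<odot>\<^bsub>?F\<^esub> v)) = A +> (r \<otimes> g2 (x \<odot>\<^bsub>?F\<^esub> v))"
          by (rule g2D(3)[OF r xY'[OF v]])
        also have "\<dots> = A +> (x \<otimes> (r \<otimes> H0 v))"
          using c x r H0(2)[OF v] by (simp add: A.Q.m_lcomm)
        finally show "A +> H0 (r \<odot>\<^bsub>?F\<^esub> v) = A +> (r \<otimes> H0 v)" by (rule cancel) (use c r in simp_all)
      qed (rule H0(1))
      then obtain H where H: "H \<in> mod_hom R ?F (regular_module R)"
        "\<And>v. v \<in> carrier ?F \<Longrightarrow> A +> H0 v = A +> H v"
        using linear_mod_lift[OF A] by blast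
      note HD = module_hom_regularD[OF H(1)]
      show "\<exists>h\<in>mod_hom R ?F (regular_module R). \<forall>v\<in>Y'. A' +> (t \<otimes> g v) = A' +> h v"
      proof (intro bexI[OF _ H(1)] ballI)
        fix v assume v: "v \<in> Y'"
        note vF = Y'D(1)[OF v]
        have "A +> (x \<otimes> g2 v) = A +> g2 (x \<odot>\<^bsub>?F\<^esub> v)" by (rule g2D(3)[OF x v, symmetric])
        also have "\<dots> = A +> (x \<otimes> H v)" using H0(2)[OF vF] H(2)[OF vF] H0(1)[OF vF] HD(1)[OF vF] x by simp
        finally have "A +> g2 v = A +> H v" by (rule cancel) (use g2c[OF v] HD(1)[OF vF] in simp_all)
        then have "A' +> g2 v = A' +> H v" by (rule AB) (use g2c[OF v] HD(1)[OF vF] in simp_all)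
        then show "A' +> (t \<otimes> g v) = A' +> H v" using g2g[OF v] by simp
      qed
    qed
  next
    assume kill: "kills_ext R A' n Y' t"
    show "kills_ext R A m Y t" unfolding kills_ext_def
    proof (intro allI impI, elim conjE)
      fix g' assume g': "linear_mod R A ?G Y g'" and g'A: "\<forall>v \<in> {..<m} \<rightarrow>\<^sub>E A. g' v \<in> A"
      note g'D = linear_modD[OF g']
      \<comment> \<open>A lift through \<open>p\<close> of multiplication by \<open>x\<close> on
        R^n, which exists because x R^n lies in \<open>Y'\<close>. The map \<open>tau\<close> below
        compares it with multiplication by \<open>x\<close> on R^m; its values lie in the kernel of
        \<open>p\<close>, hence in \<open>Y\<close>.\<close>
      obtain sg where sg: "sg \<in> mod_hom R ?F ?G" "\<And>v. v \<in> carrier ?F \<Longrightarrow> p (sg v) = x \<odot>\<^bsub>?F\<^esub> v"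
        by (rule F.free_hom_lift[OF module_free p F.smult_mod_hom[OF x]]) (use xY' in \<open>auto simp: Y'\<close>)
      note sgD = mod_homD[OF sg(1)] mod_hom_simps[OF module_free module_free sg(1)]
      define tau where "tau w = x \<odot>\<^bsub>?G\<^esub> w \<ominus>\<^bsub>?G\<^esub> sg (p w)" for w
      have tauY: "tau w \<in> Y" if w: "w \<in> carrier ?G" for w
        unfolding tau_def by (rule kerY) (use w x sgD(1) pd[OF w] sg(2)[OF pd[OF w]] ph(3)[OF x w] in simp_all)
      have tadd: "tau (u \<oplus>\<^bsub>?G\<^esub> v) = tau u \<oplus>\<^bsub>?G\<^esub> tau v" if u: "u \<in> carrier ?G" and v: "v \<in> carrier ?G" for u v
        unfolding tau_def ph(2)[OF u v] sgD(2)[OF pd[OF u] pd[OF v]] G.smult_r_distr[OF x u v]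
        by (rule G.minus_add_distrib4) (use u v x sgD(1) pd in simp_all)
      have tsm: "tau (r \<odot>\<^bsub>?G\<^esub> v) = r \<odot>\<^bsub>?G\<^esub> tau v" if r: "r \<in> carrier R" and v: "v \<in> carrier ?G" for r v
        unfolding tau_def ph(3)[OF r v] sgD(3)[OF r pd[OF v]]
        using r v x sgD(1)[OF pd[OF v]] by (simp add: G.smult_minus_distr G.smult_assoc1[symmetric] m_comm)
      define gh where "gh w = g' (tau w)" for w
      have ghlin: "linear_mod R A ?G (carrier ?G) gh"
        unfolding gh_def by (rule linear_modI) (simp_all only: tauY tadd tsm g'D)
      note ghD = linear_modD[OF ghlin]
      \<comment> \<open>For w in \<open>Y\<close> the vector p w has entries in \<open>A\<close>, so
        \<open>sg\<close> sends it into A^m, where \<open>g'\<close> vanishes modulo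
        \<open>A\<close>. Only the term x w of \<open>tau\<close> contributes.\<close>
      have ghY: "A +> gh w = A +> (x \<otimes> g' w)" if w: "w \<in> Y" for w
      proof -
        have wG: "w \<in> carrier ?G" and pw: "p w \<in> {..<n} \<rightarrow>\<^sub>E A" using w by (simp_all add: Y)
        have sA: "sg (p w) \<in> {..<m} \<rightarrow>\<^sub>E A" by (rule hom_power_ideal[OF A sg(1) pw])
        note sY = AGY[OF sA]
        have "x \<odot>\<^bsub>?G\<^esub> w = tau w \<oplus>\<^bsub>?G\<^esub> sg (p w)"
          unfolding tau_def using wG x YD(1)[OF sY] by (simp add: G.minus_eq G.a_assoc G.l_neg)
        then have "A +> g' (x \<odot>\<^bsub>?G\<^esub> w) = A +> (gh w \<oplus> g' (sg (p w)))"
          using g'D(2)[OF tauY[OF wG] sY] by (simp add: gh_def)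
        moreover have "A +> g' (sg (p w)) = \<zero>\<^bsub>R Quot A\<^esub>"
          using A.proj_zero_iff[OF g'D(1)[OF sY]] g'A sA by blast
        ultimately show ?thesis using g'D(3)[OF x w] g'D(1)[OF sY] ghD(1)[OF wG] by simp
      qed
      \<comment> \<open>On \<open>Y\<close> the map \<open>gh\<close> is divisible by
        \<open>x\<close> modulo \<open>A\<close>, so modulo A' it descends along
        \<open>p\<close>.\<close>
      define g where "g v = gh (s v)" for v
      have gc: "g v \<in> carrier R" if "v \<in> Y'" for v unfolding g_def by (rule ghD(1)[OF s(1)[OF that]])
      have gp: "A' +> g (p w) = A' +> gh w" if w: "w \<in> carrier ?G" for w
      proof -
        let ?d = "w \<ominus>\<^bsub>?G\<^esub> s (p w)"
        note sp = s(1)[OF pY'[OF w]]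
        have d: "?d \<in> Y" by (rule kerY[OF w sp s(2)[OF pY'[OF w], symmetric]])
        have wd: "w = ?d \<oplus>\<^bsub>?G\<^esub> s (p w)" using w sp by (simp add: G.minus_eq G.a_assoc G.l_neg)
        have "A +> gh (?d \<oplus>\<^bsub>?G\<^esub> s (p w)) = A +> (gh ?d \<oplus> gh (s (p w)))" by (rule ghD(2)[OF YD(1)[OF d] sp])
        also have "\<dots> = A +> (gh (s (p w)) \<oplus> x \<otimes> g' ?d)"
          using ghY[OF d] ghD(1)[OF YD(1)[OF d]] ghD(1)[OF sp] g'D(1)[OF d] x by (simp add: A.Q.a_comm)
        finally have "A +> gh w = A +> (gh (s (p w)) \<oplus> x \<otimes> g' ?d)" using wd by simp
        then have "A' +> gh w = A' +> gh (s (p w))"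
          using B_iff[OF ghD(1)[OF w] ghD(1)[OF sp]] g'D(1)[OF d] by blast
        then show ?thesis by (simp add: g_def)
      qed
      have glin: "linear_mod R A' ?F Y' g"
      proof (rule linear_modI)
        fix u v assume u: "u \<in> Y'" and v: "v \<in> Y'"
        note su = s(1)[OF u] and sv = s(1)[OF v]
        have "A' +> g (p (s u \<oplus>\<^bsub>?G\<^esub> s v)) = A' +> gh (s u \<oplus>\<^bsub>?G\<^esub> s v)"
          by (rule gp) (use su sv in simp)
        also have "p (s u \<oplus>\<^bsub>?G\<^esub> s v) = u \<oplus>\<^bsub>?F\<^esub> v" using ph(2)[OF su sv] s(2)[OF u] s(2)[OF v] by simp
        also have "A' +> gh (s u \<oplus>\<^bsub>?G\<^esub> s v) = A' +> (g u \<oplus> g v)"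
          unfolding g_def by (rule AB[OF ghD(2)[OF su sv]]) (use su sv ghD(1) in simp_all)
        finally show "A' +> g (u \<oplus>\<^bsub>?F\<^esub> v) = A' +> (g u \<oplus> g v)" .
      next
        fix r v assume r: "r \<in> carrier R" and v: "v \<in> Y'"
        note sv = s(1)[OF v]
        have "A' +> g (p (r \<odot>\<^bsub>?G\<^esub> s v)) = A' +> gh (r \<odot>\<^bsub>?G\<^esub> s v)"
          by (rule gp) (use sv r in simp)
        also have "p (r \<odot>\<^bsub>?G\<^esub> s v) = r \<odot>\<^bsub>?F\<^esub> v" using ph(3)[OF r sv] s(2)[OF v] by simp
        also have "A' +> gh (r \<odot>\<^bsub>?G\<^esub> s v) = A' +> (r \<otimes> g v)"
          unfolding g_def by (rule AB[OF ghD(3)[OF r sv]]) (use sv r ghD(1) in simp_all)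
        finally show "A' +> g (r \<odot>\<^bsub>?F\<^esub> v) = A' +> (r \<otimes> g v)" .
      qed (rule gc)
      note gD = linear_modD[OF glin]
      \<comment> \<open>The vector is split as a + x f with a in A^n. At a the value is a multiple
        of \<open>x\<close> modulo \<open>A\<close>; and x f is the image under \<open>p\<close> of
        sg f, where \<open>tau\<close> is zero.\<close>
      have gA: "g v \<in> A'" if v: "v \<in> {..<n} \<rightarrow>\<^sub>E A'" for v
      proof -
        have "\<exists>r. i < n \<longrightarrow> r \<in> carrier R \<and> v i \<ominus> x \<otimes> r \<in> A" for i
          using v A'_mem B.Icarr by (metis PiE_mem lessThan_iff)
        then obtain f where f: "\<And>i. i < n \<Longrightarrow> f i \<in> carrier R" "\<And>i. i < n \<Longrightarrow> v i \<ominus> x \<otimes> f i \<in> A" by metis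
        let ?f = "restrict f {..<n}"
        have fF: "?f \<in> carrier ?F" using f(1) by (auto simp: free_module_simps)
        let ?a = "v \<ominus>\<^bsub>?F\<^esub> x \<odot>\<^bsub>?F\<^esub> ?f"
        have vF: "v \<in> carrier ?F" by (rule BF(1)[OF v])
        have xf: "x \<odot>\<^bsub>?F\<^esub> ?f \<in> carrier ?F" by (rule F.smult_closed[OF x fF])
        have a: "?a \<in> {..<n} \<rightarrow>\<^sub>E A"
          unfolding free_a_minus[OF vF xf] using f(2) by (auto simp: free_module_simps)
        have aY': "?a \<in> Y'" using AFB[OF a] Y'(2) by blast
        have va: "v = ?a \<oplus>\<^bsub>?F\<^esub> x \<odot>\<^bsub>?F\<^esub> ?f" using vF xf by (simp add: F.minus_eq F.a_assoc F.l_neg)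
        have sa: "s ?a \<in> Y" unfolding Y using s[OF aY'] a by simp
        have "A' +> g ?a = A' +> (x \<otimes> g' (s ?a))"
          unfolding g_def by (rule AB[OF ghY[OF sa]]) (use ghD(1)[OF YD(1)[OF sa]] g'D(1)[OF sa] x in simp_all)
        then have 1: "A' +> g ?a = \<zero>\<^bsub>R Quot A'\<^esub>" using Bx[OF g'D(1)[OF sa]] by simp
        have sfG: "sg ?f \<in> carrier ?G" by (rule sgD(1)[OF fF])
        have "tau (sg ?f) = \<zero>\<^bsub>?G\<^esub>"
          unfolding tau_def sg(2)[OF fF] sgD(3)[OF x fF] using sfG x by (simp add: G.minus_eq G.r_neg)
        then have "gh (sg ?f) \<in> A" using g'A AG(2) by (simp add: gh_def)
        then have "A' +> gh (sg ?f) = \<zero>\<^bsub>R Quot A'\<^esub>" using AsubB B.proj_zero_iff[OF ghD(1)[OF sfG]] by blast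
        then have 2: "A' +> g (x \<odot>\<^bsub>?F\<^esub> ?f) = \<zero>\<^bsub>R Quot A'\<^esub>" using gp[OF sfG] sg(2)[OF fF] by simp
        have "A' +> g v = A' +> (g ?a \<oplus> g (x \<odot>\<^bsub>?F\<^esub> ?f))"
          using gD(2)[OF aY' xY'[OF fF]] va by simp
        also have "\<dots> = \<zero>\<^bsub>R Quot A'\<^esub>" using 1 2 gc[OF aY'] gc[OF xY'[OF fF]] by simp
        finally show ?thesis using B.proj_zero_iff[OF gc] Y'(2) v by blast
      qed
      obtain H where H: "H \<in> mod_hom R ?F (regular_module R)" "\<And>v. v \<in> Y' \<Longrightarrow> A' +> (t \<otimes> g v) = A' +> H v"
        using kills_extD[OF kill glin gA] by blast
      note HD = module_hom_regularD[OF H(1)]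
      have Hp: "(\<lambda>w. H (p w)) \<in> mod_hom R ?G (regular_module R)" by (rule mod_hom_comp[OF p H(1)])
      note HpD = module_hom_regularD[OF Hp]
      \<comment> \<open>The form \<open>H\<close> agrees with t g modulo A' only, which leaves an
        error x h0 modulo \<open>A\<close>. On \<open>Y\<close> the term H (p w) lies in
        \<open>A\<close>, and cancelling \<open>x\<close> there shows that \<open>h0\<close> agrees
        with t g' modulo \<open>A\<close>.\<close>
      have "\<exists>r. w \<in> carrier ?G \<longrightarrow> r \<in> carrier R \<and> A +> (t \<otimes> gh w) = A +> (H (p w) \<oplus> x \<otimes> r)" for w
      proof (cases "w \<in> carrier ?G")
        case True
        have "A' +> (t \<otimes> gh w) = A' +> (t \<otimes> g (p w))"
          using gp[OF True] gc[OF pY'[OF True]] ghD(1)[OF True] t by simp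
        also have "\<dots> = A' +> H (p w)" by (rule H(2)[OF pY'[OF True]])
        finally show ?thesis using B_iff[of "t \<otimes> gh w" "H (p w)"] ghD(1)[OF True] HpD(1)[OF True] t by auto
      qed simp
      then obtain h0 where h0: "\<And>w. w \<in> carrier ?G \<Longrightarrow> h0 w \<in> carrier R"
        "\<And>w. w \<in> carrier ?G \<Longrightarrow> A +> (t \<otimes> gh w) = A +> (H (p w) \<oplus> x \<otimes> h0 w)" by metis
      have h0': "A +> (x \<otimes> h0 w) = (A +> t) \<otimes>\<^bsub>R Quot A\<^esub> (A +> gh w) \<ominus>\<^bsub>R Quot A\<^esub> (A +> H (p w))" if w: "w \<in> carrier ?G" for w
      proof -
        have "(A +> t) \<otimes>\<^bsub>R Quot A\<^esub> (A +> gh w) = (A +> H (p w)) \<oplus>\<^bsub>R Quot A\<^esub> (A +> (x \<otimes> h0 w))"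
          using h0(2)[OF w] h0(1)[OF w] ghD(1)[OF w] HpD(1)[OF w] t x by simp
        moreover have "A +> H (p w) \<in> carrier (R Quot A)" "A +> (x \<otimes> h0 w) \<in> carrier (R Quot A)"
          using h0(1)[OF w] HpD(1)[OF w] x by simp_all
        ultimately show ?thesis by (simp only: A.Q.minus_eq_imp)
      qed
      have "linear_mod R A ?G (carrier ?G) h0"
      proof (rule linear_modI)
        fix u v assume u: "u \<in> carrier ?G" and v: "v \<in> carrier ?G"
        note uv = G.M.a_closed[OF u v]
        note c = h0(1)[OF u] h0(1)[OF v] h0(1)[OF uv] ghD(1)[OF u] ghD(1)[OF v] HpD(1)[OF u] HpD(1)[OF v]
        have "A +> (x \<otimes> h0 (u \<oplus>\<^bsub>?G\<^esub> v)) = (A +> (x \<otimes> h0 u)) \<oplus>\<^bsub>R Quot A\<^esub> (A +> (x \<otimes> h0 v))"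
          unfolding h0'[OF u] h0'[OF v] h0'[OF uv] ghD(2)[OF u v] HpD(2)[OF u v]
          using c t by (simp add: A.Q.minus_eq A.Q.minus_add A.Q.r_distr A.Q.a_ac)
        also have "\<dots> = A +> (x \<otimes> (h0 u \<oplus> h0 v))" using c x by (simp add: A.Q.r_distr)
        finally show "A +> h0 (u \<oplus>\<^bsub>?G\<^esub> v) = A +> (h0 u \<oplus> h0 v)" by (rule cancel) (use c in simp_all)
      next
        fix r v assume r: "r \<in> carrier R" and v: "v \<in> carrier ?G"
        note rv = G.smult_closed[OF r v]
        note c = h0(1)[OF v] h0(1)[OF rv] ghD(1)[OF v] HpD(1)[OF v]
        have "A +> (x \<otimes> h0 (r \<odot>\<^bsub>?G\<^esub> v)) = (A +> r) \<otimes>\<^bsub>R Quot A\<^esub> (A +> (x \<otimes> h0 v))"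
          unfolding h0'[OF v] h0'[OF rv] ghD(3)[OF r v] HpD(3)[OF r v]
          using c t r by (simp add: A.Q.minus_eq A.Q.r_minus A.Q.r_distr A.Q.m_lcomm)
        also have "\<dots> = A +> (x \<otimes> (r \<otimes> h0 v))" using c x r by (simp add: A.Q.m_lcomm)
        finally show "A +> h0 (r \<odot>\<^bsub>?G\<^esub> v) = A +> (r \<otimes> h0 v)" by (rule cancel) (use c r in simp_all)
      qed (rule h0(1))
      then obtain h where h: "h \<in> mod_hom R ?G (regular_module R)" "\<And>w. w \<in> carrier ?G \<Longrightarrow> A +> h0 w = A +> h w"
        using linear_mod_lift[OF A] by blast
      note hD = module_hom_regularD[OF h(1)]
      show "\<exists>h\<in>mod_hom R ?G (regular_module R). \<forall>v\<in>Y. A +> (t \<otimes> g' v) = A +> h v"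
      proof (intro bexI[OF _ h(1)] ballI)
        fix w assume w: "w \<in> Y"
        have wG: "w \<in> carrier ?G" and pw: "p w \<in> {..<n} \<rightarrow>\<^sub>E A" using w by (simp_all add: Y)
        note c = h0(1)[OF wG] ghD(1)[OF wG] HpD(1)[OF wG] hD(1)[OF wG] g'D(1)[OF w]
        have H0: "A +> H (p w) = \<zero>\<^bsub>R Quot A\<^esub>"
          using A.proj_zero_iff[OF c(3)] hom_power_ideal_regular[OF A H(1) pw] by blast
        have "A +> (x \<otimes> h w) = A +> (x \<otimes> h0 w)" using c x h(2)[OF wG] by simp
        also have "\<dots> = (A +> t) \<otimes>\<^bsub>R Quot A\<^esub> (A +> gh w)" unfolding h0'[OF wG] H0 using c t by (simp add: A.Q.minus_eq)
        also have "\<dots> = A +> (x \<otimes> (t \<otimes> g' w))" unfolding ghY[OF w] using c t x by (simp add: A.Q.m_lcomm)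
        finally have "A +> h w = A +> (t \<otimes> g' w)" by (rule cancel) (use c t in simp_all)
        then show "A +> (t \<otimes> g' w) = A +> h w" by simp
      qed
    qed
  qed
qed

subsection \<open>Quotient modules\<close>

context module
begin

lemma abelian_subgroup_submodule: "submodule Y R M \<Longrightarrow> abelian_subgroup Y M"
  by (rule abelian_subgroupI3[OF additive_subgroupI M.abelian_group_axioms]) (rule submodule.axioms(1))

lemma submodule_coset_eq_iff:
  assumes Y: "submodule Y R M" and u: "u \<in> carrier M" and v: "v \<in> carrier M"
  shows "Y +>\<^bsub>M\<^esub> u = Y +>\<^bsub>M\<^esub> v \<longleftrightarrow> u \<ominus>\<^bsub>M\<^esub> v \<in> Y"
proof -
  interpret S: abelian_subgroup Y M by (rule abelian_subgroup_submodule[OF Y])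
  have "Y +>\<^bsub>M\<^esub> u = Y +>\<^bsub>M\<^esub> v \<longleftrightarrow> u \<in> Y +>\<^bsub>M\<^esub> v"
    using S.a_rcos_self[OF u] S.a_repr_independence'[OF _ v] by auto
  then show ?thesis using S.a_rcos_module[OF v u] by (simp add: M.minus_eq)
qed

lemma quotient_module_simps:
  assumes Y: "submodule Y R M"
  shows "carrier (quotient_module M Y) = (+>\<^bsub>M\<^esub>) Y ` carrier M"
    and "\<zero>\<^bsub>quotient_module M Y\<^esub> = Y +>\<^bsub>M\<^esub> \<zero>\<^bsub>M\<^esub>"
    and "u \<in> carrier M \<Longrightarrow> v \<in> carrier M \<Longrightarrow>
      (Y +>\<^bsub>M\<^esub> u) \<oplus>\<^bsub>quotient_module M Y\<^esub> (Y +>\<^bsub>M\<^esub> v) = Y +>\<^bsub>M\<^esub> (u \<oplus>\<^bsub>M\<^esub> v)"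
    and "a \<in> carrier R \<Longrightarrow> v \<in> carrier M \<Longrightarrow>
      a \<odot>\<^bsub>quotient_module M Y\<^esub> (Y +>\<^bsub>M\<^esub> v) = Y +>\<^bsub>M\<^esub> (a \<odot>\<^bsub>M\<^esub> v)"
proof -
  interpret S: abelian_subgroup Y M by (rule abelian_subgroup_submodule[OF Y])
  note D = submoduleD[OF Y]
  show "carrier (quotient_module M Y) = (+>\<^bsub>M\<^esub>) Y ` carrier M"
    by (auto simp: quotient_module_def A_RCOSETS_def' a_r_coset_def')
  show "\<zero>\<^bsub>quotient_module M Y\<^esub> = Y +>\<^bsub>M\<^esub> \<zero>\<^bsub>M\<^esub>"
    using S.a_subset by (simp add: quotient_module_def)
  show "u \<in> carrier M \<Longrightarrow> v \<in> carrier M \<Longrightarrow>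
      (Y +>\<^bsub>M\<^esub> u) \<oplus>\<^bsub>quotient_module M Y\<^esub> (Y +>\<^bsub>M\<^esub> v) = Y +>\<^bsub>M\<^esub> (u \<oplus>\<^bsub>M\<^esub> v)"
    by (simp add: quotient_module_def S.a_rcos_sum)
  assume a: "a \<in> carrier R" and v: "v \<in> carrier M"
  have "Y +>\<^bsub>M\<^esub> (a \<odot>\<^bsub>M\<^esub> x) = Y +>\<^bsub>M\<^esub> (a \<odot>\<^bsub>M\<^esub> v)" if "x \<in> Y +>\<^bsub>M\<^esub> v" for x
  proof -
    have x: "x \<in> carrier M" by (rule S.a_elemrcos_carrier[OF v that])
    have "x \<ominus>\<^bsub>M\<^esub> v \<in> Y" using S.a_rcos_module[OF v x] that by (simp add: M.minus_eq)
    then have "a \<odot>\<^bsub>M\<^esub> (x \<ominus>\<^bsub>M\<^esub> v) \<in> Y" by (rule D(6)[OF a])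
    then show ?thesis using a v x by (simp add: submodule_coset_eq_iff[OF Y] smult_minus_distr)
  qed
  moreover have "Y +>\<^bsub>M\<^esub> v \<noteq> {}" using S.a_rcos_self[OF v] by blast
  ultimately have "(\<Union>x\<in>Y +>\<^bsub>M\<^esub> v. Y +>\<^bsub>M\<^esub> (a \<odot>\<^bsub>M\<^esub> x)) = Y +>\<^bsub>M\<^esub> (a \<odot>\<^bsub>M\<^esub> v)"
    by (intro SUP_eq_const)
  then show "a \<odot>\<^bsub>quotient_module M Y\<^esub> (Y +>\<^bsub>M\<^esub> v) = Y +>\<^bsub>M\<^esub> (a \<odot>\<^bsub>M\<^esub> v)"
    by (simp add: quotient_module_def)
qed

lemma module_quotient:
  assumes Y: "submodule Y R M" shows "module R (quotient_module M Y)"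
proof -
  note S = quotient_module_simps[OF Y]
  show ?thesis
  proof (rule moduleI[OF R.is_cring])
    show "abelian_group (quotient_module M Y)"
    proof (rule abelian_groupI)
      fix x assume "x \<in> carrier (quotient_module M Y)"
      then obtain u where u: "u \<in> carrier M" "x = Y +>\<^bsub>M\<^esub> u" by (auto simp: S(1))
      then show "\<exists>y\<in>carrier (quotient_module M Y). y \<oplus>\<^bsub>quotient_module M Y\<^esub> x = \<zero>\<^bsub>quotient_module M Y\<^esub>"
        by (intro bexI[of _ "Y +>\<^bsub>M\<^esub> (\<ominus>\<^bsub>M\<^esub> u)"]) (auto simp: S M.l_neg)
    qed (auto simp: S M.a_ac)
  qed (auto simp: S smult_l_distr smult_r_distr smult_assoc1)
qed

lemma quotient_proj:
  assumes Y: "submodule Y R M"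
  shows "(+>\<^bsub>M\<^esub>) Y \<in> mod_hom R M (quotient_module M Y)"
    and "(+>\<^bsub>M\<^esub>) Y ` carrier M = carrier (quotient_module M Y)"
    and "\<forall>v\<in>carrier M. Y +>\<^bsub>M\<^esub> v = \<zero>\<^bsub>quotient_module M Y\<^esub> \<longleftrightarrow> v \<in> Y"
proof -
  note S = quotient_module_simps[OF Y]
  show "(+>\<^bsub>M\<^esub>) Y \<in> mod_hom R M (quotient_module M Y)" by (rule mod_homI) (auto simp: S)
  show "(+>\<^bsub>M\<^esub>) Y ` carrier M = carrier (quotient_module M Y)" by (simp add: S)
  show "\<forall>v\<in>carrier M. Y +>\<^bsub>M\<^esub> v = \<zero>\<^bsub>quotient_module M Y\<^esub> \<longleftrightarrow> v \<in> Y"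
    by (simp add: S(2) submodule_coset_eq_iff[OF Y])
qed

lemma nonzerodivisor_on_quotient:
  assumes Y: "submodule Y R M"
  shows "nonzerodivisor_on R (quotient_module M Y) a \<longleftrightarrow>
    a \<in> carrier R \<and> (\<forall>v\<in>carrier M. a \<odot>\<^bsub>M\<^esub> v \<in> Y \<longrightarrow> v \<in> Y)"
  unfolding nonzerodivisor_on_def
  by (auto simp: quotient_module_simps(1,4)[OF Y] quotient_proj(3)[OF Y])

lemma annihilator_quotient:
  assumes Y: "submodule Y R M"
  shows "annihilator R (quotient_module M Y) = {a \<in> carrier R. \<forall>v\<in>carrier M. a \<odot>\<^bsub>M\<^esub> v \<in> Y}"
  unfolding annihilator_def
  by (simp add: quotient_module_simps(1,4)[OF Y] quotient_proj(3)[OF Y] cong: conj_cong)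

lemma quotient_nonzero:
  assumes Y: "submodule Y R M" "Y \<noteq> carrier M"
  shows "carrier (quotient_module M Y) \<noteq> {\<zero>\<^bsub>quotient_module M Y\<^esub>}"
proof -
  obtain v where v: "v \<in> carrier M" "v \<notin> Y" using Y submoduleD(1)[OF Y(1)] by blast
  then have "Y +>\<^bsub>M\<^esub> v \<noteq> \<zero>\<^bsub>quotient_module M Y\<^esub>" using quotient_proj(3)[OF Y(1)] by blast
  moreover have "Y +>\<^bsub>M\<^esub> v \<in> carrier (quotient_module M Y)" using mod_homD(1)[OF quotient_proj(1)[OF Y(1)] v(1)] .
  ultimately show ?thesis by (metis singletonD)
qed

text \<open>Preimages turn direct sum decompositions of M/Y into pairs of submodules of
  \<open>M\<close> with sum \<open>M\<close> and intersection \<open>Y\<close>. A decomposition of a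
  quotient of R^n thus gives two submodules of the same R^n.\<close>

lemma indecomposable_quotientI:
  assumes Y: "submodule Y R M" "Y \<noteq> carrier M"
    and ind: "\<And>A B. submodule A R M \<Longrightarrow> submodule B R M \<Longrightarrow> A \<inter> B = Y \<Longrightarrow>
      (\<And>v. v \<in> carrier M \<Longrightarrow> \<exists>a\<in>A. \<exists>b\<in>B. v = a \<oplus>\<^bsub>M\<^esub> b) \<Longrightarrow> A = Y \<or> B = Y"
  shows "indecomposable R (quotient_module M Y)"
proof -
  let ?N = "quotient_module M Y" and ?q = "(+>\<^bsub>M\<^esub>) Y"
  interpret N: module R ?N by (rule module_quotient[OF Y(1)])
  note q = quotient_proj[OF Y(1)]
  note qh = mod_homD[OF q(1)]
  show ?thesis unfolding indecomposable_def
  proof (intro conjI allI impI)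
    show "carrier ?N \<noteq> {\<zero>\<^bsub>?N\<^esub>}" by (rule quotient_nonzero[OF Y])
    fix A B assume "submodule A R ?N \<and> submodule B R ?N \<and> A <+>\<^bsub>?N\<^esub> B = carrier ?N \<and> A \<inter> B = {\<zero>\<^bsub>?N\<^esub>}"
    then have A: "submodule A R ?N" and B: "submodule B R ?N"
      and sum: "A <+>\<^bsub>?N\<^esub> B = carrier ?N" and int: "A \<inter> B = {\<zero>\<^bsub>?N\<^esub>}" by blast+
    let ?A = "{v \<in> carrier M. ?q v \<in> A}" and ?B = "{v \<in> carrier M. ?q v \<in> B}"
    have sA: "submodule ?A R M" and sB: "submodule ?B R M"
      by (rule submodule_vimage[OF module_axioms N.module_axioms q(1)]; fact)+
    note dA = submoduleD[OF sA]
    have YA: "v \<in> ?A" "v \<in> ?B" if "v \<in> Y" for v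
      using that submoduleD(1)[OF Y(1) that] q(3) N.submoduleD(2)[OF A] N.submoduleD(2)[OF B] by auto
    have "?A \<inter> ?B = Y" using YA q(3) int submoduleD(1)[OF Y(1)] by blast
    moreover have "\<exists>a\<in>?A. \<exists>b\<in>?B. v = a \<oplus>\<^bsub>M\<^esub> b" if v: "v \<in> carrier M" for v
    proof -
      have "?q v \<in> A <+>\<^bsub>?N\<^esub> B" using qh(1)[OF v] sum by simp
      then obtain a b where ab: "a \<in> A" "b \<in> B" "?q v = a \<oplus>\<^bsub>?N\<^esub> b" by (auto simp: set_add_def')
      obtain b' where b': "b' \<in> carrier M" "b = ?q b'" using N.submoduleD(1)[OF B ab(2)] q(2) by blast
      have bN: "b \<in> carrier ?N" and aN: "a \<in> carrier ?N" using N.submoduleD(1)[OF B ab(2)] N.submoduleD(1)[OF A ab(1)] .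
      have "?q (v \<ominus>\<^bsub>M\<^esub> b') = ?q v \<ominus>\<^bsub>?N\<^esub> b"
        using mod_hom_simps(3)[OF module_axioms N.module_axioms q(1) v b'(1)] b'(2) by simp
      also have "\<dots> = a" unfolding ab(3) using aN bN by (simp add: N.minus_eq N.a_assoc N.r_neg)
      finally have "v \<ominus>\<^bsub>M\<^esub> b' \<in> ?A" using v b' ab(1) by simp
      moreover have "b' \<in> ?B" using b' ab(2) by simp
      moreover have "v = (v \<ominus>\<^bsub>M\<^esub> b') \<oplus>\<^bsub>M\<^esub> b'" using v b'(1) by (simp add: M.minus_eq M.a_assoc M.l_neg)
      ultimately show ?thesis by blast
    qed
    ultimately have "?A = Y \<or> ?B = Y" by (rule ind[OF sA sB])
    moreover have "C = {\<zero>\<^bsub>?N\<^esub>}" if C: "submodule C R ?N" and e: "{v \<in> carrier M. ?q v \<in> C} = Y" for C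
    proof -
      have "c = \<zero>\<^bsub>?N\<^esub>" if c: "c \<in> C" for c
      proof -
        obtain v where v: "v \<in> carrier M" "c = ?q v" using N.submoduleD(1)[OF C c] q(2) by blast
        then have "v \<in> Y" using e c by blast
        then show ?thesis using q(3) v by blast
      qed
      then show ?thesis using N.submoduleD(2)[OF C] by blast
    qed
    ultimately show "A = {\<zero>\<^bsub>?N\<^esub>} \<or> B = {\<zero>\<^bsub>?N\<^esub>}" using A B by blast
  qed
qed

text \<open>The span is the least submodule containing \<open>Y\<close> and all multiples of the
  entries. The order has to be changed because regular sequences are built up from the left while
  Koszul complexes are taken apart from the left.\<close>

lemma koszul_span_set_cong:
  assumes Y: "submodule Y R M" and "set xs \<subseteq> carrier R" "set ys = set xs"
  shows "koszul_span M ys Y = koszul_span M xs Y"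
proof -
  have "koszul_span M xs Y \<subseteq> koszul_span M ys Y" if "set xs \<subseteq> carrier R" "set ys = set xs" for xs ys
    by (rule koszul_span_least[OF submodule_koszul_span[OF Y] koszul_span_superset[OF Y] that(1)])
      (use that smult_in_koszul_span[OF Y] in auto)
  then show ?thesis using assms by auto
qed

lemma ideal_smult_koszul_span:
  assumes N: "module R N" and q: "q \<in> mod_hom R M N" "q ` carrier M = carrier N"
    and ker: "\<forall>v\<in>carrier M. q v = \<zero>\<^bsub>N\<^esub> \<longleftrightarrow> v \<in> Y" and Y: "submodule Y R M"
    and xs: "set xs \<subseteq> carrier R" and v: "v \<in> carrier M"
  shows "q v \<in> ideal_smult R (Idl\<^bsub>R\<^esub> (set xs)) N \<longleftrightarrow> v \<in> koszul_span M xs Y"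
proof
  interpret N: module R N by fact
  note qh = mod_homD[OF q(1)] mod_hom_simps[OF module_axioms N q(1)]
  let ?I = "Idl\<^bsub>R\<^esub> (set xs)"
  interpret I: ideal ?I R by (rule R.genideal_ideal[OF xs])
  let ?S = "{a \<odot>\<^bsub>N\<^esub> x | a x. a \<in> ?I \<and> x \<in> carrier N}"
  have S: "?S \<subseteq> carrier N" using I.Icarr by auto
  have K: "submodule (koszul_span M xs Y) R M" by (rule submodule_koszul_span[OF Y xs])
  note KD = submoduleD[OF K]
  {
    assume "v \<in> koszul_span M xs Y"
    moreover have "koszul_span M xs Y \<subseteq> {v \<in> carrier M. q v \<in> ideal_smult R ?I N}"
    proof (rule koszul_span_least[OF _ _ xs])
      show "submodule {v \<in> carrier M. q v \<in> ideal_smult R ?I N} R M"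
        unfolding ideal_smult_def by (rule submodule_vimage[OF module_axioms N q(1) N.submodule_span[OF S]])
      show "Y \<subseteq> {v \<in> carrier M. q v \<in> ideal_smult R ?I N}"
      proof
        fix y assume y: "y \<in> Y"
        have yM: "y \<in> carrier M" by (rule submoduleD(1)[OF Y y])
        have "q y = \<zero>\<^bsub>N\<^esub>" using ker yM y by blast
        then show "y \<in> {v \<in> carrier M. q v \<in> ideal_smult R ?I N}"
          unfolding ideal_smult_def using N.submoduleD(2)[OF N.submodule_span[OF S]] yM by simp
      qed
      fix x v assume x: "x \<in> set xs" and v: "v \<in> carrier M"
      have xI: "x \<in> ?I" using R.genideal_self[OF xs] x by blast
      have xR: "x \<in> carrier R" using x xs by blast
      have "q (x \<odot>\<^bsub>M\<^esub> v) = x \<odot>\<^bsub>N\<^esub> q v" by (rule qh(3)[OF xR v])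
      also have "\<dots> \<in> ?S" using xI qh(1)[OF v] by blast
      finally have "q (x \<odot>\<^bsub>M\<^esub> v) \<in> ?S" .
      then show "x \<odot>\<^bsub>M\<^esub> v \<in> {v \<in> carrier M. q v \<in> ideal_smult R ?I N}"
        unfolding ideal_smult_def using N.span_superset[of ?S] smult_closed[OF xR v] by blast
    qed
    ultimately show "q v \<in> ideal_smult R ?I N" by blast
  next
    assume a: "q v \<in> ideal_smult R ?I N"
    have "?S \<subseteq> q ` koszul_span M xs Y"
    proof
      fix z assume "z \<in> ?S"
      then obtain a n where an: "a \<in> ?I" "n \<in> carrier N" "z = a \<odot>\<^bsub>N\<^esub> n" by blast
      obtain w where w: "w \<in> carrier M" "n = q w" using an(2) q(2) by blast
      \<comment> \<open>For fixed \<open>w\<close> the scalars that send \<open>w\<close> into the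
        span form an ideal. It contains \<open>xs\<close>, hence the ideal generated by
        \<open>xs\<close>.\<close>
      have "submodule {a \<in> carrier (regular_module R). a \<odot>\<^bsub>M\<^esub> w \<in> koszul_span M xs Y} R (regular_module R)"
        by (rule submodule_vimage[OF R.module_regular module_axioms _ K], rule mod_homI)
          (use w in \<open>auto simp: smult_l_distr smult_assoc1\<close>)
      then have "ideal {a \<in> carrier R. a \<odot>\<^bsub>M\<^esub> w \<in> koszul_span M xs Y} R" by (simp add: R.submodule_regular_iff)
      then have "?I \<subseteq> {a \<in> carrier R. a \<odot>\<^bsub>M\<^esub> w \<in> koszul_span M xs Y}"
        by (rule R.genideal_minimal) (use xs smult_in_koszul_span[OF Y xs _ w(1)] in auto)
      then have aw: "a \<odot>\<^bsub>M\<^esub> w \<in> koszul_span M xs Y" using an(1) by blast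
      have "z = q (a \<odot>\<^bsub>M\<^esub> w)" using an(3) w(2) qh(3)[OF I.Icarr[OF an(1)] w(1)] by simp
      then show "z \<in> q ` koszul_span M xs Y" using aw by blast
    qed
    then have "ideal_smult R ?I N \<subseteq> q ` koszul_span M xs Y"
      unfolding ideal_smult_def by (rule N.span_least[OF submodule_image[OF module_axioms N q(1) K]])
    then obtain w where w: "w \<in> koszul_span M xs Y" "q v = q w" using a by blast
    have wM: "w \<in> carrier M" by (rule KD(1)[OF w(1)])
    have "q (v \<ominus>\<^bsub>M\<^esub> w) = \<zero>\<^bsub>N\<^esub>" using w(2) qh(6)[OF v wM] qh(1)[OF wM] by (simp add: N.minus_eq N.r_neg)
    then have "v \<ominus>\<^bsub>M\<^esub> w \<in> Y" using ker M.minus_closed[OF v wM] by blast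
    then show "v \<in> koszul_span M xs Y"
      using submodule_cancel[OF K v w(1)] koszul_span_superset[OF Y xs] by blast
  }
qed

text \<open>\<open>N\<close> enters through any surjection \<open>q\<close> with kernel
  \<open>Y\<close>: the identity of R, the coordinate R^1 -> R, or the projection onto a quotient of
  R^n. Comparing two of these moves a regular sequence from one module to an isomorphic one.\<close>

lemma regular_sequence_iff:
  assumes N: "module R N" and q: "q \<in> mod_hom R M N" "q ` carrier M = carrier N"
    and ker: "\<forall>v\<in>carrier M. q v = \<zero>\<^bsub>N\<^esub> \<longleftrightarrow> v \<in> Y" and Y: "submodule Y R M"
    and xs: "set xs \<subseteq> carrier R"
  shows "regular_sequence R N xs \<longleftrightarrow>
    (\<forall>i < length xs. \<forall>v \<in> carrier M. (xs ! i) \<odot>\<^bsub>M\<^esub> v \<in> koszul_span M (take i xs) Y \<longrightarrow> v \<in> koszul_span M (take i xs) Y)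
    \<and> koszul_span M xs Y \<noteq> carrier M"
proof -
  interpret N: module R N by fact
  note qh = mod_homD[OF q(1)]
  have xi: "xs ! i \<in> carrier R" if "i < length xs" for i using xs that by auto
  have txs: "set (take i xs) \<subseteq> carrier R" for i using xs set_take_subset[of i xs] by blast
  note iff = ideal_smult_koszul_span[OF N q ker Y]
  have sub: "submodule (ideal_smult R (Idl\<^bsub>R\<^esub> (set zs)) N) R N" if "set zs \<subseteq> carrier R" for zs
  proof -
    interpret I: ideal "Idl\<^bsub>R\<^esub> (set zs)" R by (rule R.genideal_ideal[OF that])
    show ?thesis unfolding ideal_smult_def by (rule N.submodule_span) (use I.Icarr in auto)
  qed
  have "nonzerodivisor_on R (quotient_module N (ideal_smult R (Idl\<^bsub>R\<^esub> (set (take i xs))) N)) (xs ! i) \<longleftrightarrow>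
    (\<forall>v \<in> carrier M. (xs ! i) \<odot>\<^bsub>M\<^esub> v \<in> koszul_span M (take i xs) Y \<longrightarrow> v \<in> koszul_span M (take i xs) Y)"
    if i: "i < length xs" for i
  proof -
    have "q v \<in> ideal_smult R (Idl\<^bsub>R\<^esub> (set (take i xs))) N \<longleftrightarrow> v \<in> koszul_span M (take i xs) Y"
      "(xs ! i) \<odot>\<^bsub>N\<^esub> q v \<in> ideal_smult R (Idl\<^bsub>R\<^esub> (set (take i xs))) N \<longleftrightarrow> (xs ! i) \<odot>\<^bsub>M\<^esub> v \<in> koszul_span M (take i xs) Y"
      if "v \<in> carrier M" for v
      using iff[OF txs that] iff[OF txs smult_closed[OF xi[OF i] that]] qh(3)[OF xi[OF i] that] by simp_all
    then show ?thesis unfolding N.nonzerodivisor_on_quotient[OF sub[OF txs]] q(2)[symmetric] using xi[OF i] by simp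
  qed
  moreover have "ideal_smult R (Idl\<^bsub>R\<^esub> (set xs)) N = carrier N \<longleftrightarrow> koszul_span M xs Y = carrier M"
  proof
    assume "ideal_smult R (Idl\<^bsub>R\<^esub> (set xs)) N = carrier N"
    then show "koszul_span M xs Y = carrier M"
      using iff[OF xs] qh(1) submoduleD(1)[OF submodule_koszul_span[OF Y xs]] by blast
  next
    assume "koszul_span M xs Y = carrier M"
    then show "ideal_smult R (Idl\<^bsub>R\<^esub> (set xs)) N = carrier N"
    proof (intro equalityI subsetI)
      fix z assume "z \<in> carrier N"
      then obtain v where v: "v \<in> carrier M" "z = q v" using q(2) by (metis imageE)
      then show "z \<in> ideal_smult R (Idl\<^bsub>R\<^esub> (set xs)) N"
        using iff[OF xs v(1)] \<open>koszul_span M xs Y = carrier M\<close> by simp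
    qed (rule N.submoduleD(1)[OF sub[OF xs]])
  qed
  ultimately show ?thesis unfolding regular_sequence_def by simp
qed

end

lemma (in cring) koszul_span_regular:
  assumes "set xs \<subseteq> carrier R"
  shows "koszul_span (regular_module R) xs {\<zero>} = Idl (set xs)"
proof -
  interpret M: module R "regular_module R" by (rule module_regular)
  have Z: "submodule {\<zero>} R (regular_module R)" using M.zero_submodule by simp
  interpret I: ideal "Idl (set xs)" R by (rule genideal_ideal[OF assms])
  show ?thesis
  proof
    show "koszul_span (regular_module R) xs {\<zero>} \<subseteq> Idl (set xs)"
    proof (rule M.koszul_span_least[OF _ _ assms])
      show "submodule (Idl (set xs)) R (regular_module R)" by (simp add: submodule_regular_iff I.is_ideal)
      fix x v assume "x \<in> set xs" "v \<in> carrier (regular_module R)"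
      then show "x \<odot>\<^bsub>regular_module R\<^esub> v \<in> Idl (set xs)"
        using genideal_self[OF assms] by (auto intro: I.I_r_closed)
    qed simp
    show "Idl (set xs) \<subseteq> koszul_span (regular_module R) xs {\<zero>}"
    proof (rule genideal_minimal)
      show "ideal (koszul_span (regular_module R) xs {\<zero>}) R"
        using M.submodule_koszul_span[OF Z assms] by (simp add: submodule_regular_iff)
      show "set xs \<subseteq> koszul_span (regular_module R) xs {\<zero>}"
      proof
        fix x assume x: "x \<in> set xs"
        then have "x \<otimes> \<one> \<in> koszul_span (regular_module R) xs {\<zero>}"
          using M.smult_in_koszul_span[OF Z assms x, of \<one>] by simp
        then show "x \<in> koszul_span (regular_module R) xs {\<zero>}" using x assms by (simp add: subset_iff)
      qed
    qed
  qed
qed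

lemma (in cring) regular_sequence_regular_module:
  assumes "set xs \<subseteq> carrier R" "regular_sequence R (regular_module R) xs"
    and "i < length xs" "r \<in> carrier R" "xs ! i \<otimes> r \<in> Idl (set (take i xs))"
  shows "r \<in> Idl (set (take i xs))"
proof -
  interpret M: module R "regular_module R" by (rule module_regular)
  have Z: "submodule {\<zero>} R (regular_module R)" using M.zero_submodule by simp
  have "(\<lambda>x. x) \<in> mod_hom R (regular_module R) (regular_module R)" by (rule mod_homI) auto
  from M.regular_sequence_iff[OF module_regular this _ _ Z assms(1)] assms(2)
  have "\<forall>v \<in> carrier R. xs ! i \<otimes> v \<in> koszul_span (regular_module R) (take i xs) {\<zero>} \<longrightarrow> v \<in> koszul_span (regular_module R) (take i xs) {\<zero>}"
    using assms(3) by simp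
  moreover have "set (take i xs) \<subseteq> carrier R" using assms(1) set_take_subset[of i xs] by blast
  ultimately show ?thesis using assms(4,5) by (simp add: koszul_span_regular)
qed

subsection \<open>Local rings\<close>

locale noetherian_local = cring R + noetherian_ring R for R (structure) +
  fixes \<mm> :: "'a set"
  assumes maxi: "maximalideal \<mm> R" and unique: "\<And>\<nn>. maximalideal \<nn> R \<Longrightarrow> \<nn> = \<mm>"
begin

sublocale mm: maximalideal \<mm> R by (rule maxi)

text \<open>A nonunit generates a proper ideal. Among the ideals that contain it and avoid
  \<open>\<one>\<close> there is a maximal one by the ascending chain condition; this is a maximal
  ideal, hence \<open>\<mm>\<close>.\<close>

lemma not_in_maximal_unit:
  assumes a: "a \<in> carrier R" "a \<notin> \<mm>" shows "a \<in> Units R"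
proof (rule ccontr)
  assume nu: "a \<notin> Units R"
  interpret M: module R "regular_module R" by (rule module_regular)
  let ?Q = "{J. ideal J R \<and> a \<in> J \<and> \<one> \<notin> J}"
  have "\<one> \<notin> PIdl a"
  proof
    assume "\<one> \<in> PIdl a"
    then obtain b where "b \<in> carrier R" "\<one> = b \<otimes> a" by (auto simp: cgenideal_def)
    then have "a \<in> Units R" using a m_comm[of a b] unfolding Units_def by (auto intro!: bexI[of _ b])
    with nu show False by simp
  qed
  then have Q: "PIdl a \<in> ?Q" using cgenideal_ideal[OF a(1)] cgenideal_self[OF a(1)] by simp
  obtain J where J: "J \<in> ?Q" and mx: "\<And>K. (K, J) \<in> {(A, B). submodule A R (regular_module R) \<and> submodule B R (regular_module R) \<and> B \<subset> A} \<Longrightarrow> K \<notin> ?Q"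
    by (rule wfE_min[OF noetherian_submodule_wf[OF module_regular noetherian_regular_module[OF noetherian_ring_axioms]] Q]) blast
  have "maximalideal J R"
  proof (rule maximalidealI)
    show "ideal J R" "carrier R \<noteq> J" using J by auto
    fix K assume K: "ideal K R" "J \<subseteq> K" "K \<subseteq> carrier R"
    show "K = J \<or> K = carrier R"
    proof (rule ccontr)
      assume neg: "\<not> (K = J \<or> K = carrier R)"
      then have "K \<in> ?Q" using K J ideal.one_imp_carrier[OF K(1)] by blast
      moreover have "(K, J) \<in> {(A, B). submodule A R (regular_module R) \<and> submodule B R (regular_module R) \<and> B \<subset> A}"
        using K J neg by (auto simp: submodule_regular_iff)
      ultimately show False using mx by blast
    qed
  qed
  then have "J = \<mm>" by (rule unique)
  then show False using J a by blast
qed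

lemma one_minus_unit: "a \<in> \<mm> \<Longrightarrow> \<one> \<ominus> a \<in> Units R"
proof (rule not_in_maximal_unit)
  assume a: "a \<in> \<mm>"
  then have aR: "a \<in> carrier R" by (rule mm.Icarr)
  then show "\<one> \<ominus> a \<in> carrier R" by simp
  show "\<one> \<ominus> a \<notin> \<mm>"
  proof
    assume "\<one> \<ominus> a \<in> \<mm>"
    then have "(\<one> \<ominus> a) \<oplus> a \<in> \<mm>" using a by simp
    then have "\<one> \<in> \<mm>" using aR by (simp add: minus_eq a_assoc l_neg)
    then show False using mm.one_imp_carrier mm.I_notcarr by simp
  qed
qed

text \<open>Coordinates are cleared one after the other: every vector is congruent modulo
  \<open>Y\<close> to one whose first k coordinates vanish. For the next coordinate,
  \<open>Y\<close> contains a vector whose earlier entries vanish and whose entry at that place is 1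
  minus an element of \<open>\<mm>\<close>, a unit.\<close>

lemma nakayama_free:
  assumes Y: "submodule Y R (free_module R n)"
    and gen: "\<And>v. v \<in> carrier (free_module R n) \<Longrightarrow> \<exists>y\<in>Y. v \<ominus>\<^bsub>free_module R n\<^esub> y \<in> {..<n} \<rightarrow>\<^sub>E \<mm>"
  shows "Y = carrier (free_module R n)"
proof -
  let ?F = "free_module R n"
  interpret F: module R ?F by (rule module_free)
  note D = F.submoduleD[OF Y]
  define Z where "Z k = {v \<in> carrier ?F. \<forall>i<k. i < n \<longrightarrow> v i = \<zero>}" for k
  have Zsub: "submodule (Z k) R ?F" for k unfolding Z_def
    by (rule F.submoduleI') (auto simp: free_module_simps)
  have cong: "submodule {v \<in> carrier ?F. v \<ominus>\<^bsub>?F\<^esub> f v \<in> Y} R ?F" if f: "f \<in> mod_hom R ?F ?F" for f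
  proof (rule submodule_vimage[OF module_free module_free _ Y], rule mod_homI)
    fix u v assume "u \<in> carrier ?F" "v \<in> carrier ?F"
    then show "u \<oplus>\<^bsub>?F\<^esub> v \<ominus>\<^bsub>?F\<^esub> f (u \<oplus>\<^bsub>?F\<^esub> v) = (u \<ominus>\<^bsub>?F\<^esub> f u) \<oplus>\<^bsub>?F\<^esub> (v \<ominus>\<^bsub>?F\<^esub> f v)"
      using mod_homD[OF f] by (simp add: F.minus_add_distrib4)
  qed (use mod_homD[OF f] in \<open>auto simp: F.smult_minus_distr\<close>)
  have "\<forall>v\<in>carrier ?F. \<exists>z\<in>Z k. v \<ominus>\<^bsub>?F\<^esub> z \<in> Y" if "k \<le> n" for k
    using that
  proof (induction k)
    case 0
    have "v \<ominus>\<^bsub>?F\<^esub> v \<in> Y" if "v \<in> carrier ?F" for v using that D(2) by (simp add: F.minus_eq F.r_neg)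
    then show ?case by (auto simp: Z_def)
  next
    case (Suc k)
    then have k: "k < n" and IH: "\<And>v. v \<in> carrier ?F \<Longrightarrow> \<exists>z\<in>Z k. v \<ominus>\<^bsub>?F\<^esub> z \<in> Y" by simp_all
    have "\<forall>i. \<exists>z. z \<in> Z k \<and> unit_vector R n i \<ominus>\<^bsub>?F\<^esub> z \<in> Y" using IH[OF unit_vector_closed] by blast
    then obtain z where z: "\<And>i. z i \<in> Z k" "\<And>i. unit_vector R n i \<ominus>\<^bsub>?F\<^esub> z i \<in> Y" by metis
    have zF: "z i \<in> carrier ?F" for i by (rule F.submoduleD(1)[OF Zsub z(1)])
    \<comment> \<open>A linear choice of representatives in \<open>Z k\<close>. Linear maps preserve
      the vectors with entries in \<open>\<mm>\<close>, so \<open>w\<close> below has entries in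
      \<open>\<mm>\<close> and at the same time vanishes in the first \<open>k\<close>
      coordinates.\<close>
    obtain f where f: "f \<in> mod_hom R ?F ?F" "\<And>i. i < n \<Longrightarrow> f (unit_vector R n i) = z i"
      using F.free_hom_exists[of n z, OF zF] by blast
    have fF: "f v \<in> carrier ?F" if "v \<in> carrier ?F" for v by (rule mod_homD(1)[OF f(1) that])
    have fZ: "f v \<in> Z k" if v: "v \<in> carrier ?F" for v
      using free_module_induct[OF submodule_vimage[OF module_free module_free f(1) Zsub] _ v] f(2) z(1) by auto
    have fY: "v \<ominus>\<^bsub>?F\<^esub> f v \<in> Y" if v: "v \<in> carrier ?F" for v
      using free_module_induct[OF cong[OF f(1)] _ v] f(2) z(2) by auto
    let ?e = "unit_vector R n k"
    obtain y where y: "y \<in> Y" "?e \<ominus>\<^bsub>?F\<^esub> y \<in> {..<n} \<rightarrow>\<^sub>E \<mm>" using gen[OF unit_vector_closed] by blast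
    define w where "w = f (?e \<ominus>\<^bsub>?F\<^esub> y)"
    have ey: "?e \<ominus>\<^bsub>?F\<^esub> y \<in> carrier ?F" using D(1)[OF y(1)] by simp
    have wm: "w \<in> {..<n} \<rightarrow>\<^sub>E \<mm>" unfolding w_def by (rule hom_power_ideal[OF mm.is_ideal f(1) y(2)])
    have wZ: "w \<in> Z k" unfolding w_def by (rule fZ[OF ey])
    have wF: "w \<in> carrier ?F" by (rule F.submoduleD(1)[OF Zsub wZ])
    have "((?e \<ominus>\<^bsub>?F\<^esub> y) \<ominus>\<^bsub>?F\<^esub> w) \<oplus>\<^bsub>?F\<^esub> y \<in> Y" unfolding w_def by (rule D(3)[OF fY[OF ey] y(1)])
    moreover have "((?e \<ominus>\<^bsub>?F\<^esub> y) \<ominus>\<^bsub>?F\<^esub> w) \<oplus>\<^bsub>?F\<^esub> y = ?e \<ominus>\<^bsub>?F\<^esub> w"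
      using wF D(1)[OF y(1)] unit_vector_closed[of n k] by (simp add: F.minus_eq F.a_ac F.r_neg1 F.r_neg2 F.add_cancel_far)
    ultimately have ew: "?e \<ominus>\<^bsub>?F\<^esub> w \<in> Y" by simp
    have wk: "w k \<in> \<mm>" using wm k by auto
    have wkR: "w k \<in> carrier R" using wk by (rule mm.Icarr)
    note U = one_minus_unit[OF wk]
    let ?c = "inv (\<one> \<ominus> w k)"
    have c: "?c \<in> carrier R" using U by simp
    show ?case
    proof
      fix v assume v: "v \<in> carrier ?F"
      \<comment> \<open>The multiple of the vector in \<open>Y\<close> with unit entry 1 - w k that
        clears coordinate \<open>k\<close> of f v.\<close>
      define r where "r = f v k \<otimes> ?c"
      have fk: "f v k \<in> carrier R" using fF[OF v] k by (auto simp: free_module_simps)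
      have r: "r \<in> carrier R" unfolding r_def using fk c by simp
      let ?d = "r \<odot>\<^bsub>?F\<^esub> (?e \<ominus>\<^bsub>?F\<^esub> w)"
      have ewF: "?e \<ominus>\<^bsub>?F\<^esub> w \<in> carrier ?F" using wF by simp
      have dF: "?d \<in> carrier ?F" by (rule F.smult_closed[OF r ewF])
      have dY: "?d \<in> Y" by (rule D(6)[OF r ew])
      let ?z = "f v \<ominus>\<^bsub>?F\<^esub> ?d"
      have zF: "?z \<in> carrier ?F" by (rule F.M.minus_closed[OF fF[OF v] dF])
      have zi: "?z i = f v i \<ominus> r \<otimes> (unit_vector R n k i \<ominus> w i)" if "i < n" for i
        unfolding free_a_minus[OF fF[OF v] dF] using that
        by (simp add: free_module_simps free_a_minus[OF unit_vector_closed wF])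
      have "?z k = f v k \<ominus> f v k \<otimes> (?c \<otimes> (\<one> \<ominus> w k))"
        using zi[OF k] k fk c wkR by (simp add: unit_vector_def r_def m_assoc)
      also have "\<dots> = \<zero>" using U fk by (simp add: Units_l_inv minus_eq r_neg)
      finally have zk: "?z k = \<zero>" .
      have zi0: "?z i = \<zero>" if "i < k" "i < n" for i
      proof -
        have "f v i = \<zero>" "w i = \<zero>" using fZ[OF v] wZ that by (auto simp: Z_def)
        then show ?thesis using zi[OF that(2)] that r by (simp add: unit_vector_def minus_eq)
      qed
      have zZ: "?z \<in> Z (Suc k)" unfolding Z_def using zF zk zi0 by (auto simp: less_Suc_eq)
      have "(v \<ominus>\<^bsub>?F\<^esub> f v) \<oplus>\<^bsub>?F\<^esub> ?d \<in> Y" by (rule D(3)[OF fY[OF v] dY])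
      moreover have "(v \<ominus>\<^bsub>?F\<^esub> f v) \<oplus>\<^bsub>?F\<^esub> ?d = v \<ominus>\<^bsub>?F\<^esub> ?z"
        using v fF[OF v] dF by (simp add: F.minus_eq F.minus_add F.a_ac)
      ultimately show "\<exists>z\<in>Z (Suc k). v \<ominus>\<^bsub>?F\<^esub> z \<in> Y" using zZ by auto
    qed
  qed
  from this[OF order_refl] have *: "\<exists>z\<in>Z n. v \<ominus>\<^bsub>?F\<^esub> z \<in> Y" if "v \<in> carrier ?F" for v using that by blast
  have "v \<in> Y" if v: "v \<in> carrier ?F" for v
  proof -
    obtain z where z: "z \<in> Z n" "v \<ominus>\<^bsub>?F\<^esub> z \<in> Y" using *[OF v] by blast
    have "z = \<zero>\<^bsub>?F\<^esub>" using z(1) by (auto simp: Z_def free_module_simps fun_eq_iff PiE_iff extensional_def)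
    then show ?thesis using z(2) v by simp
  qed
  then show ?thesis using D(1) by blast
qed

text \<open>Koszul acyclicity makes the first entry of a list a nonzerodivisor modulo the later
  ones, whereas in a regular sequence each entry is one modulo the earlier ones; hence the reversed
  list. Leading entries are dropped by \<open>koszul_acyclic_tail\<close>, which applies since 1
  minus an element of \<open>\<mm>\<close> is a unit.\<close>

lemma regular_sequence_quotient_free:
  assumes Y: "submodule Y R (free_module R n)" "Y \<noteq> carrier (free_module R n)"
    and xs: "set xs \<subseteq> \<mm>"
    and ac: "koszul_acyclic_above (free_module R n) (rev xs) 0 Y"
  shows "regular_sequence R (quotient_module (free_module R n) Y) xs"
proof -
  let ?F = "free_module R n" let ?N = "quotient_module ?F Y"
  interpret F: module R ?F by (rule module_free)
  interpret N: module R ?N by (rule F.module_quotient[OF Y(1)])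
  note q = F.quotient_proj[OF Y(1)]
  have xsR: "set xs \<subseteq> carrier R" using xs(1) mm.Icarr by blast
  have NF: "noetherian_module R ?F" by (rule noetherian_free_module[OF noetherian_ring_axioms])
  have tail: "koszul_acyclic_above ?F zs 0 Y" if "koszul_acyclic_above ?F (ws @ zs) 0 Y" "set (ws @ zs) \<subseteq> \<mm>" for ws zs
    using that
  proof (induction ws)
    case (Cons w ws)
    have w: "w \<in> \<mm>" "set (w # ws @ zs) \<subseteq> carrier R" using Cons.prems(2) mm.Icarr by auto
    have "koszul_acyclic_above ?F (ws @ zs) 0 Y"
      by (rule F.koszul_acyclic_tail[OF NF Y(1) w(2)])
        (use one_minus_unit mm.I_r_closed[OF w(1)] Cons.prems(1) in auto)
    then show ?case using Cons by auto
  qed simp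
  show "regular_sequence R ?N xs"
    unfolding F.regular_sequence_iff[OF N.module_axioms q Y(1) xsR]
  proof (intro conjI allI impI ballI)
    fix i v assume i: "i < length xs" and v: "v \<in> carrier ?F" and m: "xs ! i \<odot>\<^bsub>?F\<^esub> v \<in> koszul_span ?F (take i xs) Y"
    have "rev xs = rev (drop (Suc i) xs) @ (xs ! i # rev (take i xs))"
      using id_take_nth_drop[OF i] by (metis append_Cons append_assoc append_Nil rev.simps(2) rev_append)
    then have ac': "koszul_acyclic_above ?F (xs ! i # rev (take i xs)) 0 Y"
      using tail[of "rev (drop (Suc i) xs)" "xs ! i # rev (take i xs)"] ac xs(1) by (metis set_rev)
    have tR: "set (take i xs) \<subseteq> carrier R" using xsR set_take_subset[of i xs] by blast
    have "set (xs ! i # rev (take i xs)) \<subseteq> carrier R" using xsR tR i by auto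
    from F.koszul_acyclic_regular[OF Y(1) this ac' v] m
    show "v \<in> koszul_span ?F (take i xs) Y"
      using F.koszul_span_set_cong[OF Y(1) tR, of "rev (take i xs)"] by simp
  next
    \<comment> \<open>If \<open>Y\<close> and the multiples of \<open>xs\<close> spanned R^n, then
      every vector would be congruent modulo \<open>Y\<close> to one with entries in
      \<open>\<mm>\<close>, and Nakayama would give Y = R^n.\<close>
    show "koszul_span ?F xs Y \<noteq> carrier ?F"
    proof
      assume eq: "koszul_span ?F xs Y = carrier ?F"
      let ?L = "{v \<in> carrier ?F. \<exists>y\<in>Y. v \<ominus>\<^bsub>?F\<^esub> y \<in> {..<n} \<rightarrow>\<^sub>E \<mm>}"
      note P = submodule_power_ideal[OF mm.is_ideal, of n]
      note PD = F.submoduleD[OF P] and YD = F.submoduleD[OF Y(1)]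
      have L: "submodule ?L R ?F"
      proof (rule F.submoduleI')
        have "\<zero>\<^bsub>?F\<^esub> \<ominus>\<^bsub>?F\<^esub> \<zero>\<^bsub>?F\<^esub> \<in> {..<n} \<rightarrow>\<^sub>E \<mm>"
          unfolding F.minus_zero_simps(2)[OF F.M.zero_closed] by (rule PD(2))
        then show "\<zero>\<^bsub>?F\<^esub> \<in> ?L" using YD(2) F.M.zero_closed by blast
        fix a b assume "a \<in> ?L" "b \<in> ?L"
        then obtain u v where u: "a \<in> carrier ?F" "u \<in> Y" "a \<ominus>\<^bsub>?F\<^esub> u \<in> {..<n} \<rightarrow>\<^sub>E \<mm>"
          and v: "b \<in> carrier ?F" "v \<in> Y" "b \<ominus>\<^bsub>?F\<^esub> v \<in> {..<n} \<rightarrow>\<^sub>E \<mm>" by blast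
        have "(a \<oplus>\<^bsub>?F\<^esub> b) \<ominus>\<^bsub>?F\<^esub> (u \<oplus>\<^bsub>?F\<^esub> v) \<in> {..<n} \<rightarrow>\<^sub>E \<mm>"
          unfolding F.minus_add_distrib4[OF u(1) v(1) YD(1)[OF u(2)] YD(1)[OF v(2)]] by (rule PD(3)[OF u(3) v(3)])
        then show "a \<oplus>\<^bsub>?F\<^esub> b \<in> ?L" using F.M.a_closed[OF u(1) v(1)] YD(3)[OF u(2) v(2)] by blast
      next
        fix r a assume r: "r \<in> carrier R" and "a \<in> ?L"
        then obtain u where u: "a \<in> carrier ?F" "u \<in> Y" "a \<ominus>\<^bsub>?F\<^esub> u \<in> {..<n} \<rightarrow>\<^sub>E \<mm>" by blast
        have "r \<odot>\<^bsub>?F\<^esub> a \<ominus>\<^bsub>?F\<^esub> r \<odot>\<^bsub>?F\<^esub> u \<in> {..<n} \<rightarrow>\<^sub>E \<mm>"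
          unfolding F.smult_minus_distr[OF r u(1) YD(1)[OF u(2)], symmetric] by (rule PD(6)[OF r u(3)])
        then show "r \<odot>\<^bsub>?F\<^esub> a \<in> ?L" using F.smult_closed[OF r u(1)] YD(6)[OF r u(2)] by blast
      qed blast
      have "koszul_span ?F xs Y \<subseteq> ?L"
      proof (rule F.koszul_span_least[OF L _ xsR])
        show "Y \<subseteq> ?L"
        proof
          fix y assume y: "y \<in> Y"
          have "y \<ominus>\<^bsub>?F\<^esub> y = \<zero>\<^bsub>?F\<^esub>" using YD(1)[OF y] by (simp add: F.minus_eq F.r_neg)
          then have "y \<ominus>\<^bsub>?F\<^esub> y \<in> {..<n} \<rightarrow>\<^sub>E \<mm>" using PD(2) by (simp only:)
          then show "y \<in> ?L" using y YD(1)[OF y] by blast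
        qed
        fix x v assume x: "x \<in> set xs" and v: "v \<in> carrier ?F"
        have xm: "x \<in> \<mm>" using x xs(1) by blast
        have "x \<odot>\<^bsub>?F\<^esub> v \<in> {..<n} \<rightarrow>\<^sub>E \<mm>" using v mm.I_r_closed[OF xm] by (auto simp: free_module_simps)
        moreover have xv: "x \<odot>\<^bsub>?F\<^esub> v \<in> carrier ?F" by (rule F.smult_closed[OF mm.Icarr[OF xm] v])
        ultimately have "x \<odot>\<^bsub>?F\<^esub> v \<ominus>\<^bsub>?F\<^esub> \<zero>\<^bsub>?F\<^esub> \<in> {..<n} \<rightarrow>\<^sub>E \<mm>" by simp
        then show "x \<odot>\<^bsub>?F\<^esub> v \<in> ?L" using xv YD(2) by blast
      qed
      then have "carrier ?F \<subseteq> ?L" unfolding eq .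
      then have "Y = carrier ?F" by (intro nakayama_free[OF Y(1)]) blast
      with Y(2) show False by simp
    qed
  qed
qed

lemma MCM_quotient_free:
  assumes Y: "submodule Y R (free_module R n)" "Y \<noteq> carrier (free_module R n)"
    and xs: "set xs \<subseteq> \<mm>" "enat (length xs) = krull_dim R"
    and ac: "koszul_acyclic_above (free_module R n) (rev xs) 0 Y"
  shows "MCM R \<mm> (quotient_module (free_module R n) Y)"
proof -
  let ?F = "free_module R n" let ?N = "quotient_module ?F Y"
  interpret F: module R ?F by (rule module_free)
  interpret N: module R ?N by (rule F.module_quotient[OF Y(1)])
  note q = F.quotient_proj[OF Y(1)]
  have nz: "carrier ?N \<noteq> {\<zero>\<^bsub>?N\<^esub>}" by (rule F.quotient_nonzero[OF Y])
  have fg: "finitely_generated R ?N"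
  proof -
    let ?S = "(+>\<^bsub>?F\<^esub>) Y ` unit_vector R n ` {..<n}"
    have S: "?S \<subseteq> carrier ?N" using q(2) unit_vector_closed by blast
    have "v \<in> {v \<in> carrier ?F. Y +>\<^bsub>?F\<^esub> v \<in> module_span R ?N ?S}" if "v \<in> carrier ?F" for v
      by (rule free_module_induct[OF submodule_vimage[OF module_free N.module_axioms q(1) N.submodule_span[OF S]] _ that])
        (use unit_vector_closed N.span_superset[of ?S] in auto)
    then have "(+>\<^bsub>?F\<^esub>) Y ` carrier ?F \<subseteq> module_span R ?N ?S" by (intro image_subsetI) simp
    then have "carrier ?N \<subseteq> module_span R ?N ?S" unfolding q(2) .
    then have "module_span R ?N ?S = carrier ?N"
      by (intro equalityI subsetI) (simp_all add: N.submoduleD(1)[OF N.submodule_span[OF S]] subset_iff)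
    then show ?thesis unfolding finitely_generated_def using S by (intro exI[of _ ?S]) simp
  qed
  have "regular_sequence R ?N xs" by (rule regular_sequence_quotient_free[OF Y xs(1) ac])
  then show ?thesis unfolding MCM_def using N.module_axioms nz fg xs by blast
qed

text \<open>R^1/0 stands for R in the carrier type of the list of modules. If the unit vector is a +
  b, the entries of a and b add up to 1, so one of them is outside \<open>\<mm>\<close>, hence a
  unit, and its summand is everything.\<close>

lemma indecomposable_regular:
  "indecomposable R (quotient_module (free_module R 1) {\<zero>\<^bsub>free_module R 1\<^esub>})"
proof -
  let ?F = "free_module R 1"
  interpret F: module R ?F by (rule module_free)
  let ?e = "unit_vector R 1 0"
  have v_eq: "v = v 0 \<odot>\<^bsub>?F\<^esub> ?e" and v0: "v 0 \<in> carrier R" if "v \<in> carrier ?F" for v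
    using that by (auto simp: free_module_simps unit_vector_def fun_eq_iff PiE_iff extensional_def)
  have full: "A = carrier ?F" if A: "submodule A R ?F" and a: "a \<in> A" "a 0 \<in> Units R" for A a
  proof -
    have aF: "a \<in> carrier ?F" by (rule F.submoduleD(1)[OF A a(1)])
    have "v \<in> A" if v: "v \<in> carrier ?F" for v
    proof -
      have "(v 0 \<otimes> inv (a 0)) \<odot>\<^bsub>?F\<^esub> a \<in> A" by (rule F.submoduleD(6)[OF A _ a(1)]) (use v0[OF v] a(2) in simp)
      moreover have "(v 0 \<otimes> inv (a 0)) \<odot>\<^bsub>?F\<^esub> a = v"
        using v aF v0[OF v] v0[OF aF] a(2) by (auto simp: free_module_simps fun_eq_iff m_assoc PiE_iff extensional_def)
      ultimately show ?thesis by simp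
    qed
    then show ?thesis using F.submoduleD(1)[OF A] by blast
  qed
  show ?thesis
  proof (rule F.indecomposable_quotientI[OF F.zero_submodule])
    have "\<one> \<noteq> \<zero>" using mm.I_notcarr mm.one_imp_carrier mm.zero_closed by metis
    then have "?e \<noteq> \<zero>\<^bsub>?F\<^esub>" by (auto simp: unit_vector_def free_module_simps fun_eq_iff)
    then show "{\<zero>\<^bsub>?F\<^esub>} \<noteq> carrier ?F" using unit_vector_closed[of 1 0] by blast
    fix A B assume A: "submodule A R ?F" and B: "submodule B R ?F" and AB: "A \<inter> B = {\<zero>\<^bsub>?F\<^esub>}"
      and sum: "\<And>v. v \<in> carrier ?F \<Longrightarrow> \<exists>a\<in>A. \<exists>b\<in>B. v = a \<oplus>\<^bsub>?F\<^esub> b"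
    obtain a b where ab: "a \<in> A" "b \<in> B" "?e = a \<oplus>\<^bsub>?F\<^esub> b" using sum[OF unit_vector_closed] by blast
    have aF: "a \<in> carrier ?F" and bF: "b \<in> carrier ?F"
      using F.submoduleD(1)[OF A ab(1)] F.submoduleD(1)[OF B ab(2)] .
    have "?e 0 = a 0 \<oplus> b 0" using ab(3) by (simp add: free_module_simps)
    then have one: "\<one> = a 0 \<oplus> b 0" by (simp add: unit_vector_def)
    have "a 0 \<notin> \<mm> \<or> b 0 \<notin> \<mm>"
    proof (rule ccontr)
      assume "\<not> ?thesis"
      then have "a 0 \<oplus> b 0 \<in> \<mm>" by simp
      with one show False using mm.one_imp_carrier mm.I_notcarr by simp
    qed
    then have "A = carrier ?F \<or> B = carrier ?F"
      using full[OF A ab(1)] full[OF B ab(2)] not_in_maximal_unit v0[OF aF] v0[OF bF] by blast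
    then show "A = {\<zero>\<^bsub>?F\<^esub>} \<or> B = {\<zero>\<^bsub>?F\<^esub>}" using AB F.submoduleD(1)[OF A] F.submoduleD(1)[OF B] by blast
  qed
qed

end

subsection \<open>Free resolutions and Ext\<close>

lemma a_kernel_eq: "a_kernel M N f = {x \<in> carrier M. f x = \<zero>\<^bsub>N\<^esub>}"
  by (simp add: a_kernel_def')

lemma submodule_kernel:
  assumes "module R M" "module R N" "f \<in> mod_hom R M N"
  shows "submodule {x \<in> carrier M. f x = \<zero>\<^bsub>N\<^esub>} R M"
proof -
  interpret N: module R N by fact
  show ?thesis using submodule_vimage[OF assms N.zero_submodule] by simp
qed

text \<open>\<open>Ext\<close> takes a resolution by choice, and existence makes the defining
  property of the chosen one available. Successive kernels are covered by free modules, which is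
  possible because they are finitely generated.\<close>

lemma (in cring) exists_free_resolution:
  assumes noeth: "noetherian_ring R" and M: "module R M" and fg: "finitely_generated R M"
  shows "\<exists>F \<epsilon>. free_resolution R M (fst F) (snd F) \<epsilon>"
proof -
  interpret M: module R M by fact
  obtain S where S: "finite S" "S \<subseteq> carrier M" "module_span R M S = carrier M"
    using fg unfolding finitely_generated_def by blast
  obtain n \<epsilon> where e: "\<epsilon> \<in> mod_hom R (free_module R n) M" "\<epsilon> ` carrier (free_module R n) = carrier M"
    using M.finitely_generated_free_surj[OF S(1,2)] S(3) by metis
  have "\<exists>c. snd c \<in> mod_hom R (free_module R (fst c)) (free_module R n) \<and>
      snd c ` carrier (free_module R (fst c)) = K"
    if K: "submodule K R (free_module R n)" for n K
  proof -
    interpret F: module R "free_module R n" by (rule module_free)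
    obtain T where T: "finite T" "T \<subseteq> K" "module_span R (free_module R n) T = K"
      by (rule noetherian_submodule_fg[OF module_free noetherian_free_module[OF noeth] K])
    have "T \<subseteq> carrier (free_module R n)" using T(2) F.submoduleD(1)[OF K] by blast
    then obtain m h where "h \<in> mod_hom R (free_module R m) (free_module R n)"
      "h ` carrier (free_module R m) = K"
      using F.finitely_generated_free_surj[OF T(1)] T(3) by metis
    then show ?thesis by (intro exI[of _ "(m, h)"]) simp
  qed
  note ex = this
  define c where "c n K = (SOME c. snd c \<in> mod_hom R (free_module R (fst c)) (free_module R n) \<and>
      snd c ` carrier (free_module R (fst c)) = K)" for n K
  have c: "snd (c n K) \<in> mod_hom R (free_module R (fst (c n K))) (free_module R n) \<and>
      snd (c n K) ` carrier (free_module R (fst (c n K))) = K" if "submodule K R (free_module R n)" for n K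
    unfolding c_def by (rule someI_ex[OF ex[OF that]])
  let ?ker = "\<lambda>n m f. {x \<in> carrier (free_module R n). f x = \<zero>\<^bsub>free_module R m\<^esub>}"
  \<comment> \<open>The state is the rank of the current free module together with the submodule
    that the next differential has to cover.\<close>
  define s where "s = rec_nat (n, {x \<in> carrier (free_module R n). \<epsilon> x = \<zero>\<^bsub>M\<^esub>})
     (\<lambda>_ (n, K). (fst (c n K), ?ker (fst (c n K)) n (snd (c n K))))"
  define b where "b i = fst (s i)" for i
  define d where "d i = snd (c (fst (s i)) (snd (s i)))" for i
  have s0: "s 0 = (n, {x \<in> carrier (free_module R n). \<epsilon> x = \<zero>\<^bsub>M\<^esub>})" by (simp add: s_def)
  have sS: "s (Suc i) = (fst (c (fst (s i)) (snd (s i))), ?ker (fst (c (fst (s i)) (snd (s i)))) (fst (s i)) (d i))" for i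
    by (simp add: s_def d_def split: prod.splits)
  have sub: "submodule (snd (s i)) R (free_module R (b i))" for i
  proof (induction i)
    case 0
    show ?case using submodule_kernel[OF module_free M e(1)] by (simp add: b_def s0)
  next
    case (Suc i)
    then show ?case using c[OF Suc[unfolded b_def]] submodule_kernel[OF module_free module_free]
      by (simp add: b_def sS d_def)
  qed
  have d: "d i \<in> mod_hom R (free_module R (b (Suc i))) (free_module R (b i))"
    "d i ` carrier (free_module R (b (Suc i))) = snd (s i)" for i
    using c[OF sub[unfolded b_def, of i]] by (simp_all add: b_def d_def sS)
  have "free_resolution R M b d \<epsilon>"
    unfolding free_resolution_def a_kernel_eq
  proof (intro conjI allI)
    show "d 0 ` carrier (free_module R (b 1)) = {x \<in> carrier (free_module R (b 0)). \<epsilon> x = \<zero>\<^bsub>M\<^esub>}"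
      using d(2)[of 0] by (simp add: s0 b_def)
    fix i
    show "d (Suc i) ` carrier (free_module R (b (Suc (Suc i)))) =
      {x \<in> carrier (free_module R (b (Suc i))). d i x = \<zero>\<^bsub>free_module R (b i)\<^esub>}"
      using d(2)[of "Suc i"] by (simp add: sS b_def)
  qed (use e d in \<open>simp_all add: b_def s0\<close>)
  then show ?thesis by (intro exI[of _ "(b, d)"] exI[of _ \<epsilon>]) simp
qed

lemma (in module) submodule_restrict_carrier:
  assumes "submodule Z R M" "submodule B R M" "B \<subseteq> Z"
  shows "submodule B R (M\<lparr>carrier := Z\<rparr>)"
proof -
  interpret Z: module R "M\<lparr>carrier := Z\<rparr>" by (rule submodule.submodule_is_module[OF assms(1) module_axioms])
  show ?thesis
    by (rule Z.submoduleI') (use assms(3) submoduleD[OF assms(2)] in auto)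
qed

section \<open>Hom modules and annihilators of first Ext modules\<close>

lemma Hom_module_simps:
  "carrier (Hom_module R M N) = mod_hom R M N \<inter> extensional (carrier M)"
  "\<zero>\<^bsub>Hom_module R M N\<^esub> = (\<lambda>x\<in>carrier M. \<zero>\<^bsub>N\<^esub>)"
  "f \<oplus>\<^bsub>Hom_module R M N\<^esub> g = (\<lambda>x\<in>carrier M. f x \<oplus>\<^bsub>N\<^esub> g x)"
  "a \<odot>\<^bsub>Hom_module R M N\<^esub> f = (\<lambda>x\<in>carrier M. a \<odot>\<^bsub>N\<^esub> f x)"
  by (simp_all add: Hom_module_def)

lemma mod_hom_restrict:
  assumes "module R M" "f \<in> mod_hom R M N" shows "restrict f (carrier M) \<in> mod_hom R M N"
proof -
  interpret M: module R M by fact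
  show ?thesis by (rule mod_homI) (simp_all add: mod_homD[OF assms(2)])
qed

lemma mod_hom_add:
  assumes "module R M" "module R N" "f \<in> mod_hom R M N" "g \<in> mod_hom R M N"
  shows "(\<lambda>x. f x \<oplus>\<^bsub>N\<^esub> g x) \<in> mod_hom R M N"
proof -
  interpret M: module R M by fact
  interpret N: module R N by fact
  show ?thesis
    by (rule mod_homI) (simp_all add: mod_homD[OF assms(3)] mod_homD[OF assms(4)] N.smult_r_distr N.M.a_ac)
qed

lemma module_Hom:
  assumes M: "module R M" and N: "module R N" shows "module R (Hom_module R M N)"
proof -
  interpret M: module R M by fact
  interpret N: module R N by fact
  note ext = fun_eq_iff extensional_def
  have closed: "f x \<in> carrier N" if "f \<in> mod_hom R M N" "x \<in> carrier M" for f x using mod_homD(1)[OF that] .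
  have sm: "(\<lambda>x\<in>carrier M. a \<odot>\<^bsub>N\<^esub> f x) \<in> mod_hom R M N" if "a \<in> carrier R" "f \<in> mod_hom R M N" for a f
    by (rule mod_hom_restrict[OF M mod_hom_comp[OF that(2) N.smult_mod_hom[OF that(1)]]])
  have add: "(\<lambda>x\<in>carrier M. f x \<oplus>\<^bsub>N\<^esub> g x) \<in> mod_hom R M N" if "f \<in> mod_hom R M N" "g \<in> mod_hom R M N" for f g
    by (rule mod_hom_restrict[OF M mod_hom_add[OF M N that]])
  have zero: "(\<lambda>x\<in>carrier M. \<zero>\<^bsub>N\<^esub>) \<in> mod_hom R M N" by (rule mod_homI) auto
  show ?thesis
  proof (rule moduleI[OF M.R.is_cring])
    show "abelian_group (Hom_module R M N)"
    proof (rule abelian_groupI)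
      fix f assume f: "f \<in> carrier (Hom_module R M N)"
      then have fh: "f \<in> mod_hom R M N" by (simp add: Hom_module_simps)
      let ?g = "\<lambda>x\<in>carrier M. \<ominus>\<^bsub>N\<^esub> f x"
      have "?g \<in> carrier (Hom_module R M N)"
        using mod_hom_restrict[OF M mod_hom_comp[OF fh N.uminus_mod_hom]] by (simp add: Hom_module_simps)
      moreover have "?g \<oplus>\<^bsub>Hom_module R M N\<^esub> f = \<zero>\<^bsub>Hom_module R M N\<^esub>"
        using closed[OF fh] by (auto simp: Hom_module_simps fun_eq_iff N.M.l_neg)
      ultimately show "\<exists>g\<in>carrier (Hom_module R M N). g \<oplus>\<^bsub>Hom_module R M N\<^esub> f = \<zero>\<^bsub>Hom_module R M N\<^esub>" by blast
    qed (auto simp: Hom_module_simps ext closed add zero N.M.a_ac)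
  qed (auto simp: Hom_module_simps ext closed sm N.smult_l_distr N.smult_r_distr N.smult_assoc1)
qed

lemma Hom_coboundary_mod_hom:
  assumes R: "cring R" and N: "module R N"
    and d: "d i \<in> mod_hom R (free_module R (b (Suc i))) (free_module R (b i))"
  shows "Hom_coboundary R b d i \<in> mod_hom R (Hom_cochains R b N i) (Hom_cochains R b N (Suc i))"
proof -
  interpret cring R by fact
  interpret N: module R N by fact
  note dD = mod_homD(1)[OF d]
  show ?thesis
  proof (rule mod_homI)
    fix f assume "f \<in> carrier (Hom_cochains R b N i)"
    then have f: "f \<in> mod_hom R (free_module R (b i)) N" by (simp add: Hom_cochains_def Hom_module_simps)
    show "Hom_coboundary R b d i f \<in> carrier (Hom_cochains R b N (Suc i))"
      using mod_hom_restrict[OF module_free mod_hom_comp[OF d f]]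
      by (simp add: Hom_coboundary_def Hom_cochains_def Hom_module_simps compose_def)
  qed (use dD in \<open>auto simp: Hom_coboundary_def Hom_cochains_def Hom_module_simps compose_def fun_eq_iff\<close>)
qed

text \<open>For \<open>Z \<subseteq> R\<^sup>n\<close> this says that \<open>a\<close> annihilates \<open>Ext\<^sup>1(R\<^sup>n/Z, N)\<close>.\<close>

definition extends_after_smult ::
  "('a, 'r) ring_scheme \<Rightarrow> nat \<Rightarrow> (nat \<Rightarrow> 'a) set \<Rightarrow> ('a, 'c, 'n) module_scheme \<Rightarrow> 'a \<Rightarrow> bool" where
  "extends_after_smult R n Z N a \<longleftrightarrow>
     (\<forall>g \<in> mod_hom R (free_module R n\<lparr>carrier := Z\<rparr>) N.
        \<exists>h \<in> mod_hom R (free_module R n) N. \<forall>z\<in>Z. h z = a \<odot>\<^bsub>N\<^esub> g z)"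

lemma extends_after_smultD:
  assumes "extends_after_smult R n Z N a" "g \<in> mod_hom R (free_module R n\<lparr>carrier := Z\<rparr>) N"
  obtains h where "h \<in> mod_hom R (free_module R n) N" "\<And>z. z \<in> Z \<Longrightarrow> h z = a \<odot>\<^bsub>N\<^esub> g z"
proof -
  have "\<exists>h \<in> mod_hom R (free_module R n) N. \<forall>z\<in>Z. h z = a \<odot>\<^bsub>N\<^esub> g z"
    using assms unfolding extends_after_smult_def by simp
  then show ?thesis using that by blast
qed

context cring
begin

context
  notes One_nat_def [simp del]
begin

text \<open>A 1-cocycle vanishes on the image of \<open>d 1\<close>, which is the kernel of
  \<open>d 0\<close>. So it is g after \<open>d 0\<close> for a map g on the image Z of
  \<open>d 0\<close>, and it is a coboundary exactly if g extends to the free module of rank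
  \<open>b 0\<close>.\<close>

lemma annihilator_cohomology_iff:
  assumes N: "module R N" and res: "free_resolution R M b d \<epsilon>" and M: "module R M"
  shows "a \<in> annihilator R (Hom_cohomology R b d N 1) \<longleftrightarrow>
    a \<in> carrier R \<and> extends_after_smult R (b 0) {x \<in> carrier (free_module R (b 0)). \<epsilon> x = \<zero>\<^bsub>M\<^esub>} N a"
proof -
  interpret N: module R N by fact
  let ?F = "\<lambda>i. free_module R (b i)" and ?C = "Hom_cochains R b N" and ?D = "Hom_coboundary R b d"
  have d: "d i \<in> mod_hom R (?F (Suc i)) (?F i)" for i using res by (simp add: free_resolution_def)
  have S0: "Suc 0 = 1" and S1: "Suc 1 = 2" by (simp_all add: One_nat_def)
  define Z where "Z = {x \<in> carrier (?F 0). \<epsilon> x = \<zero>\<^bsub>M\<^esub>}"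
  have e: "\<epsilon> \<in> mod_hom R (?F 0) M" using res by (simp add: free_resolution_def)
  have d0: "d 0 ` carrier (?F 1) = Z" and d1: "d 1 ` carrier (?F 2) = {x \<in> carrier (?F 1). d 0 x = \<zero>\<^bsub>?F 0\<^esub>}"
  proof -
    show "d 0 ` carrier (?F 1) = Z" using res by (simp add: free_resolution_def a_kernel_eq Z_def)
    have "d (Suc 0) ` carrier (?F (Suc (Suc 0))) = {x \<in> carrier (?F (Suc 0)). d 0 x = \<zero>\<^bsub>?F 0\<^esub>}"
      using res unfolding free_resolution_def a_kernel_eq by blast
    then show "d 1 ` carrier (?F 2) = {x \<in> carrier (?F 1). d 0 x = \<zero>\<^bsub>?F 0\<^esub>}" unfolding S0 S1 .
  qed
  interpret F0: module R "?F 0" by (rule module_free)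
  interpret F1: module R "?F 1" by (rule module_free)
  interpret F2: module R "?F 2" by (rule module_free)
  have C: "module R (?C i)" for i unfolding Hom_cochains_def by (rule module_Hom[OF module_free N])
  interpret C1: module R "?C 1" by (rule C)
  have D: "?D i \<in> mod_hom R (?C i) (?C (Suc i))" for i by (rule Hom_coboundary_mod_hom[where d = d and i = i and b = b, OF is_cring N d])
  define Zc where "Zc = Hom_cocycles R b d N 1"
  define Bc where "Bc = Hom_coboundaries R b d N 1"
  have Zc: "Zc = {f \<in> carrier (?C 1). ?D 1 f = \<zero>\<^bsub>?C 2\<^esub>}"
    unfolding Zc_def Hom_cocycles_def a_kernel_eq S1 by (rule refl)
  have Bc: "Bc = ?D 0 ` carrier (?C 0)" unfolding Bc_def Hom_coboundaries_def One_nat_def by simp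
  have Zsub: "submodule Zc R (?C 1)"
    unfolding Zc by (rule submodule_kernel[OF C C D[of 1, unfolded S1]])
  have Bsub: "submodule Bc R (?C 1)"
    unfolding Bc by (rule submodule_image[OF C C D[of 0, unfolded S0] module.carrier_is_submodule[OF C]])
  have dd: "d 0 (d 1 x) = \<zero>\<^bsub>?F 0\<^esub>" if "x \<in> carrier (?F 2)" for x using d1 that by blast
  have dc: "d 0 x \<in> Z" if "x \<in> carrier (?F 1)" for x using d0 that by blast
  have dc1: "d 1 x \<in> carrier (?F 1)" if "x \<in> carrier (?F 2)" for x using d1 that by blast
  have ZF: "z \<in> carrier (?F 0)" if "z \<in> Z" for z using that by (simp add: Z_def)
  have Zs: "submodule Z R (?F 0)" unfolding Z_def by (rule submodule_kernel[OF module_free M e])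
  interpret Z: module R "?F 0\<lparr>carrier := Z\<rparr>" by (rule submodule.submodule_is_module[OF Zs module_free])
  have ZcI: "f \<in> Zc" if "f \<in> mod_hom R (?F 1) N" "f \<in> extensional (carrier (?F 1))" "\<And>x. x \<in> carrier (?F 2) \<Longrightarrow> f (d 1 x) = \<zero>\<^bsub>N\<^esub>" for f
    using that by (auto simp: Zc Hom_cochains_def Hom_module_simps Hom_coboundary_def compose_def fun_eq_iff S1)
  have ZcE: "f \<in> mod_hom R (?F 1) N" "x \<in> carrier (?F 2) \<Longrightarrow> f (d 1 x) = \<zero>\<^bsub>N\<^esub>" if f: "f \<in> Zc" for f x
  proof -
    show "f \<in> mod_hom R (?F 1) N" using f by (simp add: Zc Hom_cochains_def Hom_module_simps)
    assume x: "x \<in> carrier (?F 2)"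
    have "?D 1 f x = \<zero>\<^bsub>?C 2\<^esub> x" using f by (simp add: Zc)
    then show "f (d 1 x) = \<zero>\<^bsub>N\<^esub>"
      using x by (simp add: Hom_coboundary_def compose_def Hom_cochains_def Hom_module_simps S1)
  qed
  have BZ: "Bc \<subseteq> Zc"
  proof
    fix f assume "f \<in> Bc"
    then obtain h where h: "h \<in> carrier (?C 0)" "f = ?D 0 h" unfolding Bc by blast
    have hh: "h \<in> mod_hom R (?F 0) N" using h(1) by (simp add: Hom_cochains_def Hom_module_simps)
    have fx: "f x = h (d 0 x)" if "x \<in> carrier (?F 1)" for x using h(2) that by (simp add: Hom_coboundary_def compose_def S0)
    have "f \<in> carrier (?C 1)" using mod_homD(1)[OF D[of 0, unfolded S0] h(1)] h(2) by simp
    then show "f \<in> Zc"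
      by (intro ZcI) (simp_all add: Hom_cochains_def Hom_module_simps fx dc1 dd mod_hom_simps(1)[OF module_free N hh])
  qed
  have aBI: "a \<odot>\<^bsub>?C 1\<^esub> f \<in> Bc" if h: "h \<in> mod_hom R (?F 0) N" and eq: "\<And>y. y \<in> carrier (?F 1) \<Longrightarrow> h (d 0 y) = a \<odot>\<^bsub>N\<^esub> f y" for f h
  proof -
    have "restrict h (carrier (?F 0)) \<in> carrier (?C 0)"
      using mod_hom_restrict[OF module_free h] by (simp add: Hom_cochains_def Hom_module_simps)
    moreover have "a \<odot>\<^bsub>?C 1\<^esub> f = ?D 0 (restrict h (carrier (?F 0)))"
      using eq ZF[OF dc] by (auto simp: Hom_cochains_def Hom_module_simps Hom_coboundary_def compose_def fun_eq_iff S0)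
    ultimately show ?thesis unfolding Bc by blast
  qed
  have aBE: "\<exists>h \<in> mod_hom R (?F 0) N. \<forall>y\<in>carrier (?F 1). h (d 0 y) = a \<odot>\<^bsub>N\<^esub> f y" if aB: "a \<odot>\<^bsub>?C 1\<^esub> f \<in> Bc" for f
  proof -
    obtain h where h: "h \<in> carrier (?C 0)" "a \<odot>\<^bsub>?C 1\<^esub> f = ?D 0 h" using aB unfolding Bc by blast
    have "h (d 0 y) = a \<odot>\<^bsub>N\<^esub> f y" if y: "y \<in> carrier (?F 1)" for y
      using fun_cong[OF h(2), of y] y by (simp add: Hom_coboundary_def compose_def Hom_cochains_def Hom_module_simps S0)
    moreover have "h \<in> mod_hom R (?F 0) N" using h(1) by (simp add: Hom_cochains_def Hom_module_simps)
    ultimately show ?thesis by blast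
  qed
  interpret Zm: module R "?C 1\<lparr>carrier := Zc\<rparr>" by (rule submodule.submodule_is_module[OF Zsub C])
  have "annihilator R (Hom_cohomology R b d N 1) = {a \<in> carrier R. \<forall>f\<in>Zc. a \<odot>\<^bsub>?C 1\<^esub> f \<in> Bc}"
    unfolding Hom_cohomology_def Zc_def[symmetric] Bc_def[symmetric]
    using Zm.annihilator_quotient[OF C1.submodule_restrict_carrier[OF Zsub Bsub BZ]] by simp
  moreover have "(\<forall>f\<in>Zc. a \<odot>\<^bsub>?C 1\<^esub> f \<in> Bc) \<longleftrightarrow> extends_after_smult R (b 0) Z N a" if a: "a \<in> carrier R"
  proof
    assume ann: "\<forall>f\<in>Zc. a \<odot>\<^bsub>?C 1\<^esub> f \<in> Bc"
    show "extends_after_smult R (b 0) Z N a" unfolding extends_after_smult_def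
    proof
      fix g assume g: "g \<in> mod_hom R (?F 0\<lparr>carrier := Z\<rparr>) N"
      have "d 0 \<in> mod_hom R (?F 1) (?F 0\<lparr>carrier := Z\<rparr>)"
        by (rule mod_homI) (use dc mod_homD[OF d[of 0, unfolded S0]] in simp_all)
      from mod_hom_comp[OF this g] have gd: "(\<lambda>x. g (d 0 x)) \<in> mod_hom R (?F 1) N" .
      let ?f = "\<lambda>x\<in>carrier (?F 1). g (d 0 x)"
      have "?f \<in> Zc"
      proof (rule ZcI)
        show "?f \<in> mod_hom R (?F 1) N" by (rule mod_hom_restrict[OF module_free gd])
        fix x assume "x \<in> carrier (?F 2)"
        then show "?f (d 1 x) = \<zero>\<^bsub>N\<^esub>"
          using mod_hom_simps(1)[OF Z.module_axioms N g] by (simp add: dc1 dd)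
      qed simp
      with ann have "a \<odot>\<^bsub>?C 1\<^esub> ?f \<in> Bc" by blast
      then obtain h where h: "h \<in> mod_hom R (?F 0) N" "\<And>y. y \<in> carrier (?F 1) \<Longrightarrow> h (d 0 y) = a \<odot>\<^bsub>N\<^esub> ?f y"
        using aBE by blast
      show "\<exists>h\<in>mod_hom R (?F 0) N. \<forall>z\<in>Z. h z = a \<odot>\<^bsub>N\<^esub> g z"
      proof (intro bexI[OF _ h(1)] ballI)
        fix z assume "z \<in> Z"
        then obtain y where "y \<in> carrier (?F 1)" "z = d 0 y" using d0 by blast
        then show "h z = a \<odot>\<^bsub>N\<^esub> g z" using h(2) by simp
      qed
    qed
  next
    assume ext: "extends_after_smult R (b 0) Z N a"
    show "\<forall>f\<in>Zc. a \<odot>\<^bsub>?C 1\<^esub> f \<in> Bc"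
    proof
      fix f assume f: "f \<in> Zc"
      note fh = ZcE(1)[OF f]
      note fD = mod_homD[OF fh] mod_hom_simps[OF module_free N fh]
      \<comment> \<open>By this the cocycle \<open>f\<close> induces a map on \<open>Z\<close>
        through any section \<open>s\<close> of \<open>d 0\<close>, and the map is linear.\<close>
      have wd: "f y = f y'" if "y \<in> carrier (?F 1)" "y' \<in> carrier (?F 1)" "d 0 y = d 0 y'" for y y'
      proof -
        have dm: "d 0 \<in> mod_hom R (?F 1) (?F 0)" by (rule d[of 0, unfolded S0])
        have "d 0 (y \<ominus>\<^bsub>?F 1\<^esub> y') = \<zero>\<^bsub>?F 0\<^esub>"
          using mod_hom_simps(3)[OF module_free module_free dm that(1,2)] that(3) mod_homD(1)[OF dm that(2)]
          by (simp add: F0.minus_eq F0.r_neg)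
        then have "y \<ominus>\<^bsub>?F 1\<^esub> y' \<in> d 1 ` carrier (?F 2)" using d1 that(1,2) by simp
        then have "f (y \<ominus>\<^bsub>?F 1\<^esub> y') = \<zero>\<^bsub>N\<^esub>" using ZcE(2)[OF f] by auto
        then have "f y \<ominus>\<^bsub>N\<^esub> f y' = \<zero>\<^bsub>N\<^esub>" using fD(6)[OF that(1,2)] by simp
        then show ?thesis using fD(1)[OF that(1)] fD(1)[OF that(2)] by (simp add: N.M.minus_equality N.M.minus_eq N.M.add.inv_solve_right')
      qed
      have "\<forall>z. \<exists>y. z \<in> Z \<longrightarrow> y \<in> carrier (?F 1) \<and> d 0 y = z" using d0 by blast
      then obtain s where s: "\<And>z. z \<in> Z \<Longrightarrow> s z \<in> carrier (?F 1)" "\<And>z. z \<in> Z \<Longrightarrow> d 0 (s z) = z" by metis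
      have "d 0 \<in> mod_hom R (?F 1) (?F 0)" by (rule d[of 0, unfolded S0])
      note dD = mod_homD[OF this]
      note ZD = F0.submoduleD[OF Zs]
      have "(\<lambda>z. f (s z)) \<in> mod_hom R (?F 0\<lparr>carrier := Z\<rparr>) N"
      proof (rule mod_homI)
        fix u v assume "u \<in> carrier (?F 0\<lparr>carrier := Z\<rparr>)" "v \<in> carrier (?F 0\<lparr>carrier := Z\<rparr>)"
        then have u: "u \<in> Z" and v: "v \<in> Z" by simp_all
        have "f (s (u \<oplus>\<^bsub>?F 0\<^esub> v)) = f (s u \<oplus>\<^bsub>?F 1\<^esub> s v)"
          by (rule wd) (use s[OF u] s[OF v] s[OF ZD(3)[OF u v]] dD(2)[OF s(1)[OF u] s(1)[OF v]] in simp_all)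
        then show "f (s (u \<oplus>\<^bsub>?F 0\<lparr>carrier := Z\<rparr>\<^esub> v)) = f (s u) \<oplus>\<^bsub>N\<^esub> f (s v)"
          using fD(2)[OF s(1)[OF u] s(1)[OF v]] by simp
      next
        fix r v assume r: "r \<in> carrier R" and "v \<in> carrier (?F 0\<lparr>carrier := Z\<rparr>)"
        then have v: "v \<in> Z" by simp
        have "f (s (r \<odot>\<^bsub>?F 0\<^esub> v)) = f (r \<odot>\<^bsub>?F 1\<^esub> s v)"
          by (rule wd) (use r s[OF v] s[OF ZD(6)[OF r v]] dD(3)[OF r s(1)[OF v]] in simp_all)
        then show "f (s (r \<odot>\<^bsub>?F 0\<lparr>carrier := Z\<rparr>\<^esub> v)) = r \<odot>\<^bsub>N\<^esub> f (s v)"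
          using fD(3)[OF r s(1)[OF v]] by simp
      qed (use s fD(1) in simp)
      note fs = this
      obtain h where h: "h \<in> mod_hom R (?F 0) N" "\<And>z. z \<in> Z \<Longrightarrow> h z = a \<odot>\<^bsub>N\<^esub> f (s z)"
        by (rule extends_after_smultD[OF ext fs], rule that)
      show "a \<odot>\<^bsub>?C 1\<^esub> f \<in> Bc"
      proof (rule aBI[OF h(1)])
        fix y assume y: "y \<in> carrier (?F 1)"
        have "f (s (d 0 y)) = f y" by (rule wd) (use y s[OF dc[OF y]] in simp_all)
        then show "h (d 0 y) = a \<odot>\<^bsub>N\<^esub> f y" using h(2)[OF dc[OF y]] by simp
      qed
    qed
  qed
  ultimately show ?thesis unfolding Z_def by blast
qed

end

end

text \<open>The identity of \<open>M\<close> lifts to maps \<open>al\<close> and \<open>be\<close>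
  between the two free modules. The multiple by \<open>a\<close> of g after \<open>be\<close>
  extends over the second, and the defect v - be (al v) lies in the kernel of \<open>p\<close>,
  where g itself is defined.\<close>

lemma (in cring) extends_after_smult_presentation:
  assumes M: "module R M" and N: "module R N" and a: "a \<in> carrier R"
    and p: "p \<in> mod_hom R (free_module R n) M" "p ` carrier (free_module R n) = carrier M"
    and q: "q \<in> mod_hom R (free_module R m) M" "q ` carrier (free_module R m) = carrier M"
    and ext: "extends_after_smult R m {x \<in> carrier (free_module R m). q x = \<zero>\<^bsub>M\<^esub>} N a"
  shows "extends_after_smult R n {x \<in> carrier (free_module R n). p x = \<zero>\<^bsub>M\<^esub>} N a"
  unfolding extends_after_smult_def
proof
  let ?F = "free_module R n" and ?G = "free_module R m"
  let ?Z = "{x \<in> carrier ?F. p x = \<zero>\<^bsub>M\<^esub>}" and ?Y = "{x \<in> carrier ?G. q x = \<zero>\<^bsub>M\<^esub>}"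
  interpret M: module R M by fact
  interpret N: module R N by fact
  interpret F: module R ?F by (rule module_free)
  interpret G: module R ?G by (rule module_free)
  have Zs: "submodule ?Z R ?F" by (rule submodule_kernel[OF module_free M p(1)])
  interpret Z: module R "?F\<lparr>carrier := ?Z\<rparr>" by (rule submodule.submodule_is_module[OF Zs module_free])
  note pD = mod_homD[OF p(1)] mod_hom_simps[OF module_free M p(1)]
  note qD = mod_homD[OF q(1)]
  obtain al where al: "al \<in> mod_hom R ?F ?G" "\<And>v. v \<in> carrier ?F \<Longrightarrow> q (al v) = p v"
    by (rule M.free_hom_lift[OF module_free q(1) p(1)]) (use q(2) pD(1) in auto)
  obtain be where be: "be \<in> mod_hom R ?G ?F" "\<And>v. v \<in> carrier ?G \<Longrightarrow> p (be v) = q v"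
    by (rule M.free_hom_lift[OF module_free p(1) q(1)]) (use p(2) qD(1) in auto)
  note alD = mod_homD[OF al(1)] and beD = mod_homD[OF be(1)]
  fix g assume g: "g \<in> mod_hom R (?F\<lparr>carrier := ?Z\<rparr>) N"
  note gD = mod_homD[OF g, simplified]
  have "be \<in> mod_hom R (?G\<lparr>carrier := ?Y\<rparr>) (?F\<lparr>carrier := ?Z\<rparr>)"
    by (rule mod_homI) (simp_all add: beD be(2))
  note g_be = mod_hom_comp[OF this g]
  obtain h where h: "h \<in> mod_hom R ?G N" "\<And>y. y \<in> ?Y \<Longrightarrow> h y = a \<odot>\<^bsub>N\<^esub> g (be y)"
    by (rule extends_after_smultD[OF ext g_be], rule that)
  define de where "de v = v \<ominus>\<^bsub>?F\<^esub> be (al v)" for v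
  have deZ: "de v \<in> ?Z" if v: "v \<in> carrier ?F" for v
  proof -
    have b: "be (al v) \<in> carrier ?F" using alD(1)[OF v] beD(1) by blast
    have "p (de v) = p v \<ominus>\<^bsub>M\<^esub> p v"
      unfolding de_def pD(6)[OF v b] using al(2)[OF v] be(2)[OF alD(1)[OF v]] by simp
    then show ?thesis using v b pD(1)[OF v] by (simp add: de_def M.minus_eq M.r_neg)
  qed
  have "de \<in> mod_hom R ?F (?F\<lparr>carrier := ?Z\<rparr>)"
  proof (rule mod_homI)
    fix x assume "x \<in> carrier ?F"
    then show "de x \<in> carrier (?F\<lparr>carrier := ?Z\<rparr>)" using deZ by simp
  next
    fix u v assume "u \<in> carrier ?F" "v \<in> carrier ?F"
    then show "de (u \<oplus>\<^bsub>?F\<^esub> v) = de u \<oplus>\<^bsub>?F\<lparr>carrier := ?Z\<rparr>\<^esub> de v"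
      by (simp add: de_def alD beD F.minus_add_distrib4)
  next
    fix r v assume "r \<in> carrier R" "v \<in> carrier ?F"
    then show "de (r \<odot>\<^bsub>?F\<^esub> v) = r \<odot>\<^bsub>?F\<lparr>carrier := ?Z\<rparr>\<^esub> de v"
      by (simp add: de_def alD beD F.smult_minus_distr)
  qed
  from mod_hom_comp[OF mod_hom_comp[OF this g] N.smult_mod_hom[OF a]]
  have gde: "(\<lambda>v. a \<odot>\<^bsub>N\<^esub> g (de v)) \<in> mod_hom R ?F N" .
  \<comment> \<open>On the kernel of \<open>p\<close> one has z = de z + be (al z) with both terms
    in the kernel, so the two summands add up to a g(z).\<close>
  have H: "(\<lambda>v. a \<odot>\<^bsub>N\<^esub> g (de v) \<oplus>\<^bsub>N\<^esub> h (al v)) \<in> mod_hom R ?F N"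
    by (rule mod_hom_add[OF module_free N gde mod_hom_comp[OF al(1) h(1)]])
  show "\<exists>h\<in>mod_hom R ?F N. \<forall>z\<in>?Z. h z = a \<odot>\<^bsub>N\<^esub> g z"
  proof (intro bexI[OF _ H] ballI)
    fix z assume z: "z \<in> ?Z"
    then have zF: "z \<in> carrier ?F" by simp
    have alz: "al z \<in> ?Y" using z al(2)[OF zF] alD(1)[OF zF] by simp
    have b: "be (al z) \<in> ?Z" using alz be(2) beD(1) by simp
    have "z = de z \<oplus>\<^bsub>?F\<^esub> be (al z)" using zF b by (simp add: de_def F.minus_eq F.a_assoc F.l_neg)
    then have "g z = g (de z) \<oplus>\<^bsub>N\<^esub> g (be (al z))"
      using mod_homD(2)[OF g, of "de z" "be (al z)"] deZ[OF zF] b by simp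
    moreover have "g (de z) \<in> carrier N" "g (be (al z)) \<in> carrier N"
      using mod_homD(1)[OF g] deZ[OF zF] b by simp_all
    ultimately show "a \<odot>\<^bsub>N\<^esub> g (de z) \<oplus>\<^bsub>N\<^esub> h (al z) = a \<odot>\<^bsub>N\<^esub> g z"
      using h(2)[OF alz] a by (simp add: N.smult_r_distr)
  qed
qed

text \<open>The resolution hidden in \<open>Ext\<close> is replaced by the presentation
  \<open>p\<close> at hand: the extension criterion sees only the augmentation, and it does not
  depend on the presentation.\<close>

lemma (in cring) annihilator_Ext_iff:
  assumes noeth: "noetherian_ring R" and M: "module R M" and fg: "finitely_generated R M" and N: "module R N"
    and p: "p \<in> mod_hom R (free_module R n) M" "p ` carrier (free_module R n) = carrier M"
  shows "a \<in> annihilator R (Ext R 1 M N) \<longleftrightarrow>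
    a \<in> carrier R \<and> extends_after_smult R n {x \<in> carrier (free_module R n). p x = \<zero>\<^bsub>M\<^esub>} N a"
proof -
  define F where "F = (SOME F. \<exists>\<epsilon>. free_resolution R M (fst F) (snd F) \<epsilon>)"
  have "\<exists>\<epsilon>. free_resolution R M (fst F) (snd F) \<epsilon>"
    unfolding F_def using someI_ex[OF exists_free_resolution[OF noeth M fg]] .
  then obtain \<epsilon> where res: "free_resolution R M (fst F) (snd F) \<epsilon>" by blast
  then have e: "\<epsilon> \<in> mod_hom R (free_module R (fst F 0)) M" "\<epsilon> ` carrier (free_module R (fst F 0)) = carrier M"
    by (simp_all add: free_resolution_def)
  have "Ext R 1 M N = Hom_cohomology R (fst F) (snd F) N 1"
    by (simp add: Ext_def F_def Let_def)
  then show ?thesis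
    using annihilator_cohomology_iff[OF N res M, of a]
      extends_after_smult_presentation[OF M N _ p e, of a] extends_after_smult_presentation[OF M N _ e p, of a]
    by (simp only:) blast
qed

lemma (in cring) zero_coset: "a \<in> carrier R \<Longrightarrow> {\<zero>} +> a = {a}"
  by (auto simp: a_r_coset_def')

text \<open>Cosets of the zero ideal are singletons, so linearity modulo \<open>{\<zero>}\<close> is
  linearity. \<open>N\<close> is a copy of R, because the member of the list that is isomorphic to R
  lives on another carrier type.\<close>

lemma (in cring) extends_after_smult_iff_kills_ext:
  assumes N: "module R N" and th: "\<theta> \<in> mod_hom R (regular_module R) N" "bij_betw \<theta> (carrier R) (carrier N)"
    and Y: "submodule Y R (free_module R n)" and a: "a \<in> carrier R"
  shows "extends_after_smult R n Y N a \<longleftrightarrow> kills_ext R {\<zero>} n Y a"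
proof -
  let ?F = "free_module R n"
  interpret F: module R ?F by (rule module_free)
  interpret N: module R N by fact
  interpret Y: module R "?F\<lparr>carrier := Y\<rparr>" by (rule submodule.submodule_is_module[OF Y module_free])
  note YD = F.submoduleD[OF Y]
  note thD = mod_homD[OF th(1), simplified]
  define \<psi> where "\<psi> = the_inv_into (carrier R) \<theta>"
  have inj: "inj_on \<theta> (carrier R)" and surj: "\<theta> ` carrier R = carrier N" using th(2) by (auto simp: bij_betw_def)
  have ps: "\<psi> (\<theta> r) = r" if "r \<in> carrier R" for r unfolding \<psi>_def by (rule the_inv_into_f_f[OF inj that])
  have psc: "\<psi> x \<in> carrier R" "\<theta> (\<psi> x) = x" if "x \<in> carrier N" for x
  proof -
    from that surj obtain r where "r \<in> carrier R" "x = \<theta> r" by (metis imageE)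
    then show "\<psi> x \<in> carrier R" "\<theta> (\<psi> x) = x" using ps by simp_all
  qed
  have psi: "\<psi> \<in> mod_hom R N (regular_module R)"
  proof (rule mod_homI)
    fix x y assume x: "x \<in> carrier N" and y: "y \<in> carrier N"
    have "\<psi> (\<theta> (\<psi> x \<oplus> \<psi> y)) = \<psi> x \<oplus> \<psi> y" by (rule ps) (use psc x y in simp)
    then show "\<psi> (x \<oplus>\<^bsub>N\<^esub> y) = \<psi> x \<oplus>\<^bsub>regular_module R\<^esub> \<psi> y" using psc[OF x] psc[OF y] thD(2) by simp
  next
    fix r x assume r: "r \<in> carrier R" and x: "x \<in> carrier N"
    have "\<psi> (\<theta> (r \<otimes> \<psi> x)) = r \<otimes> \<psi> x" by (rule ps) (use psc x r in simp)
    then show "\<psi> (r \<odot>\<^bsub>N\<^esub> x) = r \<odot>\<^bsub>regular_module R\<^esub> \<psi> x" using psc[OF x] thD(3)[OF r] by simp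
  qed (use psc in simp)
  have lin: "linear_mod R {\<zero>} ?F Y g \<longleftrightarrow> g \<in> mod_hom R (?F\<lparr>carrier := Y\<rparr>) (regular_module R)" for g
  proof
    assume g: "linear_mod R {\<zero>} ?F Y g"
    note gD = linear_modD[OF g]
    show "g \<in> mod_hom R (?F\<lparr>carrier := Y\<rparr>) (regular_module R)"
    proof (rule mod_homI)
      fix u v assume "u \<in> carrier (?F\<lparr>carrier := Y\<rparr>)" "v \<in> carrier (?F\<lparr>carrier := Y\<rparr>)"
      then have uv: "u \<in> Y" "v \<in> Y" by simp_all
      show "g (u \<oplus>\<^bsub>?F\<lparr>carrier := Y\<rparr>\<^esub> v) = g u \<oplus>\<^bsub>regular_module R\<^esub> g v"
        using gD(2)[OF uv] gD(1)[OF uv(1)] gD(1)[OF uv(2)] gD(1)[OF YD(3)[OF uv]] by (simp add: zero_coset)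
    next
      fix r v assume r: "r \<in> carrier R" and "v \<in> carrier (?F\<lparr>carrier := Y\<rparr>)"
      then have v: "v \<in> Y" by simp
      show "g (r \<odot>\<^bsub>?F\<lparr>carrier := Y\<rparr>\<^esub> v) = r \<odot>\<^bsub>regular_module R\<^esub> g v"
        using gD(3)[OF r v] gD(1)[OF v] gD(1)[OF YD(6)[OF r v]] r by (simp add: zero_coset)
    qed (use gD(1) in simp)
  next
    assume g: "g \<in> mod_hom R (?F\<lparr>carrier := Y\<rparr>) (regular_module R)"
    show "linear_mod R {\<zero>} ?F Y g"
      by (rule linear_modI) (use mod_homD[OF g] in simp_all)
  qed
  have zero: "g v \<in> {\<zero>}" if g: "g \<in> mod_hom R (?F\<lparr>carrier := Y\<rparr>) (regular_module R)" and v: "v \<in> {..<n} \<rightarrow>\<^sub>E {\<zero>}" for g v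
  proof -
    have v0: "v = \<zero>\<^bsub>?F\<^esub>" using v by (auto simp: free_module_simps fun_eq_iff PiE_iff extensional_def)
    show ?thesis unfolding v0 using mod_hom_simps(1)[OF Y.module_axioms module_regular g] by simp
  qed
  show ?thesis
  proof
    assume ext: "extends_after_smult R n Y N a"
    show "kills_ext R {\<zero>} n Y a" unfolding kills_ext_def
    proof (intro allI impI)
      fix g assume "linear_mod R {\<zero>} ?F Y g \<and> (\<forall>v \<in> {..<n} \<rightarrow>\<^sub>E {\<zero>}. g v \<in> {\<zero>})"
      then have g: "g \<in> mod_hom R (?F\<lparr>carrier := Y\<rparr>) (regular_module R)" by (simp add: lin)
      obtain h where h: "h \<in> mod_hom R ?F N" "\<And>z. z \<in> Y \<Longrightarrow> h z = a \<odot>\<^bsub>N\<^esub> \<theta> (g z)"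
        by (rule extends_after_smultD[OF ext mod_hom_comp[OF g th(1)]], rule that)
      show "\<exists>h\<in>mod_hom R ?F (regular_module R). \<forall>v\<in>Y. {\<zero>} +> (a \<otimes> g v) = {\<zero>} +> h v"
      proof (intro bexI[OF _ mod_hom_comp[OF h(1) psi]] ballI)
        fix v assume v: "v \<in> Y"
        have gv: "g v \<in> carrier R" using mod_homD(1)[OF g] v by simp
        have "h v = \<theta> (a \<otimes> g v)" using h(2)[OF v] thD(3)[OF a gv] by simp
        then show "{\<zero>} +> (a \<otimes> g v) = {\<zero>} +> \<psi> (h v)" using ps gv a by simp
      qed
    qed
  next
    assume kill: "kills_ext R {\<zero>} n Y a"
    show "extends_after_smult R n Y N a" unfolding extends_after_smult_def
    proof
      fix g assume "g \<in> mod_hom R (?F\<lparr>carrier := Y\<rparr>) N"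
      then have g: "(\<lambda>z. \<psi> (g z)) \<in> mod_hom R (?F\<lparr>carrier := Y\<rparr>) (regular_module R)" and gN: "\<And>z. z \<in> Y \<Longrightarrow> g z \<in> carrier N"
        using mod_hom_comp[OF _ psi] mod_homD(1) by (blast, fastforce)
      obtain h where h: "h \<in> mod_hom R ?F (regular_module R)" "\<And>v. v \<in> Y \<Longrightarrow> {\<zero>} +> (a \<otimes> \<psi> (g v)) = {\<zero>} +> h v"
        using kills_extD[OF kill, of "\<lambda>z. \<psi> (g z)"] g zero[OF g] lin by metis
      show "\<exists>h\<in>mod_hom R ?F N. \<forall>z\<in>Y. h z = a \<odot>\<^bsub>N\<^esub> g z"
      proof (intro bexI[OF _ mod_hom_comp[OF h(1) th(1)]] ballI)
        fix z assume z: "z \<in> Y"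
        note c = psc[OF gN[OF z]] module_hom_regularD(1)[OF h(1) YD(1)[OF z]]
        have "a \<otimes> \<psi> (g z) = h z" using h(2)[OF z] zero_coset[OF c(3)] zero_coset[of "a \<otimes> \<psi> (g z)"] c(1) a by simp
        then show "\<theta> (h z) = a \<odot>\<^bsub>N\<^esub> g z" using thD(3)[OF a c(1)] c(2) by simp
      qed
    qed
  qed
qed

subsection \<open>Direct sum decompositions\<close>

text \<open>The unit vectors are decomposed and the choices extended linearly. As \<open>A\<close>
  and \<open>B\<close> may intersect, \<open>P\<close> and \<open>Q\<close> become projections only
  modulo A \<inter> B.\<close>

lemma (in cring) decomposition_projections:
  assumes A: "submodule A R (free_module R n)" and B: "submodule B R (free_module R n)"
    and sum: "\<And>v. v \<in> carrier (free_module R n) \<Longrightarrow> \<exists>a\<in>A. \<exists>b\<in>B. v = a \<oplus>\<^bsub>free_module R n\<^esub> b"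
  obtains P Q where "P \<in> mod_hom R (free_module R n) (free_module R n)"
    "Q \<in> mod_hom R (free_module R n) (free_module R n)"
    "\<And>v. v \<in> carrier (free_module R n) \<Longrightarrow> P v \<in> A"
    "\<And>v. v \<in> carrier (free_module R n) \<Longrightarrow> Q v \<in> B"
    "\<And>v. v \<in> carrier (free_module R n) \<Longrightarrow> v = P v \<oplus>\<^bsub>free_module R n\<^esub> Q v"
proof -
  let ?F = "free_module R n"
  interpret F: module R ?F by (rule module_free)
  note AD = F.submoduleD[OF A] and BD = F.submoduleD[OF B]
  have "\<forall>i. \<exists>a b. a \<in> A \<and> b \<in> B \<and> unit_vector R n i = a \<oplus>\<^bsub>?F\<^esub> b" using sum[OF unit_vector_closed] by blast
  then obtain a b where ab: "\<And>i. a i \<in> A" "\<And>i. b i \<in> B" "\<And>i. unit_vector R n i = a i \<oplus>\<^bsub>?F\<^esub> b i" by metis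
  obtain P where P: "P \<in> mod_hom R ?F ?F" "\<And>i. i < n \<Longrightarrow> P (unit_vector R n i) = a i"
    using F.free_hom_exists[of n a, OF AD(1)[OF ab(1)]] by blast
  obtain Q where Q: "Q \<in> mod_hom R ?F ?F" "\<And>i. i < n \<Longrightarrow> Q (unit_vector R n i) = b i"
    using F.free_hom_exists[of n b, OF BD(1)[OF ab(2)]] by blast
  have PA: "P v \<in> A" if v: "v \<in> carrier ?F" for v
    using free_module_induct[OF submodule_vimage[OF module_free module_free P(1) A] _ v] P(2) ab(1) by simp
  have QB: "Q v \<in> B" if v: "v \<in> carrier ?F" for v
    using free_module_induct[OF submodule_vimage[OF module_free module_free Q(1) B] _ v] Q(2) ab(2) by simp
  have "(\<lambda>v. v) \<in> mod_hom R ?F ?F" by (rule mod_homI) simp_all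
  then have "v = P v \<oplus>\<^bsub>?F\<^esub> Q v" if v: "v \<in> carrier ?F" for v
    by (rule F.free_hom_eqI[OF _ mod_hom_add[OF module_free module_free P(1) Q(1)] _ v]) (metis P(2) Q(2) ab(3))
  with P(1) Q(1) PA QB show ?thesis by (rule that)
qed

text \<open>An extension \<open>h\<close> of x g from \<open>Y\<close> is corrected on the image of
  \<open>P\<close>: for v in \<open>A\<close> the difference h(v) - h(P v) is x g(Q v), because Q v
  lies in \<open>Y\<close>, and adding x g(P v) gives x g(v). In the application R^n/A is a direct
  summand of R^n/Y.\<close>

lemma (in cring) extends_after_smult_summand:
  assumes N: "module R N" and A: "submodule A R (free_module R n)" and Y: "submodule Y R (free_module R n)" "Y \<subseteq> A"
    and P: "P \<in> mod_hom R (free_module R n) (free_module R n)" "\<And>v. v \<in> carrier (free_module R n) \<Longrightarrow> P v \<in> A"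
    and Q: "\<And>v. v \<in> A \<Longrightarrow> Q v \<in> Y" "\<And>v. v \<in> carrier (free_module R n) \<Longrightarrow> v = P v \<oplus>\<^bsub>free_module R n\<^esub> Q v"
    and x: "x \<in> carrier R" and ext: "extends_after_smult R n Y N x"
  shows "extends_after_smult R n A N x"
  unfolding extends_after_smult_def
proof
  let ?F = "free_module R n"
  interpret F: module R ?F by (rule module_free)
  interpret N: module R N by fact
  note AD = F.submoduleD[OF A] and YD = F.submoduleD[OF Y(1)]
  fix g assume g: "g \<in> mod_hom R (?F\<lparr>carrier := A\<rparr>) N"
  note gD = mod_homD[OF g, simplified]
  have gY: "g \<in> mod_hom R (?F\<lparr>carrier := Y\<rparr>) N" by (rule mod_homI) (use gD subsetD[OF Y(2)] in simp_all)
  obtain h where h: "h \<in> mod_hom R ?F N" "\<And>z. z \<in> Y \<Longrightarrow> h z = x \<odot>\<^bsub>N\<^esub> g z"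
    by (rule extends_after_smultD[OF ext gY], rule that)
  note hD = mod_homD[OF h(1)]
  have "P \<in> mod_hom R ?F (?F\<lparr>carrier := A\<rparr>)" by (rule mod_homI) (use mod_homD[OF P(1)] P(2) in simp_all)
  from mod_hom_comp[OF mod_hom_comp[OF this g] N.smult_mod_hom[OF x]]
  have 1: "(\<lambda>v. x \<odot>\<^bsub>N\<^esub> g (P v)) \<in> mod_hom R ?F N" .
  have 2: "(\<lambda>v. \<ominus>\<^bsub>N\<^esub> h (P v)) \<in> mod_hom R ?F N"
    by (rule mod_hom_comp[OF mod_hom_comp[OF P(1) h(1)] N.uminus_mod_hom])
  have H: "(\<lambda>v. h v \<oplus>\<^bsub>N\<^esub> (x \<odot>\<^bsub>N\<^esub> g (P v) \<oplus>\<^bsub>N\<^esub> \<ominus>\<^bsub>N\<^esub> h (P v))) \<in> mod_hom R ?F N"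
    by (rule mod_hom_add[OF module_free N h(1) mod_hom_add[OF module_free N 1 2]])
  show "\<exists>h\<in>mod_hom R ?F N. \<forall>z\<in>A. h z = x \<odot>\<^bsub>N\<^esub> g z"
  proof (intro bexI[OF _ H] ballI)
    fix v assume v: "v \<in> A"
    have vF: "v \<in> carrier ?F" by (rule AD(1)[OF v])
    have Pv: "P v \<in> A" "P v \<in> carrier ?F" using P(2)[OF vF] AD(1) by blast+
    have Qv: "Q v \<in> Y" "Q v \<in> A" "Q v \<in> carrier ?F" using Q(1)[OF v] Y(2) YD(1) by blast+
    have "h v = h (P v \<oplus>\<^bsub>?F\<^esub> Q v)" using Q(2)[OF vF] by simp
    also have "\<dots> = h (P v) \<oplus>\<^bsub>N\<^esub> x \<odot>\<^bsub>N\<^esub> g (Q v)" using hD(2)[OF Pv(2) Qv(3)] h(2)[OF Qv(1)] by simp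
    finally have hv: "h v = h (P v) \<oplus>\<^bsub>N\<^esub> x \<odot>\<^bsub>N\<^esub> g (Q v)" .
    have gv: "g v = g (P v) \<oplus>\<^bsub>N\<^esub> g (Q v)" using gD(2)[OF Pv(1) Qv(2)] Q(2)[OF vF] by simp
    have c: "h (P v) \<in> carrier N" "g (P v) \<in> carrier N" "g (Q v) \<in> carrier N"
      using hD(1)[OF Pv(2)] gD(1)[OF Pv(1)] gD(1)[OF Qv(2)] .
    show "h v \<oplus>\<^bsub>N\<^esub> (x \<odot>\<^bsub>N\<^esub> g (P v) \<oplus>\<^bsub>N\<^esub> \<ominus>\<^bsub>N\<^esub> h (P v)) = x \<odot>\<^bsub>N\<^esub> g v"
      unfolding hv gv N.smult_r_distr[OF x c(2,3)]
      using c x by (simp add: N.M.a_assoc N.M.r_neg2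
          N.M.a_comm[of "x \<odot>\<^bsub>N\<^esub> g (Q v)"] N.M.a_lcomm[of "h (P v)" "x \<odot>\<^bsub>N\<^esub> g (P v)"] N.M.r_neg N.M.r_neg1)
  qed
qed

text \<open>Additivity of Ext in the first argument: g after \<open>Q\<close> is defined on
  \<open>A\<close>, g after \<open>P\<close> on \<open>B\<close>, and on \<open>Y\<close> the two
  add up to g. The extensions of their multiples by \<open>x\<close> are added.\<close>

lemma (in cring) extends_after_smult_direct_sum:
  assumes N: "module R N" and A: "submodule A R (free_module R n)" and B: "submodule B R (free_module R n)"
    and Y: "submodule Y R (free_module R n)" "Y \<subseteq> A" "Y \<subseteq> B"
    and P: "P \<in> mod_hom R (free_module R n) (free_module R n)" "\<And>v. v \<in> B \<Longrightarrow> P v \<in> Y"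
    and Q: "Q \<in> mod_hom R (free_module R n) (free_module R n)" "\<And>v. v \<in> A \<Longrightarrow> Q v \<in> Y"
    and PQ: "\<And>v. v \<in> carrier (free_module R n) \<Longrightarrow> v = P v \<oplus>\<^bsub>free_module R n\<^esub> Q v"
    and x: "x \<in> carrier R" and ext: "extends_after_smult R n A N x" "extends_after_smult R n B N x"
  shows "extends_after_smult R n Y N x"
  unfolding extends_after_smult_def
proof
  let ?F = "free_module R n"
  interpret F: module R ?F by (rule module_free)
  interpret N: module R N by fact
  note AD = F.submoduleD[OF A] and BD = F.submoduleD[OF B] and YD = F.submoduleD[OF Y(1)]
  fix g assume g: "g \<in> mod_hom R (?F\<lparr>carrier := Y\<rparr>) N"
  note gD = mod_homD[OF g, simplified]
  have "Q \<in> mod_hom R (?F\<lparr>carrier := A\<rparr>) (?F\<lparr>carrier := Y\<rparr>)"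
    by (rule mod_homI) (use mod_homD[OF Q(1)] Q(2) AD(1) in simp_all)
  note gQ = mod_hom_comp[OF this g]
  have "P \<in> mod_hom R (?F\<lparr>carrier := B\<rparr>) (?F\<lparr>carrier := Y\<rparr>)"
    by (rule mod_homI) (use mod_homD[OF P(1)] P(2) BD(1) in simp_all)
  note gP = mod_hom_comp[OF this g]
  obtain h where h: "h \<in> mod_hom R ?F N" "\<And>z. z \<in> A \<Longrightarrow> h z = x \<odot>\<^bsub>N\<^esub> g (Q z)"
    by (rule extends_after_smultD[OF ext(1) gQ], rule that)
  obtain k where k: "k \<in> mod_hom R ?F N" "\<And>z. z \<in> B \<Longrightarrow> k z = x \<odot>\<^bsub>N\<^esub> g (P z)"
    by (rule extends_after_smultD[OF ext(2) gP], rule that)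
  show "\<exists>h\<in>mod_hom R ?F N. \<forall>z\<in>Y. h z = x \<odot>\<^bsub>N\<^esub> g z"
  proof (intro bexI[OF _ mod_hom_add[OF module_free N k(1) h(1)]] ballI)
    fix v assume v: "v \<in> Y"
    have vA: "v \<in> A" and vB: "v \<in> B" using v Y by blast+
    have c: "P v \<in> Y" "Q v \<in> Y" using P(2)[OF vB] Q(2)[OF vA] .
    have "g v = g (P v) \<oplus>\<^bsub>N\<^esub> g (Q v)" using gD(2)[OF c] PQ[OF YD(1)[OF v]] by simp
    then show "k v \<oplus>\<^bsub>N\<^esub> h v = x \<odot>\<^bsub>N\<^esub> g v"
      using h(2)[OF vA] k(2)[OF vB] gD(1)[OF c(1)] gD(1)[OF c(2)] x by (simp add: N.smult_r_distr)
  qed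
qed

subsection \<open>Systems of parameters\<close>

lemma (in cring) ideal_elem_dot_product:
  assumes "set xs \<subseteq> carrier R" "a \<in> Idl (set xs)"
  obtains rs where "set rs \<subseteq> carrier R" "length rs = length xs" "a = dot_product R rs xs"
proof -
  have "\<exists>rs. set rs \<subseteq> carrier R \<and> length rs = length xs \<and> a = dot_product R rs xs"
    if "set xs \<subseteq> carrier R" "a \<in> koszul_span (regular_module R) xs {\<zero>}" for xs a
    using that
  proof (induction xs arbitrary: a)
    case (Cons x xs)
    then obtain w where w: "a \<in> carrier R" "w \<in> carrier R" "a \<ominus> x \<otimes> w \<in> koszul_span (regular_module R) xs {\<zero>}" by auto
    from Cons.IH[OF _ w(3)] Cons.prems(1) obtain rs where rs: "set rs \<subseteq> carrier R" "length rs = length xs"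
      "a \<ominus> x \<otimes> w = dot_product R rs xs" by auto
    have x: "x \<in> carrier R" using Cons.prems by simp
    have "dot_product R (w # rs) (x # xs) = w \<otimes> x \<oplus> (a \<ominus> x \<otimes> w)" using rs(3) by simp
    also have "\<dots> = a" using w x by (simp add: minus_eq a_ac m_comm r_neg r_neg1 r_neg2)
    finally show ?case using rs w by (intro exI[of _ "w # rs"]) simp
  qed simp
  from this[OF assms(1)] show ?thesis using that assms koszul_span_regular[OF assms(1)] by blast
qed

lemma (in cring) genideal_take_Suc:
  assumes xs: "set xs \<subseteq> carrier R" and k: "k < length xs"
  shows "Idl (set (take (Suc k) xs)) = {a \<in> carrier R. \<exists>r \<in> carrier R. a \<ominus> (xs ! k) \<otimes> r \<in> Idl (set (take k xs))}"
proof -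
  interpret M: module R "regular_module R" by (rule module_regular)
  have Z: "submodule {\<zero>} R (regular_module R)" using M.zero_submodule by simp
  have t: "set (take j xs) \<subseteq> carrier R" for j using xs set_take_subset[of j xs] by blast
  have s: "set (take (Suc k) xs) = set (xs ! k # take k xs)" using take_Suc_conv_app_nth[OF k] by simp
  have c: "set (xs ! k # take k xs) \<subseteq> carrier R" using t[of "Suc k"] s by simp
  have "Idl (set (take (Suc k) xs)) = Idl (set (xs ! k # take k xs))" unfolding s ..
  also have "\<dots> = koszul_span (regular_module R) (xs ! k # take k xs) {\<zero>}" by (rule koszul_span_regular[OF c, symmetric])
  also have "\<dots> = {a \<in> carrier R. \<exists>r \<in> carrier R. a \<ominus> (xs ! k) \<otimes> r \<in> Idl (set (take k xs))}"
    using koszul_span_regular[OF t] by simp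
  finally show ?thesis .
qed

text \<open>Descending induction on \<open>k\<close>, each step being the long exact sequence for
  multiplication by \<open>zs ! k\<close> modulo the first \<open>k\<close> entries of
  \<open>zs\<close>. Only \<open>pow\<close> and the common length tie \<open>ws\<close> to the
  regular sequence \<open>zs\<close>; at \<open>k = 0\<close> the regularity of \<open>zs\<close>
  has turned into acyclicity for \<open>ws\<close>.\<close>

lemma (in cring) koszul_acyclic_parameters:
  assumes ws: "set ws \<subseteq> carrier R" and zs: "set zs \<subseteq> carrier R" "length zs = length ws"
    and reg: "\<And>k r. k < length zs \<Longrightarrow> r \<in> carrier R \<Longrightarrow> zs ! k \<otimes> r \<in> Idl (set (take k zs)) \<Longrightarrow> r \<in> Idl (set (take k zs))"
    and pow: "\<And>z. z \<in> set zs \<Longrightarrow> \<exists>N::nat. z [^] N \<in> Idl (set ws)"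
    and "k \<le> length zs"
  shows "koszul_acyclic_above (free_module R n) ws k ({..<n} \<rightarrow>\<^sub>E Idl (set (take k zs)))"
  using \<open>k \<le> length zs\<close>
proof (induction rule: inc_induct)
  interpret F: module R "free_module R n" by (rule module_free)
  have t: "set (take k zs) \<subseteq> carrier R" for k using zs(1) set_take_subset[of k zs] by blast
  have sub: "submodule ({..<n} \<rightarrow>\<^sub>E Idl (set (take k zs))) R (free_module R n)" for k
    by (rule submodule_power_ideal[OF genideal_ideal[OF t]])
  {
    case base
    show ?case unfolding zs(2) by (rule F.koszul_acyclic_above_length[OF ws]) (rule sub)
  next
    case (step k)
    let ?z = "zs ! k" let ?A = "Idl (set (take k zs))"
    have z: "?z \<in> carrier R" "?z \<in> set zs" using zs step.hyps by auto
    obtain N where N: "?z [^] (N::nat) \<in> Idl (set ws)" using pow[OF z(2)] by blast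
    obtain rs where rs: "set rs \<subseteq> carrier R" "length rs = length ws" "?z [^] N = dot_product R rs ws"
      by (rule ideal_elem_dot_product[OF ws N])
    show ?case
    proof (rule F.koszul_acyclic_step[OF ws rs(1,2) sub z(1) rs(3) _ refl])
      fix v assume v: "v \<in> carrier (free_module R n)" and zv: "?z \<odot>\<^bsub>free_module R n\<^esub> v \<in> {..<n} \<rightarrow>\<^sub>E ?A"
      have "v i \<in> ?A" if i: "i < n" for i
      proof (rule reg[OF step.hyps(2)])
        show "v i \<in> carrier R" using v i by (auto simp: free_module_simps)
        show "?z \<otimes> v i \<in> ?A" using PiE_mem[OF zv, of i] i by (simp add: free_module_simps)
      qed
      then show "v \<in> {..<n} \<rightarrow>\<^sub>E ?A" using v by (auto simp: free_module_simps PiE_iff)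
    next
      have "{..<n} \<rightarrow>\<^sub>E Idl (set (take (Suc k) zs)) =
        {v \<in> carrier (free_module R n). \<exists>w\<in>carrier (free_module R n). v \<ominus>\<^bsub>free_module R n\<^esub> ?z \<odot>\<^bsub>free_module R n\<^esub> w \<in> {..<n} \<rightarrow>\<^sub>E ?A}"
        (is "?L = ?S")
      proof (intro equalityI subsetI)
        fix v assume v: "v \<in> ?L"
        then have vF: "v \<in> carrier (free_module R n)" using F.submoduleD(1)[OF sub] by blast
        have "\<exists>r. i < n \<longrightarrow> r \<in> carrier R \<and> v i \<ominus> ?z \<otimes> r \<in> ?A" for i
          using PiE_mem[OF v, of i] unfolding genideal_take_Suc[OF zs(1) step.hyps(2)] by auto
        then obtain f where f: "\<And>i. i < n \<Longrightarrow> f i \<in> carrier R" "\<And>i. i < n \<Longrightarrow> v i \<ominus> ?z \<otimes> f i \<in> ?A" by metis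
        have fF: "restrict f {..<n} \<in> carrier (free_module R n)" using f(1) by (simp add: free_module_simps)
        have "v \<ominus>\<^bsub>free_module R n\<^esub> ?z \<odot>\<^bsub>free_module R n\<^esub> restrict f {..<n} \<in> {..<n} \<rightarrow>\<^sub>E ?A"
          unfolding free_a_minus[OF vF F.smult_closed[OF z(1) fF]] using f(2) by (simp add: free_module_simps)
        then show "v \<in> ?S" using vF fF by blast
      next
        fix v assume "v \<in> ?S"
        then obtain w where v: "v \<in> carrier (free_module R n)" and w: "w \<in> carrier (free_module R n)"
          and vw: "v \<ominus>\<^bsub>free_module R n\<^esub> ?z \<odot>\<^bsub>free_module R n\<^esub> w \<in> {..<n} \<rightarrow>\<^sub>E ?A" by blast
        have "v i \<in> Idl (set (take (Suc k) zs))" if i: "i < n" for i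
        proof -
          have "v i \<ominus> ?z \<otimes> w i \<in> ?A"
            using PiE_mem[OF vw, of i] i unfolding free_a_minus[OF v F.smult_closed[OF z(1) w]] by (simp add: free_module_simps)
          moreover have "v i \<in> carrier R" "w i \<in> carrier R" using v w i by (auto simp: free_module_simps)
          ultimately show ?thesis unfolding genideal_take_Suc[OF zs(1) step.hyps(2)] by blast
        qed
        then show "v \<in> ?L" using v by (auto simp: free_module_simps PiE_iff)
      qed
      then show "koszul_acyclic_above (free_module R n) ws (Suc k) ?S" using step.IH by simp
    qed
  }
qed

text \<open>Descending induction on \<open>k\<close>. At \<open>k = length xs\<close> the acyclicity
  is automatic; each step takes a syzygy over the quotient by the first \<open>k\<close> entries,
  which lowers the bound on the degree by one and leaves \<open>kills_ext\<close> unchanged. At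
  \<open>k = 0\<close> the module R^m/Z has full depth over R.\<close>

lemma (in cring) syzygy_ladder:
  assumes noeth: "noetherian_ring R" and xs: "set xs \<subseteq> carrier R"
    and reg: "\<And>k r. k < length xs \<Longrightarrow> r \<in> carrier R \<Longrightarrow> xs ! k \<otimes> r \<in> Idl (set (take k xs)) \<Longrightarrow> r \<in> Idl (set (take k xs))"
    and Y: "submodule Y R (free_module R n)" "{..<n} \<rightarrow>\<^sub>E Idl (set xs) \<subseteq> Y"
    and "k \<le> length xs"
  shows "\<exists>m Z. submodule Z R (free_module R m) \<and> {..<m} \<rightarrow>\<^sub>E Idl (set (take k xs)) \<subseteq> Z \<and>
    koszul_acyclic_above (free_module R m) (rev xs) k Z \<and>
    (\<forall>t\<in>carrier R. kills_ext R (Idl (set xs)) n Y t \<longleftrightarrow> kills_ext R (Idl (set (take k xs))) m Z t)"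
  using \<open>k \<le> length xs\<close>
proof (induction rule: inc_induct)
  case base
  interpret F: module R "free_module R n" by (rule module_free)
  have "koszul_acyclic_above (free_module R n) (rev xs) (length xs) Y"
    using F.koszul_acyclic_above_length[of "rev xs" Y] xs Y(1) by simp
  with Y show ?case by (intro exI[of _ n] exI[of _ Y]) simp
next
  case (step k)
  let ?A = "Idl (set (take k xs))" and ?A' = "Idl (set (take (Suc k) xs))"
  obtain m Z where Z: "submodule Z R (free_module R m)" "{..<m} \<rightarrow>\<^sub>E ?A' \<subseteq> Z"
    "koszul_acyclic_above (free_module R m) (rev xs) (Suc k) Z"
    "\<forall>t\<in>carrier R. kills_ext R (Idl (set xs)) n Y t \<longleftrightarrow> kills_ext R ?A' m Z t"
    using step.IH by blast
  interpret F: module R "free_module R m" by (rule module_free)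
  have t: "set (take j xs) \<subseteq> carrier R" for j using xs set_take_subset[of j xs] by blast
  have A: "ideal ?A R" by (rule genideal_ideal[OF t])
  have xk: "xs ! k \<in> carrier R" using xs step.hyps by auto
  obtain S where S: "finite S" "S \<subseteq> Z" "module_span R (free_module R m) S = Z"
    by (rule noetherian_submodule_fg[OF module_free noetherian_free_module[OF noeth] Z(1)])
  have "S \<subseteq> carrier (free_module R m)" using S(2) F.submoduleD(1)[OF Z(1)] by blast
  then obtain l p where p: "p \<in> mod_hom R (free_module R l) (free_module R m)" "p ` carrier (free_module R l) = Z"
    using F.finitely_generated_free_surj[OF S(1)] S(3) by metis
  interpret G: module R "free_module R l" by (rule module_free)
  define W where "W = {w \<in> carrier (free_module R l). p w \<in> {..<m} \<rightarrow>\<^sub>E ?A}"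
  have AA: "?A \<subseteq> ?A'" by (rule subset_Idl_subset[OF t]) (simp add: take_Suc_conv_app_nth[OF step.hyps(2)] subset_iff)
  have AZ: "{..<m} \<rightarrow>\<^sub>E ?A \<subseteq> p ` carrier (free_module R l)"
    unfolding p(2) using Z(2) AA PiE_mono[of "{..<m}" "\<lambda>_. ?A" "\<lambda>_. ?A'"] by blast
  \<comment> \<open>This concerns a free module over the quotient ring. Both sequences in
    \<open>koszul_acyclic_parameters\<close> consist of the entries of \<open>xs\<close>, so the
    exponent 1 will do.\<close>
  have acA: "koszul_acyclic_above (free_module R m) (rev xs) k ({..<m} \<rightarrow>\<^sub>E ?A)"
  proof (rule koszul_acyclic_parameters)
    show "\<exists>N::nat. z [^] N \<in> Idl (set (rev xs))" if "z \<in> set xs" for z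
    proof (rule exI[of _ 1])
      have "z [^] (1::nat) = z" by (rule nat_pow_eone) (use that xs in blast)
      then show "z [^] (1::nat) \<in> Idl (set (rev xs))" using that genideal_self[OF xs] by auto
    qed
  qed (use xs reg step.hyps in auto)
  have acZ: "koszul_acyclic_above (free_module R m) (rev xs) (Suc k) (p ` carrier (free_module R l))"
    unfolding p(2) by (rule Z(3))
  have revxs: "set (rev xs) \<subseteq> carrier R" using xs by simp
  have ac: "koszul_acyclic_above (free_module R l) (rev xs) k W"
    unfolding W_def by (rule G.koszul_acyclic_syzygy[OF module_free p(1) revxs submodule_power_ideal[OF A] AZ acZ acA])
  have W: "submodule W R (free_module R l)" unfolding W_def
    by (rule submodule_vimage[OF module_free module_free p(1) submodule_power_ideal[OF A]])
  have AW: "{..<l} \<rightarrow>\<^sub>E ?A \<subseteq> W" unfolding W_def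
    using hom_power_ideal[OF A p(1)] G.submoduleD(1)[OF submodule_power_ideal[OF A]] by blast
  have "kills_ext R ?A' m Z t \<longleftrightarrow> kills_ext R ?A l W t" if "t \<in> carrier R" for t
    by (rule kills_ext_syzygy[OF A xk reg[OF step.hyps(2)] genideal_take_Suc[OF xs step.hyps(2)] p(1) p(2)[symmetric] Z(2) W_def that])
  then have "\<forall>t\<in>carrier R. kills_ext R (Idl (set xs)) n Y t \<longleftrightarrow> kills_ext R ?A l W t" using Z(4) by simp
  then show ?case using W AW ac by blast
qed

subsection \<open>The general element\<close>

context noetherian_local
begin

lemma free_one_iso:
  assumes "f \<in> mod_hom R (quotient_module (free_module R 1) {\<zero>\<^bsub>free_module R 1\<^esub>}) N"
    "bij_betw f (carrier (quotient_module (free_module R 1) {\<zero>\<^bsub>free_module R 1\<^esub>})) (carrier N)"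
  obtains \<theta> where "\<theta> \<in> mod_hom R (regular_module R) N" "bij_betw \<theta> (carrier R) (carrier N)"
proof -
  let ?F = "free_module R 1" let ?Q = "quotient_module ?F {\<zero>\<^bsub>?F\<^esub>}"
  interpret F: module R ?F by (rule module_free)
  interpret Q: module R ?Q by (rule F.module_quotient[OF F.zero_submodule])
  note q = F.quotient_proj[OF F.zero_submodule]
  define c where "c r = (\<lambda>i\<in>{..<1::nat}. r)" for r :: 'a
  have c: "c \<in> mod_hom R (regular_module R) ?F"
    by (rule mod_homI) (auto simp: c_def free_module_simps fun_eq_iff)
  have cb: "bij_betw c (carrier R) (carrier ?F)"
    by (rule bij_betwI[of _ _ _ "\<lambda>v. v 0"])
      (auto simp: c_def free_module_simps fun_eq_iff PiE_iff extensional_def)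
  have "inj_on ((+>\<^bsub>?F\<^esub>) {\<zero>\<^bsub>?F\<^esub>}) (carrier ?F)"
  proof (rule inj_onI)
    fix u v assume u: "u \<in> carrier ?F" and v: "v \<in> carrier ?F"
      and "{\<zero>\<^bsub>?F\<^esub>} +>\<^bsub>?F\<^esub> u = {\<zero>\<^bsub>?F\<^esub>} +>\<^bsub>?F\<^esub> v"
    then have uv: "u \<ominus>\<^bsub>?F\<^esub> v = \<zero>\<^bsub>?F\<^esub>" using F.submodule_coset_eq_iff[OF F.zero_submodule] by simp
    have "u = (u \<ominus>\<^bsub>?F\<^esub> v) \<oplus>\<^bsub>?F\<^esub> v" by (rule F.minus_add_cancel[OF u v, symmetric])
    also have "\<dots> = v" unfolding uv by (rule F.M.l_zero[OF v])
    finally show "u = v" .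
  qed
  then have qb: "bij_betw ((+>\<^bsub>?F\<^esub>) {\<zero>\<^bsub>?F\<^esub>}) (carrier ?F) (carrier ?Q)" using q(2) by (simp add: bij_betw_def)
  have "bij_betw (f \<circ> ((+>\<^bsub>?F\<^esub>) {\<zero>\<^bsub>?F\<^esub>} \<circ> c)) (carrier R) (carrier N)"
    by (rule bij_betw_trans[OF bij_betw_trans[OF cb qb] assms(2)])
  moreover have "(\<lambda>r. f ({\<zero>\<^bsub>?F\<^esub>} +>\<^bsub>?F\<^esub> c r)) \<in> mod_hom R (regular_module R) N"
    by (rule mod_hom_comp[OF mod_hom_comp[OF c q(1)] assms(1)])
  ultimately show ?thesis by (intro that) (simp_all add: o_def)
qed

lemma zero_submodule_free_one: "{\<zero>\<^bsub>free_module R 1\<^esub>} \<noteq> carrier (free_module R 1)"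
proof
  assume "{\<zero>\<^bsub>free_module R 1\<^esub>} = carrier (free_module R 1)"
  then have "unit_vector R 1 0 = \<zero>\<^bsub>free_module R 1\<^esub>" using unit_vector_closed[of 1 0] by blast
  from fun_cong[OF this, of 0] have "\<one> = \<zero>" by (simp add: unit_vector_def free_module_simps)
  then show False using mm.I_notcarr mm.one_imp_carrier mm.zero_closed by metis
qed

text \<open>Induction from larger submodules to smaller ones. If R^n/Y splits, its summands are
  R^n/A and R^n/B with \<open>A\<close> and \<open>B\<close> strictly larger; acyclicity and the
  extension property for \<open>x\<close> pass to them, and the property for \<open>t\<close> comes
  back by additivity. If R^n/Y is indecomposable, it is isomorphic to a member of the list and
  generality applies.\<close>

lemma general_element_kills_ext:
  assumes list: "complete_MCM_list R \<mm> J M" and gen: "general_element R \<mm> J M x"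
    and xs: "set xs \<subseteq> \<mm>" "enat (length xs) = krull_dim R"
    and ac1: "koszul_acyclic_above (free_module R 1) (rev xs) 0 {\<zero>\<^bsub>free_module R 1\<^esub>}"
    and t: "t \<in> \<mm>" and x: "x \<in> carrier R"
    and Y: "submodule Y R (free_module R n)" "koszul_acyclic_above (free_module R n) (rev xs) 0 Y"
    and kx: "extends_after_smult R n Y (regular_module R) x"
  shows "extends_after_smult R n Y (regular_module R) t"
proof -
  let ?F = "free_module R n" let ?R = "regular_module R"
  interpret F: module R ?F by (rule module_free)
  interpret F1: module R "free_module R 1" by (rule module_free)
  have tR: "t \<in> carrier R" using t by (rule mm.Icarr)
  have xsR: "set xs \<subseteq> carrier R" using xs(1) mm.Icarr by blast
  have NF: "noetherian_module R ?F" by (rule noetherian_free_module[OF noetherian_ring_axioms])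
  \<comment> \<open>R is itself an indecomposable maximal Cohen-Macaulay module, so some
    \<open>M k\<close> is isomorphic to it. This places the annihilators of Ext into R among the
    ideals that define generality.\<close>
  let ?R1 = "quotient_module (free_module R 1) {\<zero>\<^bsub>free_module R 1\<^esub>}"
  have "?R1 \<in> indecomposable_MCMs R \<mm>"
    unfolding indecomposable_MCMs_def
    using MCM_quotient_free[OF F1.zero_submodule zero_submodule_free_one xs ac1] indecomposable_regular by blast
  then obtain k where k: "k \<in> J" "module_iso R ?R1 (M k)" using list unfolding complete_MCM_list_def by blast
  then obtain f1 where f1: "f1 \<in> mod_hom R ?R1 (M k)" "bij_betw f1 (carrier ?R1) (carrier (M k))"
    unfolding module_iso_def by blast
  obtain \<theta> where th: "\<theta> \<in> mod_hom R ?R (M k)" "bij_betw \<theta> (carrier R) (carrier (M k))"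
    by (rule free_one_iso[OF f1])
  have MJ: "MCM R \<mm> (M j)" if "j \<in> J" for j
    using list that unfolding complete_MCM_list_def indecomposable_MCMs_def by blast
  have id: "(\<lambda>r. r) \<in> mod_hom R ?R ?R" "bij_betw (\<lambda>r. r) (carrier R) (carrier ?R)"
    by (rule mod_homI) (auto simp: bij_betw_def)
  have Mk: "module R (M k)" using MJ[OF k(1)] unfolding MCM_def by blast
  have conv: "extends_after_smult R n Y (M k) a \<longleftrightarrow> extends_after_smult R n Y ?R a"
    if "submodule Y R ?F" "a \<in> carrier R" for Y a
    using extends_after_smult_iff_kills_ext[OF Mk th that] extends_after_smult_iff_kills_ext[OF module_regular id that]
    by blast
  show ?thesis using Y kx
  proof (induction Y rule: wf_induct_rule[OF noetherian_submodule_wf[OF module_free[of n] NF]])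
    case (1 Y)
    note Y = "1.prems"(1) and ac = "1.prems"(2) and kx = "1.prems"(3)
    note YD = F.submoduleD[OF Y]
    show ?case
    proof (cases "Y = carrier ?F \<or> indecomposable R (quotient_module ?F Y)")
      case True
      show ?thesis
      proof (cases "Y = carrier ?F")
        case True
        show ?thesis unfolding extends_after_smult_def
        proof
          fix g assume "g \<in> mod_hom R (?F\<lparr>carrier := Y\<rparr>) ?R"
          then have g: "g \<in> mod_hom R ?F ?R" by (simp add: True)
          interpret RR: module R ?R by (rule module_regular)
          show "\<exists>h\<in>mod_hom R ?F ?R. \<forall>z\<in>Y. h z = t \<odot>\<^bsub>?R\<^esub> g z"
            by (rule bexI[OF _ mod_hom_comp[OF g RR.smult_mod_hom[OF tR]]]) simp
        qed
      next
        case ne: False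
        let ?N = "quotient_module ?F Y"
        have ind: "indecomposable R ?N" using True ne by blast
        have "?N \<in> indecomposable_MCMs R \<mm>"
          unfolding indecomposable_MCMs_def using MCM_quotient_free[OF Y ne xs ac] ind by blast
        then obtain j where j: "j \<in> J" "module_iso R ?N (M j)" using list unfolding complete_MCM_list_def by blast
        then obtain f where f: "f \<in> mod_hom R ?N (M j)" "bij_betw f (carrier ?N) (carrier (M j))"
          unfolding module_iso_def by blast
        interpret N: module R ?N by (rule F.module_quotient[OF Y])
        note q = F.quotient_proj[OF Y]
        have Mj: "module R (M j)" "finitely_generated R (M j)"
          using MJ[OF j(1)] unfolding MCM_def by blast+
        interpret Mj: module R "M j" by fact
        let ?p = "\<lambda>v. f (Y +>\<^bsub>?F\<^esub> v)"
        have p: "?p \<in> mod_hom R ?F (M j)" by (rule mod_hom_comp[OF q(1) f(1)])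
        have "f ` carrier ?N = carrier (M j)" using f(2) by (simp add: bij_betw_def)
        then have ps: "?p ` carrier ?F = carrier (M j)" unfolding q(2)[symmetric] by (simp add: image_image)
        have inj: "inj_on f (carrier ?N)" using f(2) by (simp add: bij_betw_def)
        have "?p v = \<zero>\<^bsub>M j\<^esub> \<longleftrightarrow> v \<in> Y" if v: "v \<in> carrier ?F" for v
        proof -
          have f0: "f \<zero>\<^bsub>?N\<^esub> = \<zero>\<^bsub>M j\<^esub>" by (rule mod_hom_simps(1)[OF N.module_axioms Mj(1) f(1)])
          have "?p v = \<zero>\<^bsub>M j\<^esub> \<longleftrightarrow> f (Y +>\<^bsub>?F\<^esub> v) = f \<zero>\<^bsub>?N\<^esub>" unfolding f0 ..
          also have "\<dots> \<longleftrightarrow> Y +>\<^bsub>?F\<^esub> v = \<zero>\<^bsub>?N\<^esub>"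
            by (rule inj_on_eq_iff[OF inj mod_homD(1)[OF q(1) v] N.M.zero_closed])
          also have "\<dots> \<longleftrightarrow> v \<in> Y" using q(3) v by blast
          finally show ?thesis .
        qed
        then have ker: "{v \<in> carrier ?F. ?p v = \<zero>\<^bsub>M j\<^esub>} = Y" using YD(1) by blast
        let ?Ann = "annihilator R (Ext R 1 (M j) (M k))"
        have Ann: "a \<in> ?Ann \<longleftrightarrow> a \<in> carrier R \<and> extends_after_smult R n Y ?R a" for a
          using annihilator_Ext_iff[OF noetherian_ring_axioms Mj Mk p ps, of a] conv[OF Y, of a]
          unfolding ker by blast
        have "?Ann \<in> Ext_annihilators R J M" unfolding Ext_annihilators_def using j(1) k(1) by blast
        moreover have "x \<in> ?Ann" using Ann kx x by blast
        \<comment> \<open>A general element lies in no other member of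
          \<open>Ext_annihilators\<close>, and both of these contain \<open>t\<close>.\<close>
        ultimately have "?Ann = carrier R \<or> ?Ann = \<mm>" using gen unfolding general_element_def by blast
        then have "t \<in> ?Ann" using t tR by blast
        then show ?thesis using Ann by blast
      qed
    next
      case False
      then have ne: "Y \<noteq> carrier ?F" and nind: "\<not> indecomposable R (quotient_module ?F Y)" by simp_all
      have "\<exists>A B. submodule A R ?F \<and> submodule B R ?F \<and> A \<inter> B = Y \<and>
        (\<forall>v\<in>carrier ?F. \<exists>a\<in>A. \<exists>b\<in>B. v = a \<oplus>\<^bsub>?F\<^esub> b) \<and> A \<noteq> Y \<and> B \<noteq> Y"
      proof (rule ccontr)
        assume neg: "\<not> ?thesis"
        have "indecomposable R (quotient_module ?F Y)"
          by (rule F.indecomposable_quotientI[OF Y ne]) (use neg in blast)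
        with nind show False by simp
      qed
      then obtain A B where A: "submodule A R ?F" and B: "submodule B R ?F" and AB: "A \<inter> B = Y"
        and sum: "\<And>v. v \<in> carrier ?F \<Longrightarrow> \<exists>a\<in>A. \<exists>b\<in>B. v = a \<oplus>\<^bsub>?F\<^esub> b" and ne': "A \<noteq> Y" "B \<noteq> Y" by blast
      have sub: "Y \<subseteq> A" "Y \<subseteq> B" using AB by blast+
      note AD = F.submoduleD[OF A] and BD = F.submoduleD[OF B]
      obtain P Q where P: "P \<in> mod_hom R ?F ?F" and Q: "Q \<in> mod_hom R ?F ?F"
        and PA: "\<And>v. v \<in> carrier ?F \<Longrightarrow> P v \<in> A" and QB: "\<And>v. v \<in> carrier ?F \<Longrightarrow> Q v \<in> B"
        and PQ: "\<And>v. v \<in> carrier ?F \<Longrightarrow> v = P v \<oplus>\<^bsub>?F\<^esub> Q v"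
        by (rule decomposition_projections[OF A B sum], assumption, rule that)
      have vP: "v \<ominus>\<^bsub>?F\<^esub> P v = Q v" if v: "v \<in> carrier ?F" for v
        using F.add_minus_cancel_left[OF AD(1)[OF PA[OF v]] BD(1)[OF QB[OF v]]] PQ[OF v] by simp
      have QP: "v = Q v \<oplus>\<^bsub>?F\<^esub> P v" if v: "v \<in> carrier ?F" for v
        using PQ[OF v] F.a_comm[OF AD(1)[OF PA[OF v]] BD(1)[OF QB[OF v]]] by simp
      have vQ: "v \<ominus>\<^bsub>?F\<^esub> Q v = P v" if v: "v \<in> carrier ?F" for v
        using F.add_minus_cancel_left[OF BD(1)[OF QB[OF v]] AD(1)[OF PA[OF v]]] QP[OF v] by simp
      \<comment> \<open>For v in \<open>A\<close> the vector Q v = v - P v lies in \<open>A\<close>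
        as well as in \<open>B\<close>.\<close>
      have QY: "Q v \<in> Y" if v: "v \<in> A" for v
      proof -
        have "v \<ominus>\<^bsub>?F\<^esub> P v \<in> A" by (rule AD(5)[OF v PA[OF AD(1)[OF v]]])
        then show ?thesis using vP[OF AD(1)[OF v]] QB[OF AD(1)[OF v]] AB by auto
      qed
      have PY: "P v \<in> Y" if v: "v \<in> B" for v
      proof -
        have "v \<ominus>\<^bsub>?F\<^esub> Q v \<in> B" by (rule BD(5)[OF v QB[OF BD(1)[OF v]]])
        then show ?thesis using vQ[OF BD(1)[OF v]] PA[OF BD(1)[OF v]] AB by auto
      qed
      have revR: "set (rev xs) \<subseteq> carrier R" using xsR by simp
      have acA: "koszul_acyclic_above ?F (rev xs) 0 A"
        by (rule F.koszul_acyclic_summand[OF revR A sub(1) Q QY _ ac]) (simp_all add: vQ PA)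
      have acB: "koszul_acyclic_above ?F (rev xs) 0 B"
        by (rule F.koszul_acyclic_summand[OF revR B sub(2) P PY _ ac]) (simp_all add: vP QB)
      have kxA: "extends_after_smult R n A ?R x"
        by (rule extends_after_smult_summand[OF module_regular A Y sub(1) P PA QY PQ x kx])
      have kxB: "extends_after_smult R n B ?R x"
        by (rule extends_after_smult_summand[OF module_regular B Y sub(2) Q QB PY QP x kx])
      have ktA: "extends_after_smult R n A ?R t"
        by (rule "1.IH"[OF _ A acA kxA]) (use A Y sub ne' in blast)
      have ktB: "extends_after_smult R n B ?R t"
        by (rule "1.IH"[OF _ B acB kxB]) (use B Y sub ne' in blast)
      show ?thesis
        by (rule extends_after_smult_direct_sum[OF module_regular A B Y sub P PY Q QY PQ tR ktA ktB])
    qed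
  qed
qed

end

section \<open>From colon ideals to an extension problem over the quotient by the parameters\<close>

theorem corollary3p3:
  fixes R :: "('a, 'r) ring_scheme" (structure)
    and \<mm> :: "'a set"
    and J :: "'i set"
    and M :: "'i \<Rightarrow> 'a fg_module"
    and xs :: "'a list"
    and I :: "'a set"
  assumes "cohen_macaulay_local_ring R \<mm>"
    and "countable_CM_type R \<mm>"
    and "uncountable (carrier (R Quot \<mm>))"
    and "complete_MCM_list R \<mm> J M"
    and "general_system_of_parameters R \<mm> J M xs"
    and "ideal I R"
  shows "\<mm> \<cdot> colon_ideal R (Idl (set xs)) (colon_ideal R (Idl (set xs)) I) \<subseteq> Idl (set xs) <+> I"
proof -
  let ?J = "Idl (set xs)" and ?Reg = "regular_module R"
  have nl: "noetherian_local_ring R \<mm>" using assms(1) by (simp add: cohen_macaulay_local_ring_def)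
  interpret noetherian_local R \<mm>
    using nl unfolding noetherian_local_ring_def noetherian_local_def noetherian_local_axioms_def by blast
  obtain ys where ys: "set ys \<subseteq> \<mm>" "regular_sequence R ?Reg ys" "enat (length ys) = krull_dim R"
    using assms(1) unfolding cohen_macaulay_local_ring_def by blast
  have xs: "set xs \<subseteq> \<mm>" "enat (length xs) = krull_dim R" and rad: "radical R ?J = \<mm>"
    using assms(5) by (simp_all add: general_system_of_parameters_def system_of_parameters_def)
  obtain x where x: "x \<in> ?J" "general_element R \<mm> J M x"
    using assms(5) unfolding general_system_of_parameters_def by blast
  have len: "length ys = length (rev xs)" using ys(3) xs(2) by (metis enat.inject length_rev)
  have xsR: "set xs \<subseteq> carrier R" and ysR: "set ys \<subseteq> carrier R" using xs(1) ys(1) mm.Icarr by blast+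
  have revR: "set (rev xs) \<subseteq> carrier R" using xsR by simp
  have Ji: "ideal ?J R" by (rule genideal_ideal[OF xsR])
  interpret J: cring_ideal ?J R by (intro cring_ideal.intro Ji is_cring)
  interpret I: ideal I R by fact
  interpret F1: module R "free_module R 1" by (rule module_free)

  \<comment> \<open>\<open>\<mm>\<close> is the radical of the parameter ideal, so powers of the
    entries of \<open>ys\<close> lie in it. With rank 1 and \<open>k = 0\<close> this turns the
    regularity of \<open>ys\<close> into acyclicity of the Koszul complex on \<open>xs\<close> over
    R.\<close>
  have "\<exists>N::nat. y [^] N \<in> Idl (set (rev xs))" if "y \<in> set ys" for y
  proof -
    have "y \<in> radical R ?J" using that ys(1) rad by blast
    then show ?thesis unfolding radical_def by simp
  qed
  from koszul_acyclic_parameters[OF revR ysR len regular_sequence_regular_module[OF ysR ys(2)] this, of 0 1]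
  have "koszul_acyclic_above (free_module R 1) (rev xs) 0 ({..<1} \<rightarrow>\<^sub>E Idl {})" by simp
  moreover have "Idl {} = {\<zero>}"
    using genideal_minimal[OF zeroideal, of "{}"] additive_subgroup.zero_closed[OF ideal.axioms(1)[OF genideal_ideal[of "{}"]]] by auto
  moreover have pz: "{..<n} \<rightarrow>\<^sub>E {\<zero>} = {\<zero>\<^bsub>free_module R n\<^esub>}" for n
    by (auto simp: free_module_simps fun_eq_iff PiE_iff extensional_def)
  ultimately have ac1: "koszul_acyclic_above (free_module R 1) (rev xs) 0 {\<zero>\<^bsub>free_module R 1\<^esub>}" by simp

  \<comment> \<open>Acyclicity returns regularity, now of \<open>xs\<close>, first on R^1/0 and then
    through the coordinate map on R. The syzygy ladder cancels these elements.\<close>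
  have "regular_sequence R (quotient_module (free_module R 1) {\<zero>\<^bsub>free_module R 1\<^esub>}) xs"
    by (rule regular_sequence_quotient_free[OF F1.zero_submodule zero_submodule_free_one xs(1) ac1])
  moreover have "(\<lambda>v. v 0) \<in> mod_hom R (free_module R 1) ?Reg"
    by (rule mod_homI) (auto simp: free_module_simps)
  moreover have "(\<lambda>v. v 0) ` carrier (free_module R 1) = carrier ?Reg"
  proof (intro equalityI subsetI)
    fix r assume "r \<in> carrier ?Reg"
    then show "r \<in> (\<lambda>v. v 0) ` carrier (free_module R 1)"
      by (intro image_eqI[of _ _ "\<lambda>i\<in>{..<1}. r"]) (auto simp: free_module_simps)
  qed (auto simp: free_module_simps)
  moreover have "\<forall>v\<in>carrier (free_module R 1). v 0 = \<zero>\<^bsub>?Reg\<^esub> \<longleftrightarrow> v \<in> {\<zero>\<^bsub>free_module R 1\<^esub>}"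
    by (auto simp: free_module_simps fun_eq_iff PiE_iff extensional_def)
  ultimately have "regular_sequence R ?Reg xs"
    using F1.regular_sequence_iff[OF module_regular _ _ _ F1.zero_submodule xsR, of "\<lambda>v. v 0"]
      F1.regular_sequence_iff[OF F1.module_quotient[OF F1.zero_submodule] F1.quotient_proj[OF F1.zero_submodule] F1.zero_submodule xsR]
    by blast
  note reg = regular_sequence_regular_module[OF xsR this]

  obtain S where S: "S \<subseteq> carrier R" "finite S" "I = Idl S" using finetely_gen[OF assms(6)] by blast
  obtain n :: nat and s where s: "S = s ` {..<n}"
    using finite_imp_nat_seg_image_inj_on[OF S(2)] by (auto simp: lessThan_def)
  let ?F = "free_module R n"
  interpret F: module R ?F by (rule module_free)
  define a where "a = (\<lambda>i\<in>{..<n}. s i)"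
  have SI: "S \<subseteq> I" unfolding S(3) by (rule genideal_self[OF S(1)])
  have aI: "a \<in> {..<n} \<rightarrow>\<^sub>E I" using SI s by (auto simp: a_def)
  have aF: "a \<in> carrier ?F" using S(1) s by (auto simp: a_def free_module_simps)
  let ?P = "{..<n} \<rightarrow>\<^sub>E ?J"
  have Ps: "submodule ?P R ?F" by (rule submodule_power_ideal[OF Ji])
  note PD = F.submoduleD[OF Ps]
  define Y where "Y = {v \<in> carrier ?F. \<exists>r\<in>carrier R. v \<ominus>\<^bsub>?F\<^esub> r \<odot>\<^bsub>?F\<^esub> a \<in> ?P}"
  have YI: "v \<in> Y" if "v \<in> carrier ?F" "r \<in> carrier R" "v \<ominus>\<^bsub>?F\<^esub> r \<odot>\<^bsub>?F\<^esub> a \<in> ?P" for v r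
    using that unfolding Y_def by blast
  have YF: "v \<in> carrier ?F" if "v \<in> Y" for v using that unfolding Y_def by blast
  have "\<forall>v. \<exists>r. v \<in> Y \<longrightarrow> r \<in> carrier R \<and> v \<ominus>\<^bsub>?F\<^esub> r \<odot>\<^bsub>?F\<^esub> a \<in> ?P" unfolding Y_def by blast
  \<comment> \<open>A coefficient of \<open>a\<close> in \<open>v\<close> modulo J^n. It is
    determined only up to those r for which r a lies in J^n; the next two facts are its additivity
    and homogeneity in this weak sense.\<close>
  then obtain c where c: "\<And>v. v \<in> Y \<Longrightarrow> c v \<in> carrier R" "\<And>v. v \<in> Y \<Longrightarrow> v \<ominus>\<^bsub>?F\<^esub> c v \<odot>\<^bsub>?F\<^esub> a \<in> ?P" by metis
  have cadd: "(u \<oplus>\<^bsub>?F\<^esub> v) \<ominus>\<^bsub>?F\<^esub> (c u \<oplus> c v) \<odot>\<^bsub>?F\<^esub> a \<in> ?P" if u: "u \<in> Y" and v: "v \<in> Y" for u v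
  proof -
    have "(u \<oplus>\<^bsub>?F\<^esub> v) \<ominus>\<^bsub>?F\<^esub> (c u \<oplus> c v) \<odot>\<^bsub>?F\<^esub> a = (u \<ominus>\<^bsub>?F\<^esub> c u \<odot>\<^bsub>?F\<^esub> a) \<oplus>\<^bsub>?F\<^esub> (v \<ominus>\<^bsub>?F\<^esub> c v \<odot>\<^bsub>?F\<^esub> a)"
      unfolding F.smult_l_distr[OF c(1)[OF u] c(1)[OF v] aF]
      by (rule F.minus_add_distrib4) (use YF[OF u] YF[OF v] c(1)[OF u] c(1)[OF v] aF in simp_all)
    then show ?thesis using PD(3)[OF c(2)[OF u] c(2)[OF v]] by simp
  qed
  have csmult: "(r \<odot>\<^bsub>?F\<^esub> v) \<ominus>\<^bsub>?F\<^esub> (r \<otimes> c v) \<odot>\<^bsub>?F\<^esub> a \<in> ?P" if r: "r \<in> carrier R" and v: "v \<in> Y" for r v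
  proof -
    have "(r \<odot>\<^bsub>?F\<^esub> v) \<ominus>\<^bsub>?F\<^esub> (r \<otimes> c v) \<odot>\<^bsub>?F\<^esub> a = r \<odot>\<^bsub>?F\<^esub> (v \<ominus>\<^bsub>?F\<^esub> c v \<odot>\<^bsub>?F\<^esub> a)"
      using YF[OF v] c(1)[OF v] aF r by (simp add: F.smult_minus_distr F.smult_assoc1)
    then show ?thesis using PD(6)[OF r c(2)[OF v]] by simp
  qed
  have PY: "v \<ominus>\<^bsub>?F\<^esub> \<zero> \<odot>\<^bsub>?F\<^esub> a \<in> ?P" if "v \<in> ?P" for v
    using that PD(1)[OF that] aF by simp
  have Ysub: "submodule Y R ?F"
  proof (rule F.submoduleI')
    show "Y \<subseteq> carrier ?F" using YF by blast
    show "\<zero>\<^bsub>?F\<^esub> \<in> Y" by (rule YI[OF F.M.zero_closed _ PY[OF PD(2)]]) simp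
    show "u \<oplus>\<^bsub>?F\<^esub> v \<in> Y" if "u \<in> Y" "v \<in> Y" for u v
      by (rule YI[OF _ _ cadd[OF that]]) (use YF c(1) that in simp_all)
    show "r \<odot>\<^bsub>?F\<^esub> v \<in> Y" if "r \<in> carrier R" "v \<in> Y" for r v
      by (rule YI[OF _ _ csmult[OF that]]) (use YF c(1) that in simp_all)
  qed
  have PsubY: "?P \<subseteq> Y" using YI[OF PD(1) _ PY] by blast

  have "x \<in> carrier R" by (rule J.Icarr[OF x(1)])
  \<comment> \<open>\<open>x\<close> lies in J, so x g is zero modulo J and the zero map extends
    it.\<close>
  have kx: "kills_ext R ?J n Y x" unfolding kills_ext_def
  proof (intro allI impI)
    fix g assume "linear_mod R ?J ?F Y g \<and> (\<forall>v\<in>?P. g v \<in> ?J)"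
    then have lin: "linear_mod R ?J ?F Y g" by (rule conjunct1)
    note gR = linear_modD(1)[OF lin]
    have z: "(\<lambda>v. \<zero>) \<in> mod_hom R ?F ?Reg" by (rule mod_homI) auto
    show "\<exists>h\<in>mod_hom R ?F ?Reg. \<forall>v\<in>Y. ?J +> (x \<otimes> g v) = ?J +> h v"
    proof (intro bexI[OF _ z] ballI)
      fix v assume v: "v \<in> Y"
      have "x \<otimes> g v \<in> ?J" by (rule J.I_r_closed[OF x(1) gR[OF v]])
      then show "?J +> (x \<otimes> g v) = ?J +> \<zero>"
        using J.proj_eq_iff[of "x \<otimes> g v" \<zero>] gR[OF v] \<open>x \<in> carrier R\<close> by (simp add: minus_eq)
    qed
  qed
  obtain m Z where Z: "submodule Z R (free_module R m)" "koszul_acyclic_above (free_module R m) (rev xs) 0 Z"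
    "\<forall>t\<in>carrier R. kills_ext R ?J n Y t \<longleftrightarrow> kills_ext R {\<zero>} m Z t"
  proof -
    have "\<exists>m Z. submodule Z R (free_module R m) \<and> {..<m} \<rightarrow>\<^sub>E Idl (set (take 0 xs)) \<subseteq> Z
        \<and> koszul_acyclic_above (free_module R m) (rev xs) 0 Z
        \<and> (\<forall>t\<in>carrier R. kills_ext R ?J n Y t \<longleftrightarrow> kills_ext R (Idl (set (take 0 xs))) m Z t)"
      by (rule syzygy_ladder[OF noetherian_ring_axioms xsR _ Ysub PsubY]) (simp_all add: reg)
    then show thesis unfolding take_0 list.set(1) \<open>Idl {} = {\<zero>}\<close> by (elim exE conjE) (rule that)
  qed
  have id: "(\<lambda>r. r) \<in> mod_hom R ?Reg ?Reg" "bij_betw (\<lambda>r. r) (carrier R) (carrier ?Reg)"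
    by (rule mod_homI) (auto simp: bij_betw_def)
  note conv = extends_after_smult_iff_kills_ext[OF module_regular id Z(1)]
  \<comment> \<open>Up the ladder with \<open>x\<close>, over R from \<open>x\<close> to
    \<open>t\<close>, and down the ladder with \<open>t\<close>.\<close>
  have kt: "kills_ext R ?J n Y t" if t: "t \<in> \<mm>" for t
  proof -
    have tR: "t \<in> carrier R" using t by (rule mm.Icarr)
    have "extends_after_smult R m Z ?Reg x" using kx Z(3) conv[OF \<open>x \<in> carrier R\<close>] \<open>x \<in> carrier R\<close> by blast
    then have "extends_after_smult R m Z ?Reg t"
      by (rule general_element_kills_ext[OF assms(4) x(2) xs ac1 t \<open>x \<in> carrier R\<close> Z(1,2)])
    then show ?thesis using Z(3) conv[OF tR] tR by blast
  qed

  let ?C = "colon_ideal R ?J I"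
  have main: "t \<otimes> u \<in> ?J <+> I" if t: "t \<in> \<mm>" and u: "u \<in> colon_ideal R ?J ?C" for t u
  proof -
    have tR: "t \<in> carrier R" using t by (rule mm.Icarr)
    have uR: "u \<in> carrier R" and uC: "\<And>r. r \<in> ?C \<Longrightarrow> u \<otimes> r \<in> ?J" using u by (auto simp: colon_ideal_def)
    \<comment> \<open>This makes r a |-> r u well defined modulo J: if r a has entries in J, then r
      multiplies the generators of I, and so all of I, into J. That is, r lies in J : I, which
      \<open>u\<close> multiplies into J.\<close>
    have ru: "r \<otimes> u \<in> ?J" if r: "r \<in> carrier R" and ra: "r \<odot>\<^bsub>?F\<^esub> a \<in> ?P" for r
    proof -
      have "submodule {b \<in> carrier ?Reg. r \<odot>\<^bsub>?Reg\<^esub> b \<in> ?J} R ?Reg"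
        by (rule submodule_vimage[OF module_regular module_regular module.smult_mod_hom[OF module_regular r]])
          (simp add: submodule_regular_iff Ji)
      then have "ideal {b \<in> carrier R. r \<otimes> b \<in> ?J} R" by (simp add: submodule_regular_iff)
      moreover have "S \<subseteq> {b \<in> carrier R. r \<otimes> b \<in> ?J}"
      proof
        fix b assume b: "b \<in> S"
        then obtain i where i: "i < n" "b = s i" using s by auto
        then show "b \<in> {b \<in> carrier R. r \<otimes> b \<in> ?J}"
          using PiE_mem[OF ra, of i] b S(1) by (auto simp: free_module_simps a_def)
      qed
      ultimately have "I \<subseteq> {b \<in> carrier R. r \<otimes> b \<in> ?J}" unfolding S(3) by (rule genideal_minimal)
      then have "r \<in> ?C" unfolding colon_ideal_def using r by blast
      then show ?thesis using uC m_comm[OF uR r] by metis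
    qed
    define g where "g v = c v \<otimes> u" for v
    have gR: "g v \<in> carrier R" if "v \<in> Y" for v unfolding g_def using c(1)[OF that] uR by simp
    have g_eq: "?J +> g v = ?J +> (r \<otimes> u)" if v: "v \<in> Y" and r: "r \<in> carrier R" and vr: "v \<ominus>\<^bsub>?F\<^esub> r \<odot>\<^bsub>?F\<^esub> a \<in> ?P" for v r
    proof -
      have ca: "c v \<odot>\<^bsub>?F\<^esub> a \<in> carrier ?F" "r \<odot>\<^bsub>?F\<^esub> a \<in> carrier ?F" using c(1)[OF v] r aF by simp_all
      have "(v \<ominus>\<^bsub>?F\<^esub> r \<odot>\<^bsub>?F\<^esub> a) \<ominus>\<^bsub>?F\<^esub> (v \<ominus>\<^bsub>?F\<^esub> c v \<odot>\<^bsub>?F\<^esub> a) = (c v \<ominus> r) \<odot>\<^bsub>?F\<^esub> a"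
        unfolding F.smult_minus_distr2[OF c(1)[OF v] r aF]
        using YF[OF v] ca by (simp add: F.minus_eq F.minus_add F.a_ac F.r_neg1 F.r_neg2 F.add_cancel_far)
      then have "(c v \<ominus> r) \<odot>\<^bsub>?F\<^esub> a \<in> ?P" using PD(5)[OF vr c(2)[OF v]] by simp
      then have "(c v \<ominus> r) \<otimes> u \<in> ?J" by (rule ru[OF minus_closed[OF c(1)[OF v] r]])
      also have "(c v \<ominus> r) \<otimes> u = g v \<ominus> r \<otimes> u" using c(1)[OF v] r uR by (simp add: g_def minus_eq l_distr l_minus)
      finally show ?thesis using J.proj_eq_iff[OF gR[OF v], of "r \<otimes> u"] r uR by simp
    qed
    have lin: "linear_mod R ?J ?F Y g"
    proof (rule linear_modI[OF gR])
      fix v w assume v: "v \<in> Y" and w: "w \<in> Y"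
      have "?J +> g (v \<oplus>\<^bsub>?F\<^esub> w) = ?J +> ((c v \<oplus> c w) \<otimes> u)"
        by (rule g_eq[OF F.submoduleD(3)[OF Ysub v w] _ cadd[OF v w]]) (use c(1) v w in simp)
      also have "(c v \<oplus> c w) \<otimes> u = g v \<oplus> g w" unfolding g_def by (rule l_distr[OF c(1)[OF v] c(1)[OF w] uR])
      finally show "?J +> g (v \<oplus>\<^bsub>?F\<^esub> w) = ?J +> (g v \<oplus> g w)" .
    next
      fix r v assume r: "r \<in> carrier R" and v: "v \<in> Y"
      have "?J +> g (r \<odot>\<^bsub>?F\<^esub> v) = ?J +> ((r \<otimes> c v) \<otimes> u)"
        by (rule g_eq[OF F.submoduleD(6)[OF Ysub r v] _ csmult[OF r v]]) (use c(1) r v in simp)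
      also have "(r \<otimes> c v) \<otimes> u = r \<otimes> g v" unfolding g_def by (rule m_assoc[OF r c(1)[OF v] uR])
      finally show "?J +> g (r \<odot>\<^bsub>?F\<^esub> v) = ?J +> (r \<otimes> g v)" .
    qed
    have gP: "g v \<in> ?J" if v: "v \<in> ?P" for v
    proof -
      have vY: "v \<in> Y" using PsubY v by blast
      have "?J +> g v = ?J +> (\<zero> \<otimes> u)" by (rule g_eq[OF vY zero_closed PY[OF v]])
      also have "\<dots> = \<zero>\<^bsub>R Quot ?J\<^esub>" using uR J.proj_zero_iff[of "\<zero> \<otimes> u"] by simp
      finally show ?thesis using J.proj_zero_iff[OF gR[OF vY]] by blast
    qed
    obtain h where h: "h \<in> mod_hom R ?F ?Reg" "\<And>v. v \<in> Y \<Longrightarrow> ?J +> (t \<otimes> g v) = ?J +> h v"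
      by (rule kills_extD[OF kt[OF t] lin gP], assumption, rule that)
    have one: "a \<ominus>\<^bsub>?F\<^esub> \<one> \<odot>\<^bsub>?F\<^esub> a \<in> ?P" using aF PD(2) by (simp add: F.minus_eq F.r_neg)
    have aY: "a \<in> Y" by (rule YI[OF aF one_closed one])
    \<comment> \<open>\<open>h\<close> is a linear form on R^n and \<open>a\<close> has entries in
      I. Since g has the value u at \<open>a\<close> modulo J, the product t u differs from an
      element of I by an element of J.\<close>
    have ha: "h a \<in> I" by (rule hom_power_ideal_regular[OF assms(6) h(1) aI])
    have haR: "h a \<in> carrier R" by (rule I.Icarr[OF ha])
    have ga: "?J +> g a = ?J +> u" using g_eq[OF aY one_closed one] uR by simp
    have "?J +> (t \<otimes> u) = ?J +> (t \<otimes> g a)" using ga tR uR gR[OF aY] by simp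
    also have "\<dots> = ?J +> h a" by (rule h(2)[OF aY])
    finally have d: "t \<otimes> u \<ominus> h a \<in> ?J" using J.proj_eq_iff[of "t \<otimes> u" "h a"] tR uR haR by simp
    have "t \<otimes> u = (t \<otimes> u \<ominus> h a) \<oplus> h a" using tR uR haR by (simp add: minus_eq a_assoc l_neg)
    then show ?thesis unfolding set_add_def' using d ha by blast
  qed
  interpret JI: ideal "?J <+>\<^bsub>R\<^esub> I" R by (rule add_ideals[OF Ji assms(6)])
  show ?thesis
  proof
    fix z assume "z \<in> \<mm> \<cdot> colon_ideal R ?J ?C"
    then show "z \<in> ?J <+> I" by (induction rule: ideal_prod.induct) (simp_all add: main)
  qed
qed

end
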